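(* Let $A$ be a pro-$C^{*}$-algebra, let $E$ be a Hilbert $A$-module which is countably generated in its multiplier module $M(E)$, and let $\{h_n\}_n$ be a standard frame of multipliers in $E$. Let $\theta:E\to H_A$, $\theta(\xi)=(\langle h_n,\xi\rangle_{M(E)})_n$, be the frame transform for $\{h_n\}_n$. Then $\theta$ is an adjointable module morphism which realizes an embedding of $E$ onto an orthogonal summand of $H_A$, and $\theta^{*}\circ e_n=h_n$ for all $n$. Moreover, $\theta^{*}\circ\theta$ is an invertible element in $b(L(E))$.
   Context: A pro-$C^{*}$-algebra $A$ is a complete Hausdorff topological $*$-algebra over $\mathbb{C}$ whose topology is given by a directed family of $C^{*}$-seminorms; $S(A)$ is the directed set of all continuous $C^{*}$-seminorms on $A$ (no unit is assumed). A pre-Hilbert $A$-module is a complex vector space $E$ that is a right $A$-module (compatibly with the complex algebra structure) with an $A$-valued inner product $\langle\cdot,\cdot\rangle_E$, $\mathbb{C}$- and $A$-linear in the second variable, with $\langle\xi,\eta\rangle_E^{*}=\langle\eta,\xi\rangle_E$, $\langle\xi,\xi\rangle_E\ge 0$, and $\langle\xi,\xi\rangle_E=0$ iff $\xi=0$. It is a Hilbert $A$-module if it is complete for the topology given by the seminorms $\overline{p}_E(\xi)=\sqrt{p(\langle\xi,\xi\rangle_E)}$, $p\in S(A)$. $A$ itself is a Hilbert $A$-module with $\langle a,b\rangle_A=a^{*}b$. $L(E,F)$ denotes the set of adjointable module morphisms $T:E\to F$ between Hilbert $A$-modules (those having a module morphism $T^{*}:F\to E$ with $\langle T\xi,\eta\rangle_F=\langle\xi,T^{*}\eta\rangle_E$),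 topologized by the seminorms $\widetilde{p}_{L(E,F)}(T)=\sup\{\overline{p}_F(T\xi): \xi\in E,\ \overline{p}_E(\xi)\le 1\}$, $p\in S(A)$; $L(E)=L(E,E)$ is a pro-$C^{*}$-algebra. $b(L(E))$ is the set of bounded elements, i.e. $T\in L(E)$ with $\|T\|_\infty=\sup_{p\in S(A)}\widetilde{p}_{L(E)}(T)<\infty$; it is a $C^{*}$-algebra, and "invertible element in $b(L(E))$" means that the inverse also lies in $b(L(E))$. The multiplier module of $E$ is $M(E)=L(A,E)$, a Hilbert module over $M(A)=L(A)$ with action $T\cdot S=T\circ S$ and inner product $\langle T,R\rangle_{M(E)}=T^{*}\circ R$. $E$ is identified with a submodule of $M(E)$ through $\xi\mapsto(a\mapsto \xi a)$. For $h\in M(E)$, $\xi\in E$, $a\in A$: $\langle h,\xi\rangle_{M(E)}=h^{*}(\xi)\in A$, $\langle\xi,h\rangle_{M(E)}=h^{*}(\xi)^{*}$, and $h\cdot a$ is identified with $h(a)\in E$. $E$ is countably generated in $M(E)$ if there is a countable set $\{g_n\}_{n\ge1}\subseteq M(E)$ such that the closed submodule of $M(E)$ generated by $\{g_n\cdot a: a\in A,\ n=1,2,\dots\}$ is the whole of $E$. A sequence $\{h_n\}_n$ in $M(E)$ is a standard frame of multipliers in $E$ if for each $\xi\in E$ the series $\sum_n\langle\xi,h_n\rangle_{M(E)}\langle h_n,\xi\rangle_{M(E)}$ converges in $A$ and there are positive constants $C,D$ with $C\langle\xi,\xi\rangle_E\le\sum_n\langle\xi,h_n\rangle_{M(E)}\langle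 h_n,\xi\rangle_{M(E)}\le D\langle\xi,\xi\rangle_E$ for all $\xi\in E$. $H_A$ is the Hilbert $A$-module of all sequences $(a_n)_n$ in $A$ such that $\sum_n a_n^{*}a_n$ converges in $A$, with $(a_n)_nb=(a_nb)_n$ and $\langle(a_n)_n,(b_n)_n\rangle_{H_A}=\sum_na_n^{*}b_n$. For each positive integer $n$, $e_n\in M(H_A)=L(A,H_A)$ is the map sending $a$ to the sequence whose $n$-th component is $a$ and whose other components are $0$. For a standard frame of multipliers, $(\langle h_n,\xi\rangle_{M(E)})_n\in H_A$ for every $\xi\in E$, so $\theta$ is well defined. "Embedding onto an orthogonal summand" means that $\theta$ is injective, a homeomorphism onto its image, and $\theta(E)$ is a closed submodule with $H_A=\theta(E)\oplus\theta(E)^{\perp}$. *)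

theory Defs
  imports "HOL-Analysis.Analysis" "HOL-Library.Function_Algebras"
begin

text \<open>
  Addition on carriers is that of an ambient type of class \<open>ab_group_add\<close>. For function types
  (sequences in an algebra, maps between modules) it is the pointwise one of
  \<open>Function_Algebras\<close>; the product topology on function types is never used.
\<close>

section \<open>Topologies given by families of seminorms\<close>

definition (in ab_group_add) seminorm_topology :: "'a set \<Rightarrow> ('a \<Rightarrow> real) set \<Rightarrow> 'a topology" where
  "seminorm_topology X P = topology_generated_by
     (insert X {{y \<in> X. p (y - x) < \<epsilon>} | p x \<epsilon>. p \<in> P \<and> x \<in> X \<and> \<epsilon> > 0})"

text \<open>Every Cauchy filter (equivalently, every Cauchy net) on \<open>X\<close> converges to a point of \<open>X\<close>.\<close>

definition (in ab_group_add) seminorm_complete :: "'a set \<Rightarrow> ('a \<Rightarrow> real) set \<Rightarrow> bool" where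
  "seminorm_complete X P \<longleftrightarrow>
     (\<forall>F. F \<noteq> bot \<and> F \<le> principal X \<and>
          (\<forall>p\<in>P. \<forall>\<epsilon>>0. \<forall>\<^sub>F (x, y) in F \<times>\<^sub>F F. p (x - y) < \<epsilon>)
        \<longrightarrow> (\<exists>l\<in>X. \<forall>p\<in>P. ((\<lambda>x. p (x - l)) \<longlongrightarrow> 0) F))"

section \<open>Pro-C*-algebras\<close>

class complex_star_algebra = ring +
  fixes scaleC :: "complex \<Rightarrow> 'a \<Rightarrow> 'a"
    and star :: "'a \<Rightarrow> 'a"
  assumes scaleC_add_right: "scaleC c (x + y) = scaleC c x + scaleC c y"
    and scaleC_add_left: "scaleC (c + d) x = scaleC c x + scaleC d x"
    and scaleC_scaleC: "scaleC c (scaleC d x) = scaleC (c * d) x"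
    and scaleC_one: "scaleC 1 x = x"
    and mult_scaleC_left: "scaleC c x * y = scaleC c (x * y)"
    and mult_scaleC_right: "x * scaleC c y = scaleC c (x * y)"
    and star_add: "star (x + y) = star x + star y"
    and star_scaleC: "star (scaleC c x) = scaleC (cnj c) (star x)"
    and star_mult: "star (x * y) = star y * star x"
    and star_star: "star (star x) = x"

definition (in complex_star_algebra) cstar_seminorm :: "('a \<Rightarrow> real) \<Rightarrow> bool" where
  "cstar_seminorm p \<longleftrightarrow>
     (\<forall>x y. p (x + y) \<le> p x + p y) \<and>
     (\<forall>c x. p (scaleC c x) = cmod c * p x) \<and>
     (\<forall>x y. p (x * y) \<le> p x * p y) \<and>
     (\<forall>x. p (star x * x) = (p x)\<^sup>2)"

text \<open>
  Hausdorffness is \<open>t2_space\<close>. Continuity of the algebra operations and of the involution is a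
  consequence of the topology being given by C*-seminorms.
\<close>

class pro_cstar_algebra = complex_star_algebra + t2_space +
  assumes pro_cstar_topology:
    "\<exists>\<Gamma>. \<Gamma> \<noteq> {} \<and> (\<forall>p\<in>\<Gamma>. cstar_seminorm p) \<and>
       (\<forall>p\<in>\<Gamma>. \<forall>q\<in>\<Gamma>. \<exists>r\<in>\<Gamma>. \<forall>x. p x \<le> r x \<and> q x \<le> r x) \<and>
       (\<forall>U. open U \<longleftrightarrow> openin (seminorm_topology UNIV \<Gamma>) U) \<and>
       seminorm_complete UNIV \<Gamma>"

definition cont_seminorms :: "('a::pro_cstar_algebra \<Rightarrow> real) set" where
  "cont_seminorms = {p. cstar_seminorm p \<and> continuous_on UNIV p}"

text \<open>In a pro-C*-algebra these are exactly the self-adjoint elements with nonnegative spectrum.\<close>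

definition cstar_positive :: "'a::pro_cstar_algebra \<Rightarrow> bool" where
  "cstar_positive a \<longleftrightarrow> (\<exists>b. a = star b * b)"

definition cstar_le :: "'a::pro_cstar_algebra \<Rightarrow> 'a \<Rightarrow> bool"  (infix \<open>\<preceq>\<close> 50) where
  "a \<preceq> b \<longleftrightarrow> cstar_positive (b - a)"

section \<open>Hilbert modules\<close>

record ('a, 'e) cmodule =
  mcarrier :: "'e set"
  mscale :: "complex \<Rightarrow> 'e \<Rightarrow> 'e"
  mact :: "'e \<Rightarrow> 'a \<Rightarrow> 'e"
  minner :: "'e \<Rightarrow> 'e \<Rightarrow> 'a"

locale pre_hilbert_module =
  fixes E :: "('a::pro_cstar_algebra, 'e::ab_group_add) cmodule"
  assumes zero_closed: "0 \<in> mcarrier E"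
    and add_closed: "\<lbrakk>\<xi> \<in> mcarrier E; \<eta> \<in> mcarrier E\<rbrakk> \<Longrightarrow> \<xi> + \<eta> \<in> mcarrier E"
    and scale_closed: "\<xi> \<in> mcarrier E \<Longrightarrow> mscale E c \<xi> \<in> mcarrier E"
    and act_closed: "\<xi> \<in> mcarrier E \<Longrightarrow> mact E \<xi> a \<in> mcarrier E"
    and scale_add_right: "\<lbrakk>\<xi> \<in> mcarrier E; \<eta> \<in> mcarrier E\<rbrakk> \<Longrightarrow>
          mscale E c (\<xi> + \<eta>) = mscale E c \<xi> + mscale E c \<eta>"
    and scale_add_left: "\<xi> \<in> mcarrier E \<Longrightarrow> mscale E (c + d) \<xi> = mscale E c \<xi> + mscale E d \<xi>"
    and scale_scale: "\<xi> \<in> mcarrier E \<Longrightarrow> mscale E c (mscale E d \<xi>) = mscale E (c * d) \<xi>"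
    and scale_one: "\<xi> \<in> mcarrier E \<Longrightarrow> mscale E 1 \<xi> = \<xi>"
    and act_add_left: "\<lbrakk>\<xi> \<in> mcarrier E; \<eta> \<in> mcarrier E\<rbrakk> \<Longrightarrow>
          mact E (\<xi> + \<eta>) a = mact E \<xi> a + mact E \<eta> a"
    and act_add_right: "\<xi> \<in> mcarrier E \<Longrightarrow> mact E \<xi> (a + b) = mact E \<xi> a + mact E \<xi> b"
    and act_act: "\<xi> \<in> mcarrier E \<Longrightarrow> mact E (mact E \<xi> a) b = mact E \<xi> (a * b)"
    and scale_act: "\<xi> \<in> mcarrier E \<Longrightarrow> mact E (mscale E c \<xi>) a = mscale E c (mact E \<xi> a)"
    and act_scaleC: "\<xi> \<in> mcarrier E \<Longrightarrow> mact E \<xi> (scaleC c a) = mscale E c (mact E \<xi> a)"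
    and inner_add: "\<lbrakk>\<xi> \<in> mcarrier E; \<eta> \<in> mcarrier E; \<zeta> \<in> mcarrier E\<rbrakk> \<Longrightarrow>
          minner E \<xi> (\<eta> + \<zeta>) = minner E \<xi> \<eta> + minner E \<xi> \<zeta>"
    and inner_scale: "\<lbrakk>\<xi> \<in> mcarrier E; \<eta> \<in> mcarrier E\<rbrakk> \<Longrightarrow>
          minner E \<xi> (mscale E c \<eta>) = scaleC c (minner E \<xi> \<eta>)"
    and inner_act: "\<lbrakk>\<xi> \<in> mcarrier E; \<eta> \<in> mcarrier E\<rbrakk> \<Longrightarrow>
          minner E \<xi> (mact E \<eta> a) = minner E \<xi> \<eta> * a"
    and inner_star: "\<lbrakk>\<xi> \<in> mcarrier E; \<eta> \<in> mcarrier E\<rbrakk> \<Longrightarrow>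
          star (minner E \<xi> \<eta>) = minner E \<eta> \<xi>"
    and inner_nonneg: "\<xi> \<in> mcarrier E \<Longrightarrow> 0 \<preceq> minner E \<xi> \<xi>"
    and inner_eq_0: "\<xi> \<in> mcarrier E \<Longrightarrow> minner E \<xi> \<xi> = 0 \<longleftrightarrow> \<xi> = 0"

definition mseminorm :: "('a::pro_cstar_algebra, 'e) cmodule \<Rightarrow> ('a \<Rightarrow> real) \<Rightarrow> 'e \<Rightarrow> real" where
  "mseminorm E p \<xi> = sqrt (p (minner E \<xi> \<xi>))"

definition mtop :: "('a::pro_cstar_algebra, 'e::ab_group_add) cmodule \<Rightarrow> 'e topology" where
  "mtop E = seminorm_topology (mcarrier E) (mseminorm E ` cont_seminorms)"

locale hilbert_module = pre_hilbert_module E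
  for E :: "('a::pro_cstar_algebra, 'e::ab_group_add) cmodule" +
  assumes complete: "seminorm_complete (mcarrier E) (mseminorm E ` cont_seminorms)"

definition alg_module :: "('a::pro_cstar_algebra, 'a) cmodule" where
  "alg_module = \<lparr>mcarrier = UNIV, mscale = scaleC, mact = (*), minner = (\<lambda>a b. star a * b)\<rparr>"

text \<open>
  Sequences (here, and of multipliers below) are indexed by \<open>nat\<close> starting from \<open>0\<close>.
\<close>

definition H_mod :: "('a::pro_cstar_algebra, nat \<Rightarrow> 'a) cmodule" where
  "H_mod = \<lparr>mcarrier = {x. summable (\<lambda>n. star (x n) * x n)},
            mscale = (\<lambda>c x n. scaleC c (x n)),
            mact = (\<lambda>x b n. x n * b),
            minner = (\<lambda>x y. \<Sum>n. star (x n) * y n)\<rparr>"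

section \<open>Adjointable operators\<close>

definition module_morphism ::
  "('a::pro_cstar_algebra, 'e::ab_group_add) cmodule \<Rightarrow> ('a, 'f::ab_group_add) cmodule \<Rightarrow> ('e \<Rightarrow> 'f) \<Rightarrow> bool" where
  "module_morphism E F T \<longleftrightarrow>
     T ` mcarrier E \<subseteq> mcarrier F \<and>
     (\<forall>\<xi>\<in>mcarrier E. \<forall>\<eta>\<in>mcarrier E. T (\<xi> + \<eta>) = T \<xi> + T \<eta>) \<and>
     (\<forall>c. \<forall>\<xi>\<in>mcarrier E. T (mscale E c \<xi>) = mscale F c (T \<xi>)) \<and>
     (\<forall>a. \<forall>\<xi>\<in>mcarrier E. T (mact E \<xi> a) = mact F (T \<xi>) a)"

definition is_adjoint ::
  "('a::pro_cstar_algebra, 'e::ab_group_add) cmodule \<Rightarrow> ('a, 'f::ab_group_add) cmodule \<Rightarrow>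
   ('e \<Rightarrow> 'f) \<Rightarrow> ('f \<Rightarrow> 'e) \<Rightarrow> bool" where
  "is_adjoint E F T S \<longleftrightarrow> module_morphism F E S \<and>
     (\<forall>\<xi>\<in>mcarrier E. \<forall>\<eta>\<in>mcarrier F. minner F (T \<xi>) \<eta> = minner E \<xi> (S \<eta>))"

text \<open>
  Elements of \<open>L E F\<close> are only meaningful on \<open>mcarrier E\<close>; their values elsewhere are arbitrary
  and never used. When \<open>E\<close> is \<open>alg_module\<close>, the carrier is the whole type.
\<close>

definition L ::
  "('a::pro_cstar_algebra, 'e::ab_group_add) cmodule \<Rightarrow> ('a, 'f::ab_group_add) cmodule \<Rightarrow> ('e \<Rightarrow> 'f) set" where
  "L E F = {T. module_morphism E F T \<and> (\<exists>S. is_adjoint E F T S)}"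

text \<open>The adjoint is uniquely determined on \<open>mcarrier F\<close>, which is all that is used of it.\<close>

definition adj ::
  "('a::pro_cstar_algebra, 'e::ab_group_add) cmodule \<Rightarrow> ('a, 'f::ab_group_add) cmodule \<Rightarrow>
   ('e \<Rightarrow> 'f) \<Rightarrow> ('f \<Rightarrow> 'e)" where
  "adj E F T = (SOME S. is_adjoint E F T S)"

text \<open>As for \<open>onorm\<close>, this is a real supremum; it is finite for adjointable \<open>T\<close>.\<close>

definition op_seminorm ::
  "('a::pro_cstar_algebra, 'e) cmodule \<Rightarrow> ('a, 'f) cmodule \<Rightarrow> ('a \<Rightarrow> real) \<Rightarrow> ('e \<Rightarrow> 'f) \<Rightarrow> real" where
  "op_seminorm E F p T = (SUP \<xi>\<in>{\<xi> \<in> mcarrier E. mseminorm E p \<xi> \<le> 1}. mseminorm F p (T \<xi>))"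

text \<open>
  The bounded elements of \<open>L E E\<close>: the iterated supremum defining the norm of \<open>T\<close> (over the
  seminorms \<open>p\<close>, then over the \<open>p\<close>-unit ball) is taken at once, so that its finiteness does not
  depend on the value of a real supremum of an unbounded set.
\<close>

definition bL :: "('a::pro_cstar_algebra, 'e::ab_group_add) cmodule \<Rightarrow> ('e \<Rightarrow> 'e) set" where
  "bL E = {T \<in> L E E.
     bdd_above {mseminorm E p (T \<xi>) | p \<xi>. p \<in> cont_seminorms \<and> \<xi> \<in> mcarrier E \<and> mseminorm E p \<xi> \<le> 1}}"

definition invertible_in_bL :: "('a::pro_cstar_algebra, 'e::ab_group_add) cmodule \<Rightarrow> ('e \<Rightarrow> 'e) \<Rightarrow> bool" where
  "invertible_in_bL E T \<longleftrightarrow> T \<in> bL E \<and>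
     (\<exists>S\<in>bL E. \<forall>\<xi>\<in>mcarrier E. S (T \<xi>) = \<xi> \<and> T (S \<xi>) = \<xi>)"

section \<open>Multiplier modules and frames of multipliers\<close>

definition multipliers :: "('a::pro_cstar_algebra, 'e::ab_group_add) cmodule \<Rightarrow> ('a \<Rightarrow> 'e) set" where
  "multipliers E = L alg_module E"

definition multiplier_top :: "('a::pro_cstar_algebra, 'e::ab_group_add) cmodule \<Rightarrow> ('a \<Rightarrow> 'e) topology" where
  "multiplier_top E = seminorm_topology (multipliers E) (op_seminorm alg_module E ` cont_seminorms)"

definition mult_embed :: "('a::pro_cstar_algebra, 'e) cmodule \<Rightarrow> 'e \<Rightarrow> 'a \<Rightarrow> 'e" where
  "mult_embed E \<xi> = (\<lambda>a. mact E \<xi> a)"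

text \<open>
  Submodules of the module \<open>M(E)\<close> over \<open>M(A) = L(A)\<close>. The complex scalars act through
  the multiples of the identity in \<open>M(A)\<close>.
\<close>

definition multiplier_submodule ::
  "('a::pro_cstar_algebra, 'e::ab_group_add) cmodule \<Rightarrow> ('a \<Rightarrow> 'e) set \<Rightarrow> bool" where
  "multiplier_submodule E N \<longleftrightarrow> N \<subseteq> multipliers E \<and> 0 \<in> N \<and>
     (\<forall>T\<in>N. \<forall>R\<in>N. T + R \<in> N) \<and>
     (\<forall>T\<in>N. \<forall>S\<in>L alg_module alg_module. T \<circ> S \<in> N)"

definition closed_multiplier_span ::
  "('a::pro_cstar_algebra, 'e::ab_group_add) cmodule \<Rightarrow> ('a \<Rightarrow> 'e) set \<Rightarrow> ('a \<Rightarrow> 'e) set" where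
  "closed_multiplier_span E G =
     \<Inter>{N. multiplier_submodule E N \<and> closedin (multiplier_top E) N \<and> G \<subseteq> N}"

definition countably_generated_in_multipliers ::
  "('a::pro_cstar_algebra, 'e::ab_group_add) cmodule \<Rightarrow> bool" where
  "countably_generated_in_multipliers E \<longleftrightarrow>
     (\<exists>g :: nat \<Rightarrow> 'a \<Rightarrow> 'e. range g \<subseteq> multipliers E \<and>
        closed_multiplier_span E {mult_embed E (g n a) | n a. True} = mult_embed E ` mcarrier E)"

text \<open>The \<open>A\<close>-valued products of \<open>h \<in> M(E)\<close> with \<open>\<xi> \<in> E\<close>, in both orders.\<close>

definition mult_inner :: "('a::pro_cstar_algebra, 'e::ab_group_add) cmodule \<Rightarrow> ('a \<Rightarrow> 'e) \<Rightarrow> 'e \<Rightarrow> 'a" where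
  "mult_inner E h \<xi> = adj alg_module E h \<xi>"

definition inner_mult :: "('a::pro_cstar_algebra, 'e::ab_group_add) cmodule \<Rightarrow> 'e \<Rightarrow> ('a \<Rightarrow> 'e) \<Rightarrow> 'a" where
  "inner_mult E \<xi> h = star (adj alg_module E h \<xi>)"

definition standard_frame_of_multipliers ::
  "('a::pro_cstar_algebra, 'e::ab_group_add) cmodule \<Rightarrow> (nat \<Rightarrow> 'a \<Rightarrow> 'e) \<Rightarrow> bool" where
  "standard_frame_of_multipliers E h \<longleftrightarrow>
     range h \<subseteq> multipliers E \<and>
     (\<forall>\<xi>\<in>mcarrier E. summable (\<lambda>n. inner_mult E \<xi> (h n) * mult_inner E (h n) \<xi>)) \<and>
     (\<exists>C D :: real. C > 0 \<and> D > 0 \<and>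
        (\<forall>\<xi>\<in>mcarrier E.
           scaleC (complex_of_real C) (minner E \<xi> \<xi>)
             \<preceq> (\<Sum>n. inner_mult E \<xi> (h n) * mult_inner E (h n) \<xi>) \<and>
           (\<Sum>n. inner_mult E \<xi> (h n) * mult_inner E (h n) \<xi>)
             \<preceq> scaleC (complex_of_real D) (minner E \<xi> \<xi>)))"

definition frame_transform ::
  "('a::pro_cstar_algebra, 'e::ab_group_add) cmodule \<Rightarrow> (nat \<Rightarrow> 'a \<Rightarrow> 'e) \<Rightarrow> 'e \<Rightarrow> nat \<Rightarrow> 'a" where
  "frame_transform E h \<xi> = (\<lambda>n. mult_inner E (h n) \<xi>)"

definition std_mult :: "nat \<Rightarrow> 'a::pro_cstar_algebra \<Rightarrow> nat \<Rightarrow> 'a" where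
  "std_mult n a = (\<lambda>k. if k = n then a else 0)"

section \<open>Embeddings onto orthogonal summands\<close>

definition closed_submodule :: "('a::pro_cstar_algebra, 'e::ab_group_add) cmodule \<Rightarrow> 'e set \<Rightarrow> bool" where
  "closed_submodule E N \<longleftrightarrow> N \<subseteq> mcarrier E \<and> 0 \<in> N \<and>
     (\<forall>\<xi>\<in>N. \<forall>\<eta>\<in>N. \<xi> + \<eta> \<in> N) \<and>
     (\<forall>c. \<forall>\<xi>\<in>N. mscale E c \<xi> \<in> N) \<and>
     (\<forall>a. \<forall>\<xi>\<in>N. mact E \<xi> a \<in> N) \<and>
     closedin (mtop E) N"

definition orth_compl :: "('a::pro_cstar_algebra, 'e) cmodule \<Rightarrow> 'e set \<Rightarrow> 'e set" where
  "orth_compl E N = {\<eta> \<in> mcarrier E. \<forall>\<xi>\<in>N. minner E \<xi> \<eta> = 0}"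

definition orthogonal_summand :: "('a::pro_cstar_algebra, 'e::ab_group_add) cmodule \<Rightarrow> 'e set \<Rightarrow> bool" where
  "orthogonal_summand E N \<longleftrightarrow> closed_submodule E N \<and>
     mcarrier E = {\<xi> + \<eta> | \<xi> \<eta>. \<xi> \<in> N \<and> \<eta> \<in> orth_compl E N} \<and>
     N \<inter> orth_compl E N = {0}"

definition embeds_onto_orthogonal_summand ::
  "('a::pro_cstar_algebra, 'e::ab_group_add) cmodule \<Rightarrow> ('a, 'f::ab_group_add) cmodule \<Rightarrow> ('e \<Rightarrow> 'f) \<Rightarrow> bool" where
  "embeds_onto_orthogonal_summand E F T \<longleftrightarrow>
     inj_on T (mcarrier E) \<and> embedding_map (mtop E) (mtop F) T \<and>
     orthogonal_summand F (T ` mcarrier E)"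

end

theory Submission
  imports Defs
begin

text \<open>
  Everything is estimated one C*-seminorm \<open>p\<close> at a time. For \<open>p\<close> alone the algebra need not be
  complete, so a self-adjoint element \<open>a\<close> of the unitization is called positive if
  \<open>p (t - a) \<le> t\<close> for some \<open>t \<ge> 0\<close>, and square roots are replaced by sequences of polynomials;
  Kaplansky's theorem makes every \<open>star x * x\<close> positive in this sense, and positivity bounds norms.
  This gives the Cauchy--Schwarz inequality, and with it the convergence of the series
  \<open>\<Sum>n. h n (x n)\<close> for \<open>x\<close> in \<open>H_mod\<close>; its sum is the adjoint of the frame transform \<open>\<theta>\<close>.
  The frame bounds \<open>C\<close> and \<open>D\<close> make \<open>R = 1 - (1 / D) \<theta>\<^sup>* \<theta>\<close> a form between \<open>0\<close> and \<open>1 - C / D\<close>,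
  hence a contraction with the same constant for all seminorms, so \<open>\<theta>\<^sup>* \<theta>\<close> has a bounded
  inverse \<open>K\<close>, and \<open>\<theta> K \<theta>\<^sup>*\<close> is the orthogonal projection onto the range of \<open>\<theta>\<close>.
\<close>

section \<open>C*-seminorms and approximate positivity in a unital *-algebra\<close>

text \<open>The definitions express order by elements of the form \<open>star b * b\<close>, and
  from this form alone it is not visible that sums or limits of positive elements are positive, or
  that the order controls seminorms. Spectral theory in the completed quotient by the kernel of
  \<open>p\<close> would show this; a norm inequality does it more directly, because it passes to
  sums by the triangle inequality and to limits as soon as the radius \<open>t\<close> is under
  control. The price is the bridge from \<open>star b * b\<close> to the norm inequality: the
  classical argument compares the spectra of \<open>star z * z\<close> and
  \<open>z * star z\<close>, and a quantitative estimate has to replace that comparison. Infinite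
  sums of positive elements are handled through seminorms too, so that no square root of an infinite
  sum is ever taken.\<close>

lemma scaleC_zero_left [simp]: "scaleC 0 (x::'a::complex_star_algebra) = 0"
  using scaleC_add_left[of 0 0 x] by simp

lemma scaleC_zero_right [simp]: "scaleC c (0::'a::complex_star_algebra) = 0"
  using scaleC_add_right[of c 0 "0::'a"] by simp

lemma scaleC_minus1: "scaleC (- 1) (x::'a::complex_star_algebra) = - x"
  using scaleC_add_left[of 1 "-1" x] by (simp add: scaleC_one eq_neg_iff_add_eq_0 add.commute)

lemma scaleC_minus_right: "scaleC c (- x) = - scaleC c (x::'a::complex_star_algebra)"
  using scaleC_add_right[of c x "- x"] by (simp add: eq_neg_iff_add_eq_0 add.commute)

lemma scaleC_minus_left: "scaleC (- c) x = - scaleC c (x::'a::complex_star_algebra)"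
  using scaleC_add_left[of c "- c" x] by (simp add: eq_neg_iff_add_eq_0 add.commute)

lemma scaleC_diff_right: "scaleC c (x - y) = scaleC c x - scaleC c (y::'a::complex_star_algebra)"
  using scaleC_add_right[of c x "- y"] by (simp add: scaleC_minus_right)

lemma star_zero [simp]: "star (0::'a::complex_star_algebra) = 0"
  using star_add[of 0 "0::'a"] by simp

lemma star_minus: "star (- x) = - star (x::'a::complex_star_algebra)"
  using star_add[of x "- x"] by (simp add: eq_neg_iff_add_eq_0 add.commute)

lemma star_diff: "star (x - y) = star x - star (y::'a::complex_star_algebra)"
  using star_add[of x "- y"] by (simp add: star_minus)

lemma star_sum: "star (\<Sum>i\<in>I. f i) = (\<Sum>i\<in>I. star (f i :: 'a::complex_star_algebra))"
  by (induction I rule: infinite_finite_induct) (auto simp: star_add)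

section \<open>Elementary consequences of the C*-identity\<close>

locale cstar_seminormed =
  fixes p :: "'a::complex_star_algebra \<Rightarrow> real"
  assumes cstar_seminorm: "cstar_seminorm p"
begin

lemma triangle: "p (x + y) \<le> p x + p y"
  and homogeneous: "p (scaleC c x) = cmod c * p x"
  and submult: "p (x * y) \<le> p x * p y"
  and cstar_identity: "p (star x * x) = (p x)\<^sup>2"
  using cstar_seminorm unfolding cstar_seminorm_def by blast+

lemma zero [simp]: "p 0 = 0"
  using homogeneous[of 0 0] by simp

lemma minus [simp]: "p (- x) = p x"
  using homogeneous[of "-1" x] by (simp add: scaleC_minus1)

lemma nonneg [simp]: "0 \<le> p x"
  using triangle[of x "- x"] by simp

lemma minus_commute: "p (x - y) = p (y - x)"
  using minus[of "x - y"] by simp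

lemma triangle_diff: "p (x - y) \<le> p x + p y"
  using triangle[of x "- y"] by simp

lemma abs_diff_le: "\<bar>p x - p y\<bar> \<le> p (x - y)"
  using triangle[of "x - y" y] triangle[of "y - x" x] minus_commute[of x y] by simp

text \<open>One factor \<open>p x\<close> cancels in
  \<open>(p x)\<^sup>2 = p (star x * x) \<le> p (star x) * p x\<close>. Applied to
  \<open>star x\<close> as well, this makes the involution isometric.\<close>

lemma star_le: "p x \<le> p (star x)"
proof (cases "p x = 0")
  case False
  have "p x * p x \<le> p (star x) * p x"
    using submult[of "star x" x] cstar_identity[of x] by (simp add: power2_eq_square)
  with False nonneg[of x] show ?thesis by (simp add: mult_le_cancel_right less_le)
qed simp

lemma star [simp]: "p (star x) = p x"
  using star_le[of x] star_le[of "star x"] by (simp add: star_star)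

lemma selfadjoint_square: "star x = x \<Longrightarrow> p (x * x) = (p x)\<^sup>2"
  using cstar_identity[of x] by simp

lemma tendsto_of_diff:
  assumes "((\<lambda>n. p (f n - a)) \<longlongrightarrow> 0) F"
  shows "((\<lambda>n. p (f n)) \<longlongrightarrow> p a) F"
proof -
  have "((\<lambda>n. p (f n) - p a) \<longlongrightarrow> 0) F"
    by (rule Lim_null_comparison[OF _ assms]) (simp add: abs_diff_le)
  then show ?thesis by (simp add: LIM_zero_iff)
qed

end

section \<open>Unital *-algebras and an iteration for square roots\<close>

class unital_star_algebra = complex_star_algebra + real_algebra_1 +
  assumes scaleR_scaleC: "scaleR r x = scaleC (complex_of_real r) x"

lemma star_one [simp]: "star (1::'a::unital_star_algebra) = 1"
  by (metis mult_1_right mult_1_left star_mult star_star)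

lemma star_scaleR: "star (scaleR r x) = scaleR r (star (x::'a::unital_star_algebra))"
  by (simp add: scaleR_scaleC star_scaleC)

lemma star_of_real [simp]: "star (of_real r :: 'a::unital_star_algebra) = of_real r"
  by (simp add: of_real_def star_scaleR)

text \<open>A fixed point \<open>x\<close> satisfies \<open>(1 - x) * (1 - x) = 1 - e\<close>, so
  the elements \<open>1 - sqrt_iter e n\<close> are approximate square roots of
  \<open>1 - e\<close>. The iterates are polynomials in \<open>e\<close> with nonnegative
  coefficients, hence for \<open>p e \<le> 1\<close> the scalar iterates at 1 dominate them.\<close>

primrec sqrt_iter :: "'a::real_algebra_1 \<Rightarrow> nat \<Rightarrow> 'a" where
  "sqrt_iter e 0 = 0"
| "sqrt_iter e (Suc n) = (1/2) *\<^sub>R (e + sqrt_iter e n * sqrt_iter e n)"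

lemma sqrt_iter_commute: "e * b = b * e \<Longrightarrow> sqrt_iter e n * b = b * sqrt_iter e n"
proof (induction n)
  case (Suc n)
  then have "sqrt_iter e n * sqrt_iter e n * b = b * (sqrt_iter e n * sqrt_iter e n)"
    by (metis mult.assoc)
  with Suc.prems show ?case by (simp add: algebra_simps)
qed simp

lemma star_sqrt_iter: "star e = e \<Longrightarrow> star (sqrt_iter e n) = sqrt_iter (e::'a::unital_star_algebra) n"
  by (induction n) (auto simp: star_scaleR star_add star_mult)

lemma sqrt_iter_one: "0 \<le> sqrt_iter (1::real) n" "sqrt_iter (1::real) n \<le> 1"
  "sqrt_iter (1::real) n \<le> sqrt_iter 1 (Suc n)"
proof -
  show "0 \<le> sqrt_iter (1::real) n" by (cases n) auto
  show "sqrt_iter (1::real) n \<le> 1"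
  proof (induction n)
    case (Suc n)
    have "0 \<le> sqrt_iter (1::real) n" by (cases n) auto
    with Suc show ?case by (simp add: mult_le_one)
  qed simp
  \<comment> \<open>Half of this square is the increment of the iteration.\<close>
  have "0 \<le> (1 - sqrt_iter (1::real) n)\<^sup>2" by simp
  then show "sqrt_iter (1::real) n \<le> sqrt_iter 1 (Suc n)"
    by (simp add: power2_eq_square algebra_simps)
qed

lemma sqrt_iter_one_diff: "(\<lambda>n. sqrt_iter (1::real) (Suc n) - sqrt_iter 1 n) \<longlonglongrightarrow> 0"
proof -
  have "incseq (sqrt_iter (1::real))" by (rule incseq_SucI) (rule sqrt_iter_one)
  moreover have "\<forall>n. sqrt_iter (1::real) n \<le> 1" using sqrt_iter_one by blast
  ultimately obtain l where l: "sqrt_iter (1::real) \<longlonglongrightarrow> l"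
    by (rule incseq_convergent)
  from tendsto_diff[OF LIMSEQ_Suc[OF l] l] show ?thesis by simp
qed

text \<open>In a unital C*-algebra the norm condition places the spectrum of \<open>a\<close>
  between 0 and \<open>2 * t\<close>. Asking for a single radius makes sums easy; that every
  \<open>t\<close> above \<open>p a\<close> then works is \<open>ppos_norm_minus\<close>.\<close>

definition ppos :: "('a::unital_star_algebra \<Rightarrow> real) \<Rightarrow> 'a \<Rightarrow> bool" where
  "ppos p a \<longleftrightarrow> star a = a \<and> (\<exists>t\<ge>0. p (of_real t - a) \<le> t)"

section \<open>Approximate square roots and the order they generate\<close>

locale unital_cstar_seminormed = cstar_seminormed p
  for p :: "'a::unital_star_algebra \<Rightarrow> real"
begin

text \<open>\<open>p 1\<close> equals its own square, so it is 0 or 1; the value 0 belongs to the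
  zero seminorm, which is allowed.\<close>

lemma one_le: "p 1 \<le> 1"
proof -
  have "p 1 = p 1 * p 1" using cstar_identity[of 1] by (simp add: power2_eq_square)
  then show ?thesis by (metis mult_cancel_right1 nonneg order_refl zero_le_one)
qed

lemma homogeneousR: "p (r *\<^sub>R x) = \<bar>r\<bar> * p x"
  by (simp add: scaleR_scaleC homogeneous)

lemma of_real_le: "p (of_real r) \<le> \<bar>r\<bar>"
  using one_le by (simp add: of_real_def homogeneousR mult_left_le)

text \<open>Both inductions compare with the scalar iteration at 1. For the increments, the iterates
  at \<open>e\<close> commute, so a difference of squares factors as
  \<open>(u - v) * (u + v)\<close>.\<close>

lemma sqrt_iter_bounds:
  assumes "p e \<le> 1"
  shows "p (sqrt_iter e n) \<le> sqrt_iter 1 n"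
    and "p (sqrt_iter e (Suc n) - sqrt_iter e n) \<le> sqrt_iter 1 (Suc n) - sqrt_iter 1 n"
proof -
  show bound: "p (sqrt_iter e n) \<le> sqrt_iter 1 n" for n
  proof (induction n)
    case (Suc n)
    have "p (e + sqrt_iter e n * sqrt_iter e n) \<le> p e + p (sqrt_iter e n) * p (sqrt_iter e n)"
      using triangle submult by (meson add_left_mono order_trans)
    also have "\<dots> \<le> 1 + sqrt_iter 1 n * sqrt_iter 1 n"
      using assms Suc by (intro add_mono mult_mono) (auto simp: sqrt_iter_one)
    finally show ?case by (simp add: homogeneousR)
  qed simp
  show "p (sqrt_iter e (Suc n) - sqrt_iter e n) \<le> sqrt_iter 1 (Suc n) - sqrt_iter 1 n"
  proof (induction n)
    case 0
    then show ?case using assms by (simp add: homogeneousR)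
  next
    case (Suc n)
    define u v where "u = sqrt_iter e (Suc n)" and "v = sqrt_iter e n"
    define r s :: real where "r = sqrt_iter 1 (Suc n)" and "s = sqrt_iter 1 n"
    have comm: "u * v = v * u"
      unfolding u_def v_def by (intro sqrt_iter_commute sqrt_iter_commute[symmetric]) simp
    have u: "u = (1/2) *\<^sub>R (e + v * v)" and r: "r = (1/2) * (1 + s * s)"
      by (simp_all add: u_def v_def r_def s_def)
    have "(1/2) *\<^sub>R (e + u * u) - (1/2) *\<^sub>R (e + v * v) = (1/2) *\<^sub>R ((u - v) * (u + v))"
      using comm by (simp add: algebra_simps)
    then have eq: "sqrt_iter e (Suc (Suc n)) - u = (1/2) *\<^sub>R ((u - v) * (u + v))"
      unfolding sqrt_iter.simps(2)[of e "Suc n"] u_def[symmetric] u[symmetric] .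
    have "(1/2) * (1 + r * r) - (1/2) * (1 + s * s) = (1/2) * ((r - s) * (r + s))"
      by algebra
    then have eqr: "sqrt_iter 1 (Suc (Suc n)) - r = (1/2) * ((r - s) * (r + s))"
      unfolding sqrt_iter.simps(2)[of 1 "Suc n"] r_def[symmetric] r[symmetric] by simp
    have "p ((u - v) * (u + v)) \<le> p (u - v) * (p u + p v)"
      using submult[of "u - v" "u + v"] triangle[of u v] nonneg[of "u - v"]
      by (meson mult_left_mono order_trans)
    also have "\<dots> \<le> (r - s) * (r + s)"
      using Suc.IH bound[of n] bound[of "Suc n"] unfolding u_def[symmetric] v_def[symmetric] r_def[symmetric] s_def[symmetric]
      by (intro mult_mono add_mono) (auto simp: r_def s_def sqrt_iter_one simp del: sqrt_iter.simps)
    finally show ?case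
      unfolding u_def[symmetric] r_def[symmetric] eq eqr by (simp add: homogeneousR)
  qed
qed

text \<open>The error of \<open>w n * w n\<close> is twice an increment of the iteration. It
  therefore tends to 0 whether or not the iterates themselves converge, and no completeness
  enters.\<close>

lemma sqrt_one_minus:
  assumes "star e = e" "p e \<le> 1"
  obtains w where "\<And>n. star (w n) = w n" "\<And>n. p (1 - w n) \<le> 1"
    "\<And>n b. e * b = b * e \<Longrightarrow> w n * b = b * w n"
    "(\<lambda>n. p (w n * w n - (1 - e))) \<longlonglongrightarrow> 0"
proof
  let ?w = "\<lambda>n. 1 - sqrt_iter e n"
  show "star (?w n) = ?w n" for n using assms by (simp add: star_diff star_sqrt_iter)
  show "p (1 - ?w n) \<le> 1" for n
    using sqrt_iter_bounds(1)[OF assms(2), of n] sqrt_iter_one(2)[of n] by simp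
  show "?w n * b = b * ?w n" if "e * b = b * e" for n b
    using sqrt_iter_commute[OF that] by (simp add: algebra_simps)
  have eq: "?w n * ?w n - (1 - e) = 2 *\<^sub>R (sqrt_iter e (Suc n) - sqrt_iter e n)" for n
    by (simp add: algebra_simps scaleR_2)
  show "(\<lambda>n. p (?w n * ?w n - (1 - e))) \<longlonglongrightarrow> 0"
    unfolding eq homogeneousR
    by (rule tendsto_mult_right_zero, rule tendsto_sandwich[OF _ _ tendsto_const sqrt_iter_one_diff])
      (use sqrt_iter_bounds(2)[OF assms(2)] in auto)
qed

text \<open>By commutation \<open>star x * x = a * a + b * b\<close> for
  \<open>x = a + scaleC \<i> b\<close>, and the real part \<open>a\<close> of \<open>x\<close>
  satisfies \<open>p a \<le> p x\<close>. All later monotonicity goes back to this argument, which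
  involves no notion of positivity.\<close>

lemma commuting_squares_mono:
  assumes "star a = a" "star b = b" "a * b = b * a"
  shows "p (a * a) \<le> p (a * a + b * b)"
proof -
  define x where "x = a + scaleC \<i> b"
  have sx: "star x = a - scaleC \<i> b"
    by (simp add: x_def star_add star_scaleC assms scaleC_minus1[symmetric] scaleC_scaleC)
  have "star x * x = a * a + b * b"
    unfolding sx unfolding x_def using assms(3)
    by (simp add: ring_distribs mult_scaleC_left mult_scaleC_right scaleC_scaleC scaleC_minus1
        scaleC_add_right scaleC_diff_right)
  then have px: "p (a * a + b * b) = (p x)\<^sup>2" by (metis cstar_identity)
  have "x + star x = 2 *\<^sub>R a" unfolding sx unfolding x_def by (simp add: scaleR_2)
  then have "2 * p a \<le> p x + p (star x)" by (metis triangle homogeneousR abs_numeral)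
  then have "p a \<le> p x" by simp
  then show ?thesis unfolding px selfadjoint_square[OF assms(1)] by (simp add: power_mono)
qed

lemma ppos_selfadjoint: "ppos p a \<Longrightarrow> star a = a"
  by (simp add: ppos_def)

lemma ppos_zero: "ppos p 0"
  by (auto simp: ppos_def intro: exI[of _ 0])

lemma ppos_add:
  assumes "ppos p a" "ppos p b"
  shows "ppos p (a + b)"
proof -
  from assms obtain s t where s: "0 \<le> s" "p (of_real s - a) \<le> s" and t: "0 \<le> t" "p (of_real t - b) \<le> t"
    by (auto simp: ppos_def)
  have eq: "of_real (s + t) - (a + b) = (of_real s - a) + (of_real t - b)" by simp
  have "p (of_real (s + t) - (a + b)) \<le> s + t"
    unfolding eq using triangle s(2) t(2) by (rule order_trans[OF _ add_mono])
  then show ?thesis using assms s t unfolding ppos_def by (metis star_add add_nonneg_nonneg)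
qed

lemma ppos_scaleR:
  assumes "ppos p a" "0 \<le> r"
  shows "ppos p (r *\<^sub>R a)"
proof -
  from assms obtain s where s: "0 \<le> s" "p (of_real s - a) \<le> s" by (auto simp: ppos_def)
  have "of_real (r * s) - r *\<^sub>R a = r *\<^sub>R (of_real s - a)" by (simp add: of_real_def algebra_simps)
  then have "p (of_real (r * s) - r *\<^sub>R a) \<le> r * s"
    using s assms(2) by (simp add: homogeneousR mult_left_mono)
  then show ?thesis using assms s unfolding ppos_def by (metis star_scaleR mult_nonneg_nonneg)
qed

lemma ppos_of_norm_le:
  assumes "star c = c" "p c \<le> t"
  shows "ppos p (of_real t - c)"
  using assms order_trans[OF nonneg assms(2)] by (auto simp: ppos_def star_diff intro!: exI[of _ t])

text \<open>Rescaling gives \<open>a = t *\<^sub>R (1 - e)\<close> with \<open>p e \<le> 1\<close>,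
  the situation of \<open>sqrt_one_minus\<close>. The common bound \<open>K\<close> stands in for
  convergence of the roots.\<close>

lemma ppos_sqrt:
  assumes "ppos p a"
  obtains y K where "\<And>n. star (y n) = y n" "\<And>n. ppos p (y n)" "\<And>n. p (y n) \<le> K"
    "\<And>n b. a * b = b * a \<Longrightarrow> y n * b = b * y n"
    "(\<lambda>n. p (y n * y n - a)) \<longlonglongrightarrow> 0"
proof -
  from assms obtain s where s: "0 \<le> s" "p (of_real s - a) \<le> s" by (auto simp: ppos_def)
  \<comment> \<open>Adding 1 makes the radius positive, so that one may divide by it; by
    \<open>one_le\<close> the estimate survives.\<close>
  define t where "t = s + 1"
  have t: "t > 0" using s by (simp add: t_def)
  have eq: "of_real t - a = of_real s - a + 1" by (simp add: t_def)
  have "p (of_real s - a + 1) \<le> s + 1"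
    using triangle s(2) one_le by (rule order_trans[OF _ add_mono])
  then have pt: "p (of_real t - a) \<le> t" by (simp only: eq[symmetric] t_def)
  define e where "e = (1 / t) *\<^sub>R (of_real t - a)"
  have a: "a = t *\<^sub>R (1 - e)" using t by (simp add: e_def algebra_simps of_real_def)
  have e: "star e = e" "p e \<le> 1"
    using assms pt t by (simp_all add: e_def star_scaleR star_diff ppos_selfadjoint homogeneousR)
  obtain w where w: "\<And>n. star (w n) = w n" "\<And>n. p (1 - w n) \<le> 1"
    "\<And>n b. e * b = b * e \<Longrightarrow> w n * b = b * w n"
    "(\<lambda>n. p (w n * w n - (1 - e))) \<longlonglongrightarrow> 0"
    using e by (rule sqrt_one_minus) blast
  show thesis
  proof
    let ?y = "\<lambda>n. sqrt t *\<^sub>R w n"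
    show "star (?y n) = ?y n" for n by (simp add: star_scaleR w(1))
    have "ppos p (w n)" for n
      using w(1,2)[of n] unfolding ppos_def by (metis of_real_1 zero_le_one)
    then show "ppos p (?y n)" for n using t by (intro ppos_scaleR) auto
    have "p (w n) \<le> 2" for n using triangle_diff[of 1 "1 - w n"] w(2)[of n] one_le by simp
    then show "p (?y n) \<le> sqrt t * 2" for n using t by (simp add: homogeneousR)
    show "?y n * b = b * ?y n" if "a * b = b * a" for n b
    proof -
      have "e * b = b * e" using that by (simp add: e_def algebra_simps of_real_def)
      from w(3)[OF this] show ?thesis by simp
    qed
    have "?y n * ?y n - a = t *\<^sub>R (w n * w n - (1 - e))" for n
      using t by (simp add: scaleR_diff_right[of t "w n * w n" "1 - e"] flip: a)
    then show "(\<lambda>n. p (?y n * ?y n - a)) \<longlonglongrightarrow> 0"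
      by (simp add: homogeneousR tendsto_mult_right_zero w(4))
  qed
qed

text \<open>After scaling, the claim is \<open>p (1 - z * z) \<le> 1\<close>. Approximate roots
  \<open>w n\<close> of \<open>1 - z * z\<close> commute with \<open>z\<close>, and
  \<open>w n * w n + z * z\<close> tends to 1, so \<open>commuting_squares_mono\<close> applies. The
  excess of \<open>s\<close> over \<open>t\<close> keeps the divisor positive.\<close>

lemma norm_minus_square:
  assumes "star y = y" "p (y * y) \<le> t"
  shows "p (of_real t - y * y) \<le> t"
proof (rule field_le_epsilon)
  fix \<epsilon> :: real assume \<epsilon>: "\<epsilon> > 0"
  define s where "s = t + \<epsilon> / 2"
  have t: "0 \<le> t" using nonneg assms(2) by (rule order_trans)
  have s: "s > 0" "p (y * y) \<le> s" using t \<epsilon> assms by (auto simp: s_def)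
  define e where "e = (1 / s) *\<^sub>R (y * y)"
  have e: "star e = e" "p e \<le> 1"
    using s assms by (simp_all add: e_def star_scaleR star_mult homogeneousR)
  obtain w where w: "\<And>n. star (w n) = w n"
    "\<And>n b. e * b = b * e \<Longrightarrow> w n * b = b * w n"
    "(\<lambda>n. p (w n * w n - (1 - e))) \<longlonglongrightarrow> 0"
    using e by (rule sqrt_one_minus) blast
  define z where "z = (1 / sqrt s) *\<^sub>R y"
  have zz: "z * z = e" using s by (simp add: z_def e_def)
  have z: "star z = z" by (simp add: z_def star_scaleR assms)
  have comm: "w n * z = z * w n" for n
    by (rule w(2)) (simp only: zz[symmetric] mult.assoc)
  have "(\<lambda>n. p (w n * w n)) \<longlonglongrightarrow> p (1 - e)" using w(3) by (rule tendsto_of_diff)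
  moreover have "(\<lambda>n. p (w n * w n + z * z)) \<longlonglongrightarrow> p 1"
    using w(3) by (intro tendsto_of_diff) (simp add: zz algebra_simps)
  moreover have "p (w n * w n) \<le> p (w n * w n + z * z)" for n
    by (rule commuting_squares_mono[OF w(1) z comm])
  ultimately have "p (1 - e) \<le> p 1" by (meson LIMSEQ_le)
  then have "p (s *\<^sub>R (1 - e)) \<le> s" using s one_le by (simp add: homogeneousR)
  also have "s *\<^sub>R (1 - e) = of_real s - y * y" using s by (simp add: e_def of_real_def algebra_simps)
  finally have "p (of_real s - y * y) \<le> s" .
  moreover have "of_real t - y * y = (of_real s - y * y) - of_real (\<epsilon> / 2)" by (simp add: s_def)
  ultimately show "p (of_real t - y * y) \<le> t + \<epsilon>"
    using triangle_diff[of "of_real s - y * y" "of_real (\<epsilon> / 2)"] of_real_le[of "\<epsilon>/2"] \<epsilon>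
    by (simp add: s_def)
qed

lemma ppos_selfadjoint_square: "star y = y \<Longrightarrow> ppos p (y * y)"
  using norm_minus_square[of y "p (y * y)"] nonneg[of "y * y"] unfolding ppos_def
  by (metis order_refl star_mult)

text \<open>Squares have this property by \<open>norm_minus_square\<close>, and \<open>a\<close> is
  a limit of squares. The unspecified radius in \<open>ppos\<close> thereby becomes any bound of
  \<open>p a\<close>, as limits and comparisons require.\<close>

lemma ppos_norm_minus:
  assumes "ppos p a" "p a \<le> t"
  shows "p (of_real t - a) \<le> t"
proof -
  obtain y where y: "\<And>n. star (y n) = y n" "(\<lambda>n. p (y n * y n - a)) \<longlonglongrightarrow> 0"
    using ppos_sqrt[OF assms(1)] by metis
  let ?d = "\<lambda>n. p (y n * y n - a)"
  \<comment> \<open>One \<open>?d n\<close> enlarges the radius until it bounds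
    \<open>p (y n * y n)\<close>, one replaces \<open>y n * y n\<close> by \<open>a\<close>, and one
    moves the centre back to \<open>t\<close>.\<close>
  have "p (of_real t - a) \<le> t + 3 * ?d n" for n
  proof -
    let ?s = "t + ?d n"
    have "p (y n * y n) \<le> ?s" using triangle[of "y n * y n - a" a] assms(2) by simp
    from norm_minus_square[OF y(1) this] have "p (of_real ?s - y n * y n) \<le> ?s" .
    moreover have "of_real t - a = (of_real ?s - y n * y n) + ((y n * y n - a) - of_real (?d n))"
      by simp
    ultimately have "p (of_real t - a) \<le> ?s + (?d n + p (of_real (?d n)))"
      using triangle[of "of_real ?s - y n * y n" "(y n * y n - a) - of_real (?d n)"]
        triangle_diff[of "y n * y n - a" "of_real (?d n)"] by simp
    then show ?thesis using of_real_le[of "?d n"] by simp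
  qed
  moreover have "(\<lambda>n. t + 3 * ?d n) \<longlonglongrightarrow> t + 3 * 0" using y(2) by (intro tendsto_intros)
  ultimately show ?thesis using LIMSEQ_le_const[of "\<lambda>n. t + 3 * ?d n" t] by auto
qed

text \<open>The radii of the \<open>f n\<close> could grow without bound;
  \<open>ppos_norm_minus\<close> permits the common radius \<open>p a + 1\<close> for all large
  \<open>n\<close>.\<close>

lemma ppos_limit:
  assumes "\<And>n. ppos p (f n)" "(\<lambda>n::nat. p (f n - a)) \<longlonglongrightarrow> 0" "star a = a"
  shows "ppos p a"
proof -
  let ?t = "p a + 1"
  have ev: "\<forall>\<^sub>F n in sequentially. p (f n - a) < 1"
    using assms(2) by (rule order_tendstoD) simp
  have "\<forall>\<^sub>F n in sequentially. p (of_real ?t - f n) \<le> ?t"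
    using ev
  proof eventually_elim
    case (elim n)
    then have "p (f n) \<le> ?t" using triangle[of "f n - a" a] by simp
    then show ?case by (intro ppos_norm_minus assms)
  qed
  moreover have "(\<lambda>n. p (of_real ?t - f n)) \<longlonglongrightarrow> p (of_real ?t - a)"
    using assms(2) by (intro tendsto_of_diff) (simp add: minus_commute[of a])
  ultimately have "p (of_real ?t - a) \<le> ?t" by (intro tendsto_upperbound) auto
  then show ?thesis unfolding ppos_def using assms(3) nonneg by (metis add_nonneg_nonneg zero_le_one)
qed

text \<open>For \<open>t = p (a + b)\<close> the element \<open>t - a\<close> is positive, being
  \<open>(t - (a + b)) + b\<close>. Its approximate roots commute with those of \<open>a\<close>, so
  \<open>commuting_squares_mono\<close> applies although \<open>a\<close> and \<open>b\<close> need
  not commute.\<close>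

lemma ppos_mono:
  assumes "ppos p a" "ppos p b"
  shows "p a \<le> p (a + b)"
proof -
  let ?t = "p (a + b)"
  have "ppos p (of_real ?t - (a + b))"
    using ppos_add[OF assms] by (intro ppos_of_norm_le) (auto simp: ppos_selfadjoint)
  then have "ppos p (of_real ?t - (a + b) + b)" using assms(2) by (rule ppos_add)
  then have "ppos p (of_real ?t - a)" by (simp add: algebra_simps)
  then obtain z where z: "\<And>n. star (z n) = z n"
    "\<And>n b. (of_real ?t - a) * b = b * (of_real ?t - a) \<Longrightarrow> z n * b = b * z n"
    "(\<lambda>n. p (z n * z n - (of_real ?t - a))) \<longlonglongrightarrow> 0"
    by (rule ppos_sqrt) blast
  obtain y where y: "\<And>n. star (y n) = y n"
    "\<And>n b. a * b = b * a \<Longrightarrow> y n * b = b * y n"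
    "(\<lambda>n. p (y n * y n - a)) \<longlonglongrightarrow> 0"
    using assms(1) by (rule ppos_sqrt) metis
  have comm: "y n * z n = z n * y n" for n
  proof -
    have "y n * a = a * y n" by (rule y) simp
    then show ?thesis by (intro z(2)[symmetric]) (simp add: algebra_simps of_real_def)
  qed
  have "(\<lambda>n. p (y n * y n)) \<longlonglongrightarrow> p a" using y(3) by (rule tendsto_of_diff)
  moreover have "(\<lambda>n. p (y n * y n + z n * z n)) \<longlonglongrightarrow> p (of_real ?t)"
  proof (rule tendsto_of_diff, rule Lim_null_comparison)
    have "y n * y n + z n * z n - of_real ?t = (y n * y n - a) + (z n * z n - (of_real ?t - a))"
      for n by simp
    then show "\<forall>\<^sub>F n in sequentially. norm (p (y n * y n + z n * z n - of_real ?t))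
        \<le> p (y n * y n - a) + p (z n * z n - (of_real ?t - a))"
      by (simp only: real_norm_def abs_of_nonneg[OF nonneg] triangle eventually_True)
    show "(\<lambda>n. p (y n * y n - a) + p (z n * z n - (of_real ?t - a))) \<longlonglongrightarrow> 0"
      using tendsto_add[OF y(3) z(3)] by simp
  qed
  moreover have "p (y n * y n) \<le> p (y n * y n + z n * z n)" for n
    by (rule commuting_squares_mono[OF y(1) z(1) comm])
  ultimately have "p a \<le> p (of_real ?t)" by (meson LIMSEQ_le)
  then show ?thesis using of_real_le[of ?t] by simp
qed

lemma tendsto_sandwich_mult:
  assumes "(\<lambda>n::nat. p (f n)) \<longlonglongrightarrow> 0"
  shows "(\<lambda>n. p (x * f n * y)) \<longlonglongrightarrow> 0"
proof (rule Lim_null_comparison)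
  show "\<forall>\<^sub>F n in sequentially. norm (p (x * f n * y)) \<le> p x * p (f n) * p y"
    by (simp, intro always_eventually allI order_trans[OF submult] mult_right_mono submult nonneg)
  show "(\<lambda>n. p x * p (f n) * p y) \<longlonglongrightarrow> 0"
    using assms by (intro tendsto_mult_left_zero tendsto_mult_right_zero)
qed

text \<open>Commutation makes \<open>f * y n\<close> selfadjoint, and its square approximates
  \<open>f * a * f\<close>. Conjugation by arbitrary elements has to wait for Kaplansky's theorem,
  whose proof uses this special case.\<close>

lemma ppos_commuting_conj:
  assumes "ppos p a" "star f = f" "a * f = f * a"
  shows "ppos p (f * a * f)"
proof -
  obtain y where y: "\<And>n. star (y n) = y n" "\<And>n b. a * b = b * a \<Longrightarrow> y n * b = b * y n"
    "(\<lambda>n. p (y n * y n - a)) \<longlonglongrightarrow> 0"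
    using assms(1) by (rule ppos_sqrt) metis
  show ?thesis
  proof (rule ppos_limit)
    have comm: "y n * f = f * y n" for n by (intro y assms)
    have "f * (y n * y n) * f = (f * y n) * (f * y n)" for n
      by (metis comm mult.assoc)
    moreover have "star (f * y n) = f * y n" for n by (simp add: star_mult y(1) assms(2) comm)
    ultimately show "ppos p (f * (y n * y n) * f)" for n
      by (simp add: ppos_selfadjoint_square)
    have "f * (y n * y n) * f - f * a * f = f * (y n * y n - a) * f" for n
      by (simp add: algebra_simps)
    then show "(\<lambda>n. p (f * (y n * y n) * f - f * a * f)) \<longlonglongrightarrow> 0"
      using tendsto_sandwich_mult[OF y(3)] by simp
    show "star (f * a * f) = f * a * f"
      using assms(1,2) by (simp add: star_mult ppos_selfadjoint mult.assoc)
  qed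
qed

end

section \<open>Kaplansky's theorem and conjugation\<close>

context unital_cstar_seminormed
begin

text \<open>\<open>u\<close> and \<open>v\<close> are, up to sign, twice the real and imaginary
  parts of \<open>z\<close>; in the sum of their squares \<open>z * z\<close> and
  \<open>star z * star z\<close> cancel.\<close>

lemma ppos_anticommutator: "ppos p (star z * z + z * star z)"
proof -
  define u where "u = z + star z"
  define v where "v = scaleC \<i> (z - star z)"
  have sa: "star u = u" "star v = v"
    by (simp_all add: u_def v_def star_add star_star star_scaleC star_diff add.commute
        scaleC_diff_right scaleC_minus_left)
  have v: "v * v = - ((z - star z) * (z - star z))"
    unfolding v_def by (simp add: mult_scaleC_left mult_scaleC_right scaleC_scaleC scaleC_minus1)
  have "u * u + v * v = 2 *\<^sub>R (star z * z + z * star z)"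
    unfolding v unfolding u_def by (simp add: ring_distribs scaleR_2)
  then have "star z * z + z * star z = (1/2) *\<^sub>R (u * u + v * v)" by simp
  then show ?thesis
    using ppos_selfadjoint_square[OF sa(1)] ppos_selfadjoint_square[OF sa(2)]
    by (simp add: ppos_add ppos_scaleR)
qed

text \<open>If \<open>w = star z * z\<close> is nearly the negative of a positive element, then
  \<open>v = z * star z\<close> is nearly positive by \<open>ppos_anticommutator\<close>. The
  element \<open>x\<close> can be written with \<open>m + w\<close> or with \<open>m + v\<close>:
  the first form bounds \<open>p (star x * x)\<close> by about \<open>m ^ 3\<close>, because
  \<open>w\<close> is almost negative, and the second bounds it from below by about
  \<open>2 * m ^ 3\<close>.\<close>

lemma almost_negative_square_small:
  assumes b: "ppos p b"
  shows "p (star z * z) \<le> 100 * p (star z * z + b)"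
proof (rule ccontr)
  define w v e \<epsilon> m where "w = star z * z" and "v = z * star z" and "e = w + b"
    and "\<epsilon> = p e" and "m = p w"
  assume "\<not> ?thesis"
  then have m: "100 * \<epsilon> < m" by (simp add: m_def \<epsilon>_def e_def w_def)
  have \<epsilon>: "0 \<le> \<epsilon>" by (simp add: \<epsilon>_def)
  have pz: "(p z)\<^sup>2 = m" by (simp add: m_def w_def cstar_identity)
  have pv: "p v = m" using cstar_identity[of "star z"] by (simp add: v_def star_star pz)
  have sw: "star w = w" by (simp add: w_def star_mult star_star)
  have se: "star e = e" by (simp add: e_def star_add sw ppos_selfadjoint[OF b])
  have pe: "ppos p (of_real \<epsilon> - e)" by (rule ppos_of_norm_le[OF se]) (simp add: \<epsilon>_def)
  define \<rho> where "\<rho> = of_real \<epsilon> + v"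
  define k where "k = m - \<epsilon>"
  have k: "0 \<le> k" using m \<epsilon> by (simp add: k_def)
  \<comment> \<open>Since \<open>e = w + b\<close>, these positive summands add up to
    \<open>of_real \<epsilon> + v\<close>.\<close>
  have "ppos p ((w + v) + b + (of_real \<epsilon> - e))"
    unfolding w_def v_def by (intro ppos_add ppos_anticommutator b pe)
  also have "(w + v) + b + (of_real \<epsilon> - e) = \<rho>" by (simp add: e_def \<rho>_def)
  finally have \<rho>: "ppos p \<rho>" .
  have k\<rho>: "k \<le> p \<rho>"
    using triangle_diff[of \<rho> "of_real \<epsilon>"] of_real_le[of \<epsilon>] \<epsilon> by (simp add: \<rho>_def k_def pv)
  have "ppos p (b + (of_real \<epsilon> - e))" by (intro ppos_add b pe)
  also have "b + (of_real \<epsilon> - e) = of_real \<epsilon> - w" by (simp add: e_def)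
  finally have "ppos p (of_real \<epsilon> - w)" .
  moreover have "p (of_real \<epsilon> - w) \<le> m + \<epsilon>"
    using triangle_diff[of "of_real \<epsilon>" w] of_real_le[of \<epsilon>] \<epsilon> by (simp add: m_def)
  \<comment> \<open>Recentring the positive element \<open>of_real \<epsilon> - w\<close> at the
    radius \<open>m + \<epsilon>\<close> leaves exactly \<open>of_real m + w\<close>.\<close>
  ultimately have "p (of_real (m + \<epsilon>) - (of_real \<epsilon> - w)) \<le> m + \<epsilon>" by (rule ppos_norm_minus)
  then have pmw: "p (of_real m + w) \<le> m + \<epsilon>" by simp
  define x where "x = (of_real m + w) * star z"
  have x: "x = star z * (of_real m + v)"
    by (simp add: x_def w_def v_def algebra_simps of_real_def)
  have sx: "star x = (of_real m + v) * z"
    by (simp add: x star_mult star_add star_star v_def)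
  have px: "p (star x * x) \<le> (m + \<epsilon>)\<^sup>2 * m"
  proof -
    have "p x \<le> (m + \<epsilon>) * p z"
      using submult[of "of_real m + w" "star z"] mult_right_mono[OF pmw nonneg[of z]]
      by (simp add: x_def)
    then have "(p x)\<^sup>2 \<le> ((m + \<epsilon>) * p z)\<^sup>2" by (simp add: power_mono)
    then show ?thesis by (simp add: cstar_identity power_mult_distrib pz)
  qed
  have v\<rho>: "of_real m + v = of_real k + \<rho>" by (simp add: k_def \<rho>_def)
  have "star x * x = (of_real k + \<rho>) * v * (of_real k + \<rho>)"
    unfolding sx unfolding x v\<rho> by (simp add: v_def mult.assoc)
  also have "\<dots> = (of_real k + \<rho>) * \<rho> * (of_real k + \<rho>) - \<epsilon> *\<^sub>R ((of_real k + \<rho>) * (of_real k + \<rho>))"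
    by (simp add: \<rho>_def of_real_def algebra_simps)
  finally have sxx: "(of_real k + \<rho>) * \<rho> * (of_real k + \<rho>) =
      star x * x + \<epsilon> *\<^sub>R ((of_real m + v) * (of_real m + v))" by (simp add: v\<rho>)
  have pmv: "p (of_real m + v) \<le> 2 * m"
    using triangle[of "of_real m" v] of_real_le[of m] m \<epsilon> by (simp add: pv)
  have "p ((of_real m + v) * (of_real m + v)) \<le> (2 * m) * (2 * m)"
    using submult mult_mono[OF pmv pmv _ nonneg] m \<epsilon>
    by (metis abs_ge_zero nonneg order_trans pmv)
  then have "p (\<epsilon> *\<^sub>R ((of_real m + v) * (of_real m + v))) \<le> \<epsilon> * (4 * m\<^sup>2)"
    using \<epsilon> by (simp add: homogeneousR power2_eq_square mult_left_mono)
  then have upper: "p ((of_real k + \<rho>) * \<rho> * (of_real k + \<rho>)) \<le> (m + \<epsilon>)\<^sup>2 * m + 4 * \<epsilon> * m\<^sup>2"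
    unfolding sxx using px triangle[of "star x * x" "\<epsilon> *\<^sub>R ((of_real m + v) * (of_real m + v))"]
    by simp
  \<comment> \<open>All three terms are positive, so by \<open>ppos_mono\<close> the first alone
    gives a lower bound, and the C*-identity computes its seminorm.\<close>
  have eq: "(of_real k + \<rho>) * \<rho> * (of_real k + \<rho>) =
      (2 * k) *\<^sub>R (\<rho> * \<rho>) + ((k * k) *\<^sub>R \<rho> + \<rho> * \<rho> * \<rho>)"
    by (simp add: of_real_def algebra_simps scaleR_2[symmetric])
  have s\<rho>: "star \<rho> = \<rho>" using \<rho> by (rule ppos_selfadjoint)
  have "p ((2 * k) *\<^sub>R (\<rho> * \<rho>)) \<le> p ((of_real k + \<rho>) * \<rho> * (of_real k + \<rho>))"
    unfolding eq
    by (intro ppos_mono ppos_add ppos_scaleR ppos_selfadjoint_square ppos_commuting_conj s\<rho> \<rho>)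
      (use k in auto)
  then have "2 * k * (p \<rho>)\<^sup>2 \<le> p ((of_real k + \<rho>) * \<rho> * (of_real k + \<rho>))"
    using k by (simp add: homogeneousR selfadjoint_square s\<rho>)
  moreover have "k\<^sup>2 \<le> (p \<rho>)\<^sup>2" using k k\<rho> by (simp add: power_mono)
  then have "2 * k * k\<^sup>2 \<le> 2 * k * (p \<rho>)\<^sup>2" using k by (intro mult_left_mono) auto
  ultimately have main: "2 * k * k\<^sup>2 \<le> (m + \<epsilon>)\<^sup>2 * m + 4 * \<epsilon> * m\<^sup>2" using upper by linarith
  have m0: "0 < m" using m \<epsilon> by linarith
  have "(99/100 * m) ^ 3 \<le> k ^ 3" using m m0 by (intro power_mono) (auto simp: k_def)
  moreover have "(m + \<epsilon>)\<^sup>2 * m \<le> (101/100 * m)\<^sup>2 * m"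
    using m m0 \<epsilon> by (intro mult_right_mono power_mono) auto
  moreover have "4 * \<epsilon> * m\<^sup>2 \<le> 4 * (m / 100) * m\<^sup>2" using m by (intro mult_right_mono) auto
  \<comment> \<open>Divided by \<open>m ^ 3\<close>, this reads about 1.94 \<le> 1.06; the factor
    100 was chosen to leave such a gap.\<close>
  ultimately have "2 * (99/100 * m) ^ 3 \<le> (101/100 * m)\<^sup>2 * m + 4 * (m / 100) * m\<^sup>2"
    using main by (simp add: power3_eq_cube power2_eq_square)
  moreover have "0 < m ^ 3" using m0 by simp
  ultimately show False by (simp add: power3_eq_cube power2_eq_square)
qed

text \<open>Kaplansky's theorem. With \<open>d\<close> close to the absolute value of \<open>c = star x * x\<close>, the element
  \<open>r = d - c\<close> is close to twice the negative part of \<open>c\<close>; the previous estimate, applied to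
  \<open>z = x * r\<close>, shows that \<open>r\<close> is small.\<close>

theorem ppos_star_mult: "ppos p (star x * x)"
proof -
  define c where "c = star x * x"
  have sc: "star c = c" by (simp add: c_def star_mult star_star)
  obtain d K where d: "\<And>n. star (d n) = d n" "\<And>n. ppos p (d n)" "\<And>n. p (d n) \<le> K"
    "\<And>n b. c * c * b = b * (c * c) \<Longrightarrow> d n * b = b * d n"
    "(\<lambda>n. p (d n * d n - c * c)) \<longlonglongrightarrow> 0"
    using ppos_selfadjoint_square[OF sc] by (rule ppos_sqrt) blast
  have dc: "d n * c = c * d n" for n by (rule d) (simp add: mult.assoc)
  define r where "r n = d n - c" for n
  have sr: "star (r n) = r n" for n by (simp add: r_def star_diff d(1) sc)
  have rc: "d n * r n = r n * d n" for n by (simp add: r_def algebra_simps dc)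
  define M where "M = K + p c"
  have pr: "p (r n) \<le> M" for n
    using triangle_diff[of "d n" c] d(3)[of n] by (simp add: r_def M_def)
  have M: "0 \<le> M" using pr nonneg order_trans by blast
  define s where "s n = p (d n * d n - c * c) * M" for n
  have s: "s \<longlonglongrightarrow> 0" unfolding s_def using d(5) by (rule tendsto_mult_left_zero)
  have sum: "p (r n * c * r n + r n * d n * r n) \<le> s n" for n
  proof -
    \<comment> \<open>Everything commutes, and \<open>r n * (d n + c)\<close> is the difference of
      the two squares.\<close>
    have "r n * c * r n + r n * d n * r n = (d n * d n - c * c) * r n"
      by (simp add: r_def ring_distribs dc flip: mult.assoc)
    then show ?thesis
      using submult[of "d n * d n - c * c" "r n"] mult_left_mono[OF pr nonneg]
      by (metis order_trans s_def)
  qed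
  have "p (r n * c * r n) \<le> 100 * s n" for n
  proof -
    have "star (x * r n) * (x * r n) = r n * c * r n"
      by (simp add: star_mult sr c_def mult.assoc)
    moreover have "ppos p (r n * d n * r n)" by (intro ppos_commuting_conj d(2) sr rc)
    ultimately show ?thesis
      using almost_negative_square_small[of "r n * d n * r n" "x * r n"] sum[of n] by simp
  qed
  have cube: "p (r n * r n * r n) \<le> 201 * s n" for n
  proof -
    \<comment> \<open>The middle factor is \<open>d n - c\<close>, so the cube is the small sum
      minus twice \<open>r n * c * r n\<close>; hence 201 = 1 + 2 * 100.\<close>
    have "r n * r n * r n = (r n * c * r n + r n * d n * r n) - (r n * c * r n + r n * c * r n)"
      by (simp add: r_def algebra_simps)
    then show ?thesis
      using \<open>p (r n * c * r n) \<le> 100 * s n\<close> sum[of n]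
        triangle_diff[of "r n * c * r n + r n * d n * r n" "r n * c * r n + r n * c * r n"]
        triangle[of "r n * c * r n" "r n * c * r n"] by simp
  qed
  have "(p (r n)) ^ 3 \<le> 201 * s n" for n
  proof (cases "p (r n) = 0")
    case True
    then show ?thesis using order_trans[OF nonneg cube[of n]] by simp
  next
    case False
    have "star (r n * r n) = r n * r n" by (simp add: star_mult sr)
    \<comment> \<open>The C*-identity gives the seminorm of a fourth power exactly; cancelling one
      factor then bounds the cube of \<open>p (r n)\<close>.\<close>
    then have "(p (r n)) ^ 4 = p (r n * r n * (r n * r n))"
      by (simp add: selfadjoint_square sr)
    also have "\<dots> \<le> p (r n * r n * r n) * p (r n)"
      using submult[of "r n * r n * r n" "r n"] by (simp add: mult.assoc)
    finally have "p (r n) ^ 3 * p (r n) \<le> p (r n * r n * r n) * p (r n)"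
      by (simp add: eval_nat_numeral mult.commute)
    then have "p (r n) ^ 3 \<le> p (r n * r n * r n)"
      using False nonneg[of "r n"] by (simp add: mult_le_cancel_right less_le)
    then show ?thesis using cube by (rule order_trans)
  qed
  then have le: "p (r n) \<le> root 3 (201 * s n)" for n
    by (metis nonneg odd_real_root_power_cancel odd_numeral real_root_le_mono zero_less_numeral)
  have "(\<lambda>n. root 3 (201 * s n)) \<longlonglongrightarrow> root 3 (201 * 0)"
    by (intro tendsto_intros s)
  then have "(\<lambda>n. root 3 (201 * s n)) \<longlonglongrightarrow> 0" by simp
  from tendsto_sandwich[OF _ _ tendsto_const this] have "(\<lambda>n. p (r n)) \<longlonglongrightarrow> 0"
    using le by simp
  then have "ppos p c"
    unfolding r_def by (rule ppos_limit[OF d(2) _ sc])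
  then show ?thesis by (simp add: c_def)
qed

lemma ppos_conj:
  assumes "ppos p a"
  shows "ppos p (star x * a * x)"
proof -
  obtain y where y: "\<And>n. star (y n) = y n" "(\<lambda>n. p (y n * y n - a)) \<longlonglongrightarrow> 0"
    using assms by (rule ppos_sqrt) blast
  show ?thesis
  proof (rule ppos_limit)
    show "ppos p (star (y n * x) * (y n * x))" for n by (rule ppos_star_mult)
    have "star (y n * x) * (y n * x) - star x * a * x = star x * (y n * y n - a) * x" for n
      by (simp add: star_mult y(1) algebra_simps)
    then show "(\<lambda>n. p (star (y n * x) * (y n * x) - star x * a * x)) \<longlonglongrightarrow> 0"
      using tendsto_sandwich_mult[OF y(2)] by simp
    show "star (star x * a * x) = star x * a * x"
      using assms by (simp add: star_mult star_star ppos_selfadjoint mult.assoc)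
  qed
qed

end

section \<open>Unitization\<close>

text \<open>Radii are multiples of a unit, which the given algebra may lack. One is adjoined in
  every case, so that also \<open>0 \<noteq> 1\<close> holds.\<close>

datatype 'a unitization = Unitize (uscalar: complex) (uelem: 'a)

instantiation unitization :: (complex_star_algebra) unital_star_algebra
begin

definition "0 = Unitize 0 0"
definition "1 = Unitize 1 0"
definition "u + v = Unitize (uscalar u + uscalar v) (uelem u + uelem v)"
definition "u - v = Unitize (uscalar u - uscalar v) (uelem u - uelem v)"
definition "- u = Unitize (- uscalar u) (- uelem u)"
definition "u * v = Unitize (uscalar u * uscalar v)
  (scaleC (uscalar u) (uelem v) + scaleC (uscalar v) (uelem u) + uelem u * uelem v)"
definition "scaleC c u = Unitize (c * uscalar u) (scaleC c (uelem u))"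
definition "scaleR r u = Unitize (complex_of_real r * uscalar u) (scaleC (complex_of_real r) (uelem u))"
definition "star u = Unitize (cnj (uscalar u)) (star (uelem u))"

lemmas unitization_defs = zero_unitization_def one_unitization_def plus_unitization_def
  minus_unitization_def uminus_unitization_def times_unitization_def scaleC_unitization_def
  scaleR_unitization_def star_unitization_def

instance
  by standard
    (simp_all add: unitization_defs ring_distribs scaleC_minus_right scaleC_diff_right add_ac mult.assoc
      mult.commute[where 'a = complex] mult.left_commute[where 'a = complex] scaleC_add_right scaleC_add_left scaleC_scaleC
      scaleC_one mult_scaleC_left mult_scaleC_right star_add star_scaleC star_mult star_star)

end

definition uact :: "'a unitization \<Rightarrow> 'a \<Rightarrow> 'a::complex_star_algebra" where
  "uact u x = scaleC (uscalar u) x + uelem u * x"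

text \<open>The operator seminorm of left multiplication. It inherits the C*-identity from
  \<open>p\<close>, because \<open>star u\<close> is adjoint to \<open>u\<close> for the pairing
  \<open>star x * y\<close>. It may vanish on nonzero elements even if \<open>p\<close> does not,
  namely when the algebra already has a unit; a seminorm is all that is wanted.\<close>

definition unorm :: "('a::complex_star_algebra \<Rightarrow> real) \<Rightarrow> 'a unitization \<Rightarrow> real" where
  "unorm p u = (SUP x\<in>{x. p x \<le> 1}. p (uact u x))"

abbreviation uembed :: "'a \<Rightarrow> 'a::complex_star_algebra unitization" where
  "uembed \<equiv> Unitize 0"

lemma uact_simps:
  "uact (u + v) x = uact u x + uact v x"
  "uact (u * v) x = uact u (uact v x)"
  "uact (scaleC c u) x = scaleC c (uact u x)"
  "uact u (scaleC c x) = scaleC c (uact u x)"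
  "star (uact u x) * y = star x * uact (star u) y"
  by (simp_all add: uact_def unitization_defs ring_distribs scaleC_add_right scaleC_add_left
      scaleC_scaleC mult_scaleC_left mult_scaleC_right star_add star_scaleC star_mult mult.assoc
      mult.commute[where 'a = complex] mult.left_commute[where 'a = complex] add_ac)

section \<open>The C*-identity for the unitization\<close>

context cstar_seminormed
begin

lemma unorm_bdd: "bdd_above ((\<lambda>x. p (uact u x)) ` {x. p x \<le> 1})"
proof (rule bdd_aboveI2)
  fix x assume "x \<in> {x. p x \<le> 1}"
  then have x: "p x \<le> 1" by simp
  have "p (uact u x) \<le> cmod (uscalar u) * p x + p (uelem u) * p x"
    unfolding uact_def using triangle homogeneous submult by (metis add_left_mono order_trans)
  also have "\<dots> \<le> cmod (uscalar u) * 1 + p (uelem u) * 1"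
    by (intro add_mono mult_left_mono x) auto
  finally show "p (uact u x) \<le> cmod (uscalar u) + p (uelem u)" by simp
qed

lemma unorm_leI: "(\<And>x. p x \<le> 1 \<Longrightarrow> p (uact u x) \<le> K) \<Longrightarrow> unorm p u \<le> K"
  unfolding unorm_def by (rule cSUP_least) (auto intro: exI[of _ 0])

lemma unorm_ge: "p x \<le> 1 \<Longrightarrow> p (uact u x) \<le> unorm p u"
  unfolding unorm_def by (rule cSUP_upper[OF _ unorm_bdd]) simp

lemma unorm_nonneg: "0 \<le> unorm p u"
  by (rule order_trans[OF nonneg unorm_ge[of 0]]) simp

text \<open>Elements with \<open>p x = 0\<close> cannot be normalized; for them
  \<open>uact u x\<close> stays in the kernel of \<open>p\<close>.\<close>

lemma unorm_bound: "p (uact u x) \<le> unorm p u * p x"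
proof (cases "p x = 0")
  case True
  have "p (uact u x) \<le> cmod (uscalar u) * p x + p (uelem u) * p x"
    unfolding uact_def using triangle homogeneous submult by (metis add_left_mono order_trans)
  then show ?thesis using True by simp
next
  case False
  then have x: "p x > 0" using nonneg[of x] by linarith
  let ?c = "complex_of_real (1 / p x)"
  have "p (uact u (scaleC ?c x)) \<le> unorm p u"
    by (rule unorm_ge) (use x in \<open>simp add: homogeneous norm_divide\<close>)
  then show ?thesis using x by (simp add: uact_simps homogeneous norm_divide field_simps)
qed

text \<open>The usual operator argument:
  \<open>(p (uact u x))\<^sup>2 = p (star x * uact (star u * u) x)\<close>. Together with
  submultiplicativity, this inequality forces the involution to be isometric and yields the
  C*-identity.\<close>

lemma unorm_star_le: "(unorm p u)\<^sup>2 \<le> unorm p (star u * u)"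
proof -
  have "p (uact u x) \<le> sqrt (unorm p (star u * u))" if x: "p x \<le> 1" for x
  proof (rule real_le_rsqrt)
    have "(p (uact u x))\<^sup>2 = p (star x * uact (star u * u) x)"
      by (simp add: cstar_identity[symmetric] uact_simps)
    also have "\<dots> \<le> p x * (unorm p (star u * u) * p x)"
      using submult[of "star x" "uact (star u * u) x"] mult_left_mono[OF unorm_bound nonneg[of x]]
      by (metis order_trans star)
    also have "\<dots> \<le> 1 * (unorm p (star u * u) * 1)"
      using x unorm_nonneg by (intro mult_mono mult_left_mono mult_nonneg_nonneg) auto
    finally show "(p (uact u x))\<^sup>2 \<le> unorm p (star u * u)" by simp
  qed
  then have "unorm p u \<le> sqrt (unorm p (star u * u))" by (rule unorm_leI)
  then have "(unorm p u)\<^sup>2 \<le> (sqrt (unorm p (star u * u)))\<^sup>2"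
    using unorm_nonneg by (intro power_mono)
  then show ?thesis using unorm_nonneg by simp
qed

lemma cstar_seminorm_unorm: "cstar_seminorm (unorm p)"
  unfolding cstar_seminorm_def
proof (intro conjI allI)
  fix u v :: "'a unitization" and c :: complex
  show "unorm p (u + v) \<le> unorm p u + unorm p v"
    by (rule unorm_leI, unfold uact_simps, rule order_trans[OF triangle])
      (intro add_mono unorm_ge)
  have le: "unorm p (scaleC c u) \<le> cmod c * unorm p u" for c u
    by (rule unorm_leI) (auto simp: uact_simps homogeneous intro: mult_left_mono unorm_ge)
  show "unorm p (scaleC c u) = cmod c * unorm p u"
  proof (cases "c = 0")
    case True
    then show ?thesis using le[of c u] unorm_nonneg[of "scaleC c u"] by simp
  next
    case False
    then have "cmod c * unorm p (scaleC (1 / c) (scaleC c u)) \<le> unorm p (scaleC c u)"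
      using le[of "1 / c" "scaleC c u"] by (simp add: norm_divide field_simps)
    with False le[of c u] show ?thesis by (simp add: scaleC_scaleC scaleC_one)
  qed
  show mult: "unorm p (u * v) \<le> unorm p u * unorm p v" for u v
    by (rule unorm_leI, unfold uact_simps, rule order_trans[OF unorm_bound])
      (intro mult_left_mono unorm_ge unorm_nonneg)
  have star: "unorm p u \<le> unorm p (star u)" for u
  proof (cases "unorm p u = 0")
    case True
    then show ?thesis using unorm_nonneg[of "star u"] by simp
  next
    case False
    have "unorm p u * unorm p u \<le> unorm p (star u) * unorm p u"
      using mult[of "star u" u] unorm_star_le[of u] by (simp add: power2_eq_square)
    with False unorm_nonneg[of u] show ?thesis by (simp add: mult_le_cancel_right less_le)
  qed
  have "unorm p (star u * u) \<le> unorm p u * unorm p u"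
    using mult[of "star u" u] star[of u] star[of "star u"] by (simp add: star_star)
  with unorm_star_le[of u] show "unorm p (star u * u) = (unorm p u)\<^sup>2"
    by (simp add: power2_eq_square)
qed

text \<open>For the lower bound the operator is tested on \<open>star a\<close>, since
  \<open>p (a * star a) = (p a)\<^sup>2\<close>.\<close>

lemma unorm_uembed [simp]: "unorm p (uembed a) = p a"
proof (rule antisym)
  show "unorm p (uembed a) \<le> p a"
  proof (rule unorm_leI)
    fix x assume "p x \<le> 1"
    then show "p (uact (uembed a) x) \<le> p a"
      using submult[of a x] mult_left_mono[of "p x" 1 "p a"] by (simp add: uact_def)
  qed
  show "p a \<le> unorm p (uembed a)"
  proof (cases "p a = 0")
    case True
    then show ?thesis using unorm_nonneg by simp
  next
    case False
    have "p a * p a = p (a * star a)"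
      using cstar_identity[of "star a"] by (simp add: star_star power2_eq_square)
    also have "\<dots> \<le> unorm p (uembed a) * p a"
      using unorm_bound[of "uembed a" "star a"] by (simp add: uact_def)
    finally show ?thesis using False nonneg[of a] by (simp add: mult_le_cancel_right less_le)
  qed
qed

end

section \<open>Positivity and convergence in pro-C*-algebras\<close>

lemma uembed_simps:
  "uembed 0 = 0" "uembed (a + b) = uembed a + uembed b" "uembed (a - b) = uembed a - uembed b"
  "uembed (a * b) = uembed a * uembed b" "uembed (star a) = star (uembed a)"
  "uembed (scaleC c a) = scaleC c (uembed a)"
  by (simp_all add: unitization_defs)

definition cpos :: "('a::complex_star_algebra \<Rightarrow> real) \<Rightarrow> 'a \<Rightarrow> bool" where
  "cpos p a \<longleftrightarrow> ppos (unorm p) (uembed a)"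

context cstar_seminormed
begin

interpretation U: unital_cstar_seminormed "unorm p"
  by unfold_locales (rule cstar_seminorm_unorm)

lemma cpos_zero: "cpos p 0"
  by (simp add: cpos_def uembed_simps U.ppos_zero)

lemma cpos_add: "cpos p a \<Longrightarrow> cpos p b \<Longrightarrow> cpos p (a + b)"
  by (simp add: cpos_def uembed_simps U.ppos_add)

lemma cpos_sum: "(\<And>i. i \<in> I \<Longrightarrow> cpos p (f i)) \<Longrightarrow> cpos p (\<Sum>i\<in>I. f i)"
  by (induction I rule: infinite_finite_induct) (auto intro: cpos_add cpos_zero)

lemma cpos_scale: "cpos p a \<Longrightarrow> 0 \<le> r \<Longrightarrow> cpos p (scaleC (complex_of_real r) a)"
  unfolding cpos_def uembed_simps scaleR_scaleC[symmetric] by (rule U.ppos_scaleR)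

lemma cpos_mono: "cpos p a \<Longrightarrow> cpos p b \<Longrightarrow> p a \<le> p (a + b)"
  using U.ppos_mono[of "uembed a" "uembed b"] by (simp add: cpos_def flip: uembed_simps)

lemma cpos_mono_diff: "cpos p a \<Longrightarrow> cpos p (b - a) \<Longrightarrow> p a \<le> p b"
  using cpos_mono[of a "b - a"] by simp

lemma cpos_limit:
  assumes "\<And>n. cpos p (f n)" "(\<lambda>n::nat. p (f n - a)) \<longlonglongrightarrow> 0" "star a = a"
  shows "cpos p a"
  unfolding cpos_def
proof (rule U.ppos_limit)
  show "ppos (unorm p) (uembed (f n))" for n using assms(1) by (simp add: cpos_def)
  show "(\<lambda>n. unorm p (uembed (f n) - uembed a)) \<longlonglongrightarrow> 0"
    using assms(2) by (simp flip: uembed_simps)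
  show "star (uembed a) = uembed a" using assms(3) by (simp flip: uembed_simps)
qed

lemma cpos_star_mult: "cpos p (star a * a)"
  by (simp add: cpos_def uembed_simps U.ppos_star_mult)

text \<open>The positive element \<open>t - c\<close> lives in the unitization, but conjugation by
  an embedded element returns to the algebra, which is an ideal there.\<close>

lemma cpos_conj_le:
  assumes "star c = c" "p c \<le> t"
  shows "cpos p (scaleC (complex_of_real t) (star u * u) - star u * c * u)"
proof -
  have "ppos (unorm p) (of_real t - uembed c)"
    using assms by (intro U.ppos_of_norm_le) (simp_all flip: uembed_simps)
  then have "ppos (unorm p) (star (uembed u) * (of_real t - uembed c) * uembed u)"
    by (rule U.ppos_conj)
  also have "star (uembed u) * (of_real t - uembed c) * uembed u =
      uembed (scaleC (complex_of_real t) (star u * u) - star u * c * u)"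
    by (simp add: uembed_simps of_real_def[where 'a = "'a unitization"] algebra_simps scaleR_scaleC[symmetric])
  finally show ?thesis by (simp add: cpos_def)
qed

end

lemma cstar_seminormed_cont: "p \<in> cont_seminorms \<Longrightarrow> cstar_seminormed p"
  by (simp add: cont_seminorms_def cstar_seminormed_def)

text \<open>The passage from the order of the definitions to positivity for each seminorm; it rests
  on Kaplansky's theorem.\<close>

lemma cpos_of_cstar_positive:
  assumes "cstar_positive a" "p \<in> cont_seminorms"
  shows "cpos p a"
proof -
  interpret cstar_seminormed p using assms(2) by (rule cstar_seminormed_cont)
  show ?thesis using assms(1) by (auto simp: cstar_positive_def cpos_star_mult)
qed

lemma seminorm_complete_sequence:
  assumes "seminorm_complete X P" "\<And>n::nat. f n \<in> X"
    and "\<And>p \<epsilon>. p \<in> P \<Longrightarrow> \<epsilon> > 0 \<Longrightarrow> \<exists>N. \<forall>m\<ge>N. \<forall>n\<ge>N. p (f m - f n) < \<epsilon>"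
  obtains l where "l \<in> X" "\<And>p. p \<in> P \<Longrightarrow> (\<lambda>n. p (f n - l)) \<longlonglongrightarrow> 0"
proof -
  let ?F = "filtermap f sequentially"
  have "?F \<noteq> bot" by (simp add: filtermap_bot_iff)
  moreover have "?F \<le> principal X" using assms(2) by (simp add: le_principal eventually_filtermap)
  moreover have "\<forall>\<^sub>F (x, y) in ?F \<times>\<^sub>F ?F. p (x - y) < \<epsilon>" if p: "p \<in> P" and \<epsilon>: "\<epsilon> > 0" for p \<epsilon>
  proof -
    obtain N where N: "\<And>m n. m \<ge> N \<Longrightarrow> n \<ge> N \<Longrightarrow> p (f m - f n) < \<epsilon>" using assms(3)[OF p \<epsilon>] by blast
    let ?Q = "\<lambda>x. \<exists>n\<ge>N. x = f n"
    have "eventually ?Q ?F"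
      unfolding eventually_filtermap using eventually_ge_at_top[of N] by eventually_elim auto
    then show ?thesis
      unfolding eventually_prod_filter using N by (intro exI[of _ ?Q]) auto
  qed
  ultimately obtain l where "l \<in> X" "\<forall>p\<in>P. ((\<lambda>x. p (x - l)) \<longlongrightarrow> 0) ?F"
    using assms(1) unfolding seminorm_complete_def by blast
  then show thesis by (intro that) (auto simp: filterlim_filtermap)
qed

lemma openin_seminorm_ball:
  "p \<in> P \<Longrightarrow> x \<in> X \<Longrightarrow> \<epsilon> > 0 \<Longrightarrow> openin (seminorm_topology X P) {y \<in> X. p (y - x) < \<epsilon>}"
  unfolding seminorm_topology_def by (rule topology_generated_by_Basis) blast

section \<open>Convergence in terms of generating seminorms and of all continuous ones\<close>

context
  fixes \<Gamma> :: "('a::pro_cstar_algebra \<Rightarrow> real) set"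
  assumes cstar: "\<forall>p\<in>\<Gamma>. cstar_seminorm p"
    and top: "\<forall>U::'a set. open U \<longleftrightarrow> openin (seminorm_topology UNIV \<Gamma>) U"
begin

text \<open>The balls form a subbasis, so the converse goes by induction over the generated
  topology; around each of its points a ball contains a smaller one by the triangle
  inequality.\<close>

lemma tendsto_iff_generating_seminorms:
  "(f \<longlongrightarrow> l) F \<longleftrightarrow> (\<forall>p\<in>\<Gamma>. ((\<lambda>x. p (f x - l)) \<longlongrightarrow> 0) F)"
proof
  assume f: "(f \<longlongrightarrow> l) F"
  show "\<forall>p\<in>\<Gamma>. ((\<lambda>x. p (f x - l)) \<longlongrightarrow> 0) F"
  proof
    fix p assume p: "p \<in> \<Gamma>"
    interpret cstar_seminormed p using cstar p by unfold_locales auto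
    show "((\<lambda>x. p (f x - l)) \<longlongrightarrow> 0) F"
    proof (rule tendstoI)
      fix e :: real assume e: "e > 0"
      have "open {y \<in> UNIV. p (y - l) < e}"
        using top openin_seminorm_ball[OF p _ e, of l UNIV] by blast
      from topological_tendstoD[OF f this] e
      show "\<forall>\<^sub>F x in F. dist (p (f x - l)) 0 < e" by simp
    qed
  qed
next
  assume f: "\<forall>p\<in>\<Gamma>. ((\<lambda>x. p (f x - l)) \<longlongrightarrow> 0) F"
  show "(f \<longlongrightarrow> l) F"
  proof (rule topological_tendstoI)
    fix S assume S: "open S" "l \<in> S"
    from S(1) have "generate_topology_on
        (insert UNIV {{y \<in> UNIV. p (y - x) < \<epsilon>} | p x \<epsilon>. p \<in> \<Gamma> \<and> x \<in> UNIV \<and> \<epsilon> > 0}) S"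
      unfolding top[rule_format] seminorm_topology_def openin_topology_generated_by_iff .
    then show "\<forall>\<^sub>F x in F. f x \<in> S"
      using S(2)
    proof (induction rule: generate_topology_on.induct)
      case (Int a b)
      then show ?case by (auto intro: eventually_conj)
    next
      case (UN K)
      then obtain k where "k \<in> K" "\<forall>\<^sub>F x in F. f x \<in> k" by blast
      then show ?case by (auto elim: eventually_mono)
    next
      case (Basis s)
      show ?case
      proof (cases "s = UNIV")
        case False
        with Basis obtain p x \<epsilon> where s: "p \<in> \<Gamma>" "s = {y. p (y - x) < \<epsilon>}" by auto
        interpret cstar_seminormed p using cstar s by unfold_locales auto
        have "\<forall>\<^sub>F y in F. p (f y - l) < \<epsilon> - p (l - x)"
          using f s Basis(2) by (intro order_tendstoD(2)) auto
        then show ?thesis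
        proof eventually_elim
          case (elim y)
          then show ?case using triangle[of "f y - l" "l - x"] by (simp add: s)
        qed
      qed simp
    qed simp
  qed
qed

lemma generating_subset_cont: "\<Gamma> \<subseteq> cont_seminorms"
proof
  fix p assume p: "p \<in> \<Gamma>"
  interpret cstar_seminormed p using cstar p by unfold_locales auto
  have "(p \<longlongrightarrow> p x) (at x)" for x
  proof (rule tendsto_of_diff)
    have "((\<lambda>y. y) \<longlongrightarrow> x) (at x)" by (rule tendsto_ident_at)
    then show "((\<lambda>y. p (y - x)) \<longlongrightarrow> 0) (at x)"
      using p unfolding tendsto_iff_generating_seminorms by blast
  qed
  then show "p \<in> cont_seminorms"
    by (simp add: cont_seminorms_def cstar_seminorm continuous_on_eq_continuous_at continuous_at)
qed

text \<open>A continuous seminorm need not belong to \<open>\<Gamma>\<close>, but continuity at 0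
  carries convergence over to it. This frees later statements from the choice of
  \<open>\<Gamma>\<close>.\<close>

lemma cont_seminorm_tendsto_zero:
  assumes "p \<in> cont_seminorms" "\<forall>q\<in>\<Gamma>. ((\<lambda>x. q (f x - l)) \<longlongrightarrow> 0) F"
  shows "((\<lambda>x. p (f x - l)) \<longlongrightarrow> 0) F"
proof -
  interpret cstar_seminormed p using assms(1) by (rule cstar_seminormed_cont)
  have "((\<lambda>x. f x - l) \<longlongrightarrow> 0) F"
    unfolding tendsto_iff_generating_seminorms using assms(2) by simp
  moreover have "isCont p 0"
    using assms(1) by (simp add: cont_seminorms_def continuous_on_eq_continuous_at)
  ultimately show ?thesis using isCont_tendsto_compose by fastforce
qed

end

lemma tendsto_iff_cont_seminorms:
  fixes f :: "'b \<Rightarrow> 'a::pro_cstar_algebra"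
  shows "(f \<longlongrightarrow> l) F \<longleftrightarrow> (\<forall>p\<in>cont_seminorms. ((\<lambda>x. p (f x - l)) \<longlongrightarrow> 0) F)"
proof -
  obtain \<Gamma> :: "('a \<Rightarrow> real) set" where \<Gamma>: "\<forall>p\<in>\<Gamma>. cstar_seminorm p"
    "\<forall>U::'a set. open U \<longleftrightarrow> openin (seminorm_topology UNIV \<Gamma>) U"
    using pro_cstar_topology by blast
  show ?thesis
    unfolding tendsto_iff_generating_seminorms[OF \<Gamma>]
    using generating_subset_cont[OF \<Gamma>] cont_seminorm_tendsto_zero[OF \<Gamma>] by blast
qed

lemma cauchy_convergent:
  fixes f :: "nat \<Rightarrow> 'a::pro_cstar_algebra"
  assumes "\<And>p \<epsilon>. p \<in> cont_seminorms \<Longrightarrow> \<epsilon> > 0 \<Longrightarrow> \<exists>N. \<forall>m\<ge>N. \<forall>n\<ge>N. p (f m - f n) < \<epsilon>"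
  shows "convergent f"
proof -
  obtain \<Gamma> :: "('a \<Rightarrow> real) set" where \<Gamma>: "\<forall>p\<in>\<Gamma>. cstar_seminorm p"
    "\<forall>U::'a set. open U \<longleftrightarrow> openin (seminorm_topology UNIV \<Gamma>) U" "seminorm_complete UNIV \<Gamma>"
    using pro_cstar_topology by blast
  have \<Gamma>_cont: "p \<in> cont_seminorms" if "p \<in> \<Gamma>" for p
    using generating_subset_cont[OF \<Gamma>(1,2)] that by blast
  obtain l where "\<And>p. p \<in> \<Gamma> \<Longrightarrow> (\<lambda>n. p (f n - l)) \<longlonglongrightarrow> 0"
    using seminorm_complete_sequence[OF \<Gamma>(3), of f] assms[OF \<Gamma>_cont] by (metis UNIV_I)
  then have "f \<longlonglongrightarrow> l" unfolding tendsto_iff_generating_seminorms[OF \<Gamma>(1,2)] by blast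
  then show ?thesis by (rule convergentI)
qed

lemma eq_zero_if_cont_seminorms:
  fixes x :: "'a::pro_cstar_algebra"
  assumes "\<And>p. p \<in> cont_seminorms \<Longrightarrow> p x = 0"
  shows "x = 0"
proof -
  have "(\<lambda>n::nat. x) \<longlonglongrightarrow> 0"
    unfolding tendsto_iff_cont_seminorms
  proof
    fix p :: "'a \<Rightarrow> real" assume "p \<in> cont_seminorms"
    from assms[OF this] show "(\<lambda>n::nat. p (x - 0)) \<longlonglongrightarrow> 0" by simp
  qed
  then show ?thesis by (simp add: LIMSEQ_const_iff)
qed

lemma cpos_suminf:
  fixes f :: "nat \<Rightarrow> 'a::pro_cstar_algebra"
  assumes "summable f" "p \<in> cont_seminorms" "\<And>n. cpos p (f n)" "star (suminf f) = suminf f"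
  shows "cpos p (suminf f)"
proof -
  interpret cstar_seminormed p using assms(2) by (rule cstar_seminormed_cont)
  show ?thesis
  proof (rule cpos_limit)
    show "cpos p (sum f {..<n})" for n by (intro cpos_sum assms)
    show "(\<lambda>n. p (sum f {..<n} - suminf f)) \<longlonglongrightarrow> 0"
      using summable_LIMSEQ[OF assms(1)] assms(2) unfolding tendsto_iff_cont_seminorms by blast
  qed fact
qed

lemma tendsto_star:
  fixes f :: "'b \<Rightarrow> 'a::pro_cstar_algebra"
  assumes "(f \<longlongrightarrow> l) F"
  shows "((\<lambda>x. star (f x)) \<longlongrightarrow> star l) F"
  unfolding tendsto_iff_cont_seminorms
proof
  fix p :: "'a \<Rightarrow> real" assume p: "p \<in> cont_seminorms"
  interpret cstar_seminormed p using p by (rule cstar_seminormed_cont)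
  show "((\<lambda>x. p (star (f x) - star l)) \<longlongrightarrow> 0) F"
    using assms p unfolding tendsto_iff_cont_seminorms by (simp flip: star_diff)
qed

text \<open>Makes the general rules \<open>summable_add\<close> and \<open>suminf_add\<close>
  applicable to series in the algebra.\<close>

instance pro_cstar_algebra \<subseteq> topological_comm_monoid_add
proof
  fix a b :: 'a
  show "((\<lambda>x. fst x + snd x) \<longlongrightarrow> a + b) (nhds a \<times>\<^sub>F nhds b)"
    unfolding tendsto_iff_cont_seminorms
  proof
    fix p :: "'a \<Rightarrow> real" assume p: "p \<in> cont_seminorms"
    interpret cstar_seminormed p using p by (rule cstar_seminormed_cont)
    have "(fst \<longlongrightarrow> a) (nhds a \<times>\<^sub>F nhds b)" "(snd \<longlongrightarrow> b) (nhds a \<times>\<^sub>F nhds b)"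
      by (auto intro: filterlim_fst filterlim_snd)
    then have "((\<lambda>x. p (fst x - a) + p (snd x - b)) \<longlongrightarrow> 0) (nhds a \<times>\<^sub>F nhds b)"
      using p unfolding tendsto_iff_cont_seminorms by (intro tendsto_add_zero) auto
    then show "((\<lambda>x. p (fst x + snd x - (a + b))) \<longlongrightarrow> 0) (nhds a \<times>\<^sub>F nhds b)"
      by (rule Lim_null_comparison[rotated])
        (simp add: add_diff_add triangle)
  qed
qed

lemma tendsto_mult_const_pro_cstar:
  fixes f :: "'b \<Rightarrow> 'a::pro_cstar_algebra"
  assumes "(f \<longlongrightarrow> l) F"
  shows "((\<lambda>x. f x * a) \<longlongrightarrow> l * a) F" and "((\<lambda>x. a * f x) \<longlongrightarrow> a * l) F"
proof -
  have right: "((\<lambda>x. g x * a) \<longlongrightarrow> m * a) F" if g: "(g \<longlongrightarrow> m) F" for g :: "'b \<Rightarrow> 'a" and m a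
    unfolding tendsto_iff_cont_seminorms
  proof
    fix p :: "'a \<Rightarrow> real" assume p: "p \<in> cont_seminorms"
    interpret cstar_seminormed p using p by (rule cstar_seminormed_cont)
    have "((\<lambda>x. p (g x - m) * p a) \<longlongrightarrow> 0) F"
      using g p unfolding tendsto_iff_cont_seminorms by (intro tendsto_mult_left_zero) auto
    then show "((\<lambda>x. p (g x * a - m * a)) \<longlongrightarrow> 0) F"
      by (rule Lim_null_comparison[rotated])
        (simp add: submult flip: left_diff_distrib)
  qed
  show "((\<lambda>x. f x * a) \<longlongrightarrow> l * a) F" by (rule right[OF assms])
  show "((\<lambda>x. a * f x) \<longlongrightarrow> a * l) F"
    using tendsto_star[OF right[OF tendsto_star[OF assms], of "star a"]]
    by (simp add: star_mult star_star)
qed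

section \<open>The Cauchy--Schwarz inequality\<close>

text \<open>The terms missing from \<open>I\<close> are positive, so longer partial sums dominate in
  seminorm.\<close>

lemma sum_le_suminf_seminorm:
  fixes f :: "nat \<Rightarrow> 'a::pro_cstar_algebra"
  assumes "summable f" "p \<in> cont_seminorms" "\<And>n. cpos p (f n)" "finite I"
  shows "p (sum f I) \<le> p (suminf f)"
proof -
  interpret cstar_seminormed p using assms(2) by (rule cstar_seminormed_cont)
  have "(\<lambda>n. p (sum f {..<n})) \<longlonglongrightarrow> p (suminf f)"
    using summable_LIMSEQ[OF assms(1)] assms(2)
    by (intro tendsto_of_diff) (auto simp: tendsto_iff_cont_seminorms)
  moreover obtain N where N: "I \<subseteq> {..<N}" using assms(4) by (meson finite_nat_bounded)
  have "p (sum f I) \<le> p (sum f {..<n})" if "n \<ge> N" for n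
  proof -
    have "I \<subseteq> {..<n}" using N that by auto
    then have "sum f {..<n} - sum f I = sum f ({..<n} - I)"
      by (simp add: sum_diff)
    then show ?thesis by (intro cpos_mono_diff) (auto intro!: cpos_sum assms(3))
  qed
  ultimately show ?thesis by (intro LIMSEQ_le_const) auto
qed

lemma summable_iff_cauchy:
  fixes f :: "nat \<Rightarrow> 'a::pro_cstar_algebra"
  shows "summable f \<longleftrightarrow>
    (\<forall>p\<in>cont_seminorms. \<forall>\<epsilon>>0. \<exists>N. \<forall>n\<ge>N. \<forall>m. p (sum f {n..<m}) < \<epsilon>)"
proof
  assume f: "summable f"
  show "\<forall>p\<in>cont_seminorms. \<forall>\<epsilon>>0. \<exists>N. \<forall>n\<ge>N. \<forall>m. p (sum f {n..<m}) < \<epsilon>"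
  proof (intro ballI allI impI)
    fix p :: "'a \<Rightarrow> real" and \<epsilon> :: real assume p: "p \<in> cont_seminorms" and \<epsilon>: "\<epsilon> > 0"
    interpret cstar_seminormed p using p by (rule cstar_seminormed_cont)
    have "(\<lambda>n. p (sum f {..<n} - suminf f)) \<longlonglongrightarrow> 0"
      using summable_LIMSEQ[OF f] p unfolding tendsto_iff_cont_seminorms by blast
    then have "\<forall>\<^sub>F n in sequentially. p (sum f {..<n} - suminf f) < \<epsilon> / 2"
      using \<epsilon> by (intro order_tendstoD(2)) auto
    then obtain N where N: "\<And>n. n \<ge> N \<Longrightarrow> p (sum f {..<n} - suminf f) < \<epsilon> / 2"
      by (auto simp: eventually_sequentially)
    have "p (sum f {n..<m}) < \<epsilon>" if n: "n \<ge> N" for n m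
    proof (cases "n \<le> m")
      case True
      then have "sum f {n..<m} = (sum f {..<m} - suminf f) - (sum f {..<n} - suminf f)"
        using sum_diff_nat_ivl[of 0 n m f] by (simp add: atLeast0LessThan)
      then show ?thesis
        using triangle_diff[of "sum f {..<m} - suminf f" "sum f {..<n} - suminf f"] N[of n] N[of m] n True
        by simp
    qed (use \<epsilon> in simp)
    then show "\<exists>N. \<forall>n\<ge>N. \<forall>m. p (sum f {n..<m}) < \<epsilon>" by blast
  qed
next
  assume f: "\<forall>p\<in>cont_seminorms. \<forall>\<epsilon>>0. \<exists>N. \<forall>n\<ge>N. \<forall>m. p (sum f {n..<m}) < \<epsilon>"
  have "convergent (\<lambda>n. sum f {..<n})"
  proof (rule cauchy_convergent)
    fix p :: "'a \<Rightarrow> real" and \<epsilon> :: real assume p: "p \<in> cont_seminorms" and \<epsilon>: "\<epsilon> > 0"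
    interpret cstar_seminormed p using p by (rule cstar_seminormed_cont)
    obtain N where N: "\<And>n m. n \<ge> N \<Longrightarrow> p (sum f {n..<m}) < \<epsilon>" using f p \<epsilon> by blast
    have *: "p (sum f {..<m} - sum f {..<n}) < \<epsilon>" if "n \<ge> N" "n \<le> m" for m n
      using N[of n m] that sum_diff_nat_ivl[of 0 n m f] by (simp add: atLeast0LessThan)
    have "p (sum f {..<m} - sum f {..<n}) < \<epsilon>" if "n \<ge> N" "m \<ge> N" for m n
      using *[of n m] *[of m n] that minus_commute[of "sum f {..<m}" "sum f {..<n}"] by linarith
    then show "\<exists>N. \<forall>m\<ge>N. \<forall>n\<ge>N. p (sum f {..<m} - sum f {..<n}) < \<epsilon>" by blast
  qed
  then show "summable f" by (simp add: summable_iff_convergent)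
qed

text \<open>The part of a pre-Hilbert module structure needed for the Cauchy--Schwarz inequality. In
  contrast to \<open>pre_hilbert_module\<close>, the inner product may be degenerate, and positivity is required
  for each seminorm separately, which is preserved by limits.\<close>

locale semi_inner_module =
  fixes E :: "('a::pro_cstar_algebra, 'e::ab_group_add) cmodule"
  assumes semi_zero_closed: "0 \<in> mcarrier E"
    and semi_add_closed: "\<lbrakk>\<xi> \<in> mcarrier E; \<eta> \<in> mcarrier E\<rbrakk> \<Longrightarrow> \<xi> + \<eta> \<in> mcarrier E"
    and semi_uminus_closed: "\<xi> \<in> mcarrier E \<Longrightarrow> - \<xi> \<in> mcarrier E"
    and semi_scale_closed: "\<xi> \<in> mcarrier E \<Longrightarrow> mscale E c \<xi> \<in> mcarrier E"
    and semi_act_closed: "\<xi> \<in> mcarrier E \<Longrightarrow> mact E \<xi> a \<in> mcarrier E"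
    and semi_inner_add: "\<lbrakk>\<xi> \<in> mcarrier E; \<eta> \<in> mcarrier E; \<zeta> \<in> mcarrier E\<rbrakk> \<Longrightarrow>
          minner E \<xi> (\<eta> + \<zeta>) = minner E \<xi> \<eta> + minner E \<xi> \<zeta>"
    and semi_inner_scale: "\<lbrakk>\<xi> \<in> mcarrier E; \<eta> \<in> mcarrier E\<rbrakk> \<Longrightarrow>
          minner E \<xi> (mscale E c \<eta>) = scaleC c (minner E \<xi> \<eta>)"
    and semi_inner_act: "\<lbrakk>\<xi> \<in> mcarrier E; \<eta> \<in> mcarrier E\<rbrakk> \<Longrightarrow>
          minner E \<xi> (mact E \<eta> a) = minner E \<xi> \<eta> * a"
    and semi_inner_star: "\<lbrakk>\<xi> \<in> mcarrier E; \<eta> \<in> mcarrier E\<rbrakk> \<Longrightarrow>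
          star (minner E \<xi> \<eta>) = minner E \<eta> \<xi>"
    and semi_inner_cpos: "\<lbrakk>\<xi> \<in> mcarrier E; p \<in> cont_seminorms\<rbrakk> \<Longrightarrow> cpos p (minner E \<xi> \<xi>)"
begin

lemma semi_diff_closed: "\<xi> \<in> mcarrier E \<Longrightarrow> \<eta> \<in> mcarrier E \<Longrightarrow> \<xi> - \<eta> \<in> mcarrier E"
  using semi_add_closed[of \<xi> "- \<eta>"] semi_uminus_closed by simp

lemma semi_sum_closed: "(\<And>i. i \<in> I \<Longrightarrow> f i \<in> mcarrier E) \<Longrightarrow> (\<Sum>i\<in>I. f i) \<in> mcarrier E"
  by (induction I rule: infinite_finite_induct) (auto intro: semi_zero_closed semi_add_closed)

lemma inner_zero_right: "\<xi> \<in> mcarrier E \<Longrightarrow> minner E \<xi> 0 = 0"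
  using semi_inner_add[of \<xi> 0 0] semi_zero_closed by simp

lemma inner_minus_right:
  "\<xi> \<in> mcarrier E \<Longrightarrow> \<eta> \<in> mcarrier E \<Longrightarrow> minner E \<xi> (- \<eta>) = - minner E \<xi> \<eta>"
  using semi_inner_add[of \<xi> \<eta> "- \<eta>"] semi_uminus_closed[of \<eta>] inner_zero_right[of \<xi>]
  by (intro minus_unique[symmetric]) simp

lemma inner_diff_right:
  "\<xi> \<in> mcarrier E \<Longrightarrow> \<eta> \<in> mcarrier E \<Longrightarrow> \<zeta> \<in> mcarrier E \<Longrightarrow>
    minner E \<xi> (\<eta> - \<zeta>) = minner E \<xi> \<eta> - minner E \<xi> \<zeta>"
  using semi_inner_add[of \<xi> \<eta> "- \<zeta>"] semi_uminus_closed[of \<zeta>] inner_minus_right by simp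

lemma inner_sum_right:
  assumes "\<xi> \<in> mcarrier E" "\<And>i. i \<in> I \<Longrightarrow> f i \<in> mcarrier E"
  shows "minner E \<xi> (\<Sum>i\<in>I. f i) = (\<Sum>i\<in>I. minner E \<xi> (f i))"
  using assms(2)
proof (induction I rule: infinite_finite_induct)
  case (insert i I)
  then have "minner E \<xi> (f i + sum f I) = minner E \<xi> (f i) + minner E \<xi> (sum f I)"
    by (intro semi_inner_add semi_sum_closed assms(1)) blast+
  moreover have "minner E \<xi> (sum f I) = (\<Sum>i\<in>I. minner E \<xi> (f i))"
    using insert.IH insert.prems by blast
  ultimately show ?case using insert.hyps by (simp only: sum.insert not_False_eq_True)
next
  case (infinite I)
  then show ?case by (simp only: sum.infinite not_False_eq_True inner_zero_right[OF assms(1)])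
next
  case empty
  show ?case by (simp only: sum.empty inner_zero_right[OF assms(1)])
qed

lemma inner_add_left:
  assumes "\<xi> \<in> mcarrier E" "\<eta> \<in> mcarrier E" "\<zeta> \<in> mcarrier E"
  shows "minner E (\<xi> + \<eta>) \<zeta> = minner E \<xi> \<zeta> + minner E \<eta> \<zeta>"
proof -
  have "star (minner E \<zeta> (\<xi> + \<eta>)) = star (minner E \<zeta> \<xi>) + star (minner E \<zeta> \<eta>)"
    by (simp only: semi_inner_add assms star_add)
  then show ?thesis by (simp only: semi_inner_star semi_add_closed assms)
qed

lemma inner_minus_left:
  assumes "\<xi> \<in> mcarrier E" "\<eta> \<in> mcarrier E"
  shows "minner E (- \<xi>) \<eta> = - minner E \<xi> \<eta>"
proof -
  have "star (minner E \<eta> (- \<xi>)) = - star (minner E \<eta> \<xi>)"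
    by (simp only: inner_minus_right assms star_minus)
  then show ?thesis by (simp only: semi_inner_star semi_uminus_closed assms)
qed

lemma inner_diff_left:
  assumes "\<xi> \<in> mcarrier E" "\<eta> \<in> mcarrier E" "\<zeta> \<in> mcarrier E"
  shows "minner E (\<xi> - \<eta>) \<zeta> = minner E \<xi> \<zeta> - minner E \<eta> \<zeta>"
  using inner_add_left[of \<xi> "- \<eta>" \<zeta>] assms by (simp add: semi_uminus_closed inner_minus_left)

lemma inner_act_left:
  assumes "\<xi> \<in> mcarrier E" "\<eta> \<in> mcarrier E"
  shows "minner E (mact E \<xi> a) \<eta> = star a * minner E \<xi> \<eta>"
proof -
  have "star (minner E \<eta> (mact E \<xi> a)) = star a * star (minner E \<eta> \<xi>)"
    by (simp only: semi_inner_act assms star_mult)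
  then show ?thesis by (simp only: semi_inner_star semi_act_closed assms)
qed

text \<open>Positivity of \<open>minner E (\<eta> - \<zeta>) (\<eta> - \<zeta>)\<close>, where
  \<open>\<zeta>\<close> is \<open>\<xi>\<close> acted on by \<open>u\<close> divided by
  \<open>s\<close>. The natural coefficient would use the inverse of \<open>c\<close>, which may not
  exist; a scalar \<open>s > p c\<close> replaces \<open>c\<close>, and \<open>cpos_conj_le\<close>
  absorbs the quadratic term.\<close>

lemma cauchy_schwarz_squared:
  assumes "\<xi> \<in> mcarrier E" "\<eta> \<in> mcarrier E" "p \<in> cont_seminorms"
  shows "(p (minner E \<xi> \<eta>))\<^sup>2 \<le> p (minner E \<xi> \<xi>) * p (minner E \<eta> \<eta>)"
proof -
  interpret cstar_seminormed p using assms(3) by (rule cstar_seminormed_cont)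
  define c u where "c = minner E \<xi> \<xi>" and "u = minner E \<xi> \<eta>"
  have su: "minner E \<eta> \<xi> = star u" using assms by (simp add: u_def semi_inner_star)
  have *: "(p u)\<^sup>2 \<le> s * p (minner E \<eta> \<eta>)" if s: "s > p c" for s
  proof -
    have s0: "s > 0" using nonneg s by (rule le_less_trans)
    define r where "r = complex_of_real (1 / s)"
    define a where "a = scaleC r u"
    define \<zeta> where "\<zeta> = mact E \<xi> a"
    have \<zeta>: "\<zeta> \<in> mcarrier E" using assms by (simp add: \<zeta>_def semi_act_closed)
    have r: "r * (r * complex_of_real s) = r" using s0 by (simp add: r_def)
    have rr: "complex_of_real (1 / s * (1 / s)) = r * r" by (simp add: r_def)
    have "minner E (\<eta> - \<zeta>) (\<eta> - \<zeta>) =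
        minner E \<eta> \<eta> - star u * a - (star a * u - star a * c * a)"
      using assms \<zeta> su by (simp add: inner_diff_left inner_diff_right semi_diff_closed)
        (simp add: \<zeta>_def inner_act_left semi_inner_act semi_act_closed c_def u_def mult.assoc)
    also have "star a = scaleC r (star u)" by (simp add: a_def star_scaleC r_def)
    finally have sq: "minner E (\<eta> - \<zeta>) (\<eta> - \<zeta>) = minner E \<eta> \<eta> - scaleC r (star u * u) -
        (scaleC r (star u * u) - scaleC (r * r) (star u * c * u))"
      by (simp add: a_def mult_scaleC_left mult_scaleC_right scaleC_scaleC)
    have "cpos p (scaleC (complex_of_real s) (star u * u) - star u * c * u)"
      using assms s by (intro cpos_conj_le) (simp_all add: c_def semi_inner_star)
    then have "cpos p (scaleC (complex_of_real (1 / s * (1 / s)))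
        (scaleC (complex_of_real s) (star u * u) - star u * c * u))"
      by (rule cpos_scale) simp
    then have "cpos p (scaleC r (star u * u) - scaleC (r * r) (star u * c * u))"
      unfolding rr using r by (simp add: scaleC_diff_right scaleC_scaleC mult.assoc)
    moreover have "cpos p (minner E (\<eta> - \<zeta>) (\<eta> - \<zeta>))"
      using assms \<zeta> by (intro semi_inner_cpos semi_diff_closed)
    ultimately have "cpos p (minner E (\<eta> - \<zeta>) (\<eta> - \<zeta>) +
        (scaleC r (star u * u) - scaleC (r * r) (star u * c * u)))"
      by (rule cpos_add[rotated])
    then have "cpos p (minner E \<eta> \<eta> - scaleC r (star u * u))" unfolding sq by simp
    moreover have "cpos p (scaleC r (star u * u))"
      unfolding r_def using s0 by (intro cpos_scale cpos_star_mult) simp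
    ultimately have "p (scaleC r (star u * u)) \<le> p (minner E \<eta> \<eta>)"
      by (rule cpos_mono_diff[rotated])
    then show ?thesis using s0 by (simp add: homogeneous cstar_identity r_def norm_divide field_simps)
  qed
  have "(p u)\<^sup>2 \<le> p c * p (minner E \<eta> \<eta>)"
  proof (rule field_le_epsilon)
    fix e :: real assume e: "e > 0"
    let ?y = "p (minner E \<eta> \<eta>)"
    have y: "0 \<le> ?y" by simp
    \<comment> \<open>This \<open>s\<close> exceeds \<open>p c\<close> strictly and costs at most
      \<open>e\<close> after multiplication by \<open>?y\<close>.\<close>
    have "(p u)\<^sup>2 \<le> (p c + e / (?y + 1)) * ?y" using e y by (intro *) (simp add: add_nonneg_pos)
    also have "\<dots> = p c * ?y + e * (?y / (?y + 1))" by (simp add: algebra_simps)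
    also have "\<dots> \<le> p c * ?y + e * 1" using e y by (intro add_left_mono mult_left_mono) (auto simp: divide_le_eq_1 add_nonneg_pos)
    finally show "(p u)\<^sup>2 \<le> p c * ?y + e" by simp
  qed
  then show ?thesis by (simp add: c_def u_def)
qed

lemma mseminorm_nonneg: "p \<in> cont_seminorms \<Longrightarrow> 0 \<le> mseminorm E p \<xi>"
  by (simp add: mseminorm_def cstar_seminormed.nonneg[OF cstar_seminormed_cont])

lemma mseminorm_squared: "p \<in> cont_seminorms \<Longrightarrow> (mseminorm E p \<xi>)\<^sup>2 = p (minner E \<xi> \<xi>)"
  by (simp add: mseminorm_def cstar_seminormed.nonneg[OF cstar_seminormed_cont])

lemma cauchy_schwarz:
  assumes "\<xi> \<in> mcarrier E" "\<eta> \<in> mcarrier E" "p \<in> cont_seminorms"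
  shows "p (minner E \<xi> \<eta>) \<le> mseminorm E p \<xi> * mseminorm E p \<eta>"
  using cauchy_schwarz_squared[OF assms] assms(3)
  by (intro power2_le_imp_le[OF _ mult_nonneg_nonneg])
    (simp_all add: power_mult_distrib mseminorm_squared mseminorm_nonneg)

lemma mseminorm_triangle:
  assumes "\<xi> \<in> mcarrier E" "\<eta> \<in> mcarrier E" "p \<in> cont_seminorms"
  shows "mseminorm E p (\<xi> + \<eta>) \<le> mseminorm E p \<xi> + mseminorm E p \<eta>"
proof (rule power2_le_imp_le)
  interpret cstar_seminormed p using assms(3) by (rule cstar_seminormed_cont)
  let ?x = "mseminorm E p \<xi>" and ?y = "mseminorm E p \<eta>"
  have "minner E (\<xi> + \<eta>) (\<xi> + \<eta>) =
      (minner E \<xi> \<xi> + minner E \<xi> \<eta>) + (minner E \<eta> \<xi> + minner E \<eta> \<eta>)"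
    using assms by (simp add: inner_add_left semi_inner_add semi_add_closed)
  then have "p (minner E (\<xi> + \<eta>) (\<xi> + \<eta>)) \<le>
      p (minner E \<xi> \<xi>) + p (minner E \<xi> \<eta>) + (p (minner E \<eta> \<xi>) + p (minner E \<eta> \<eta>))"
    by (simp only: order_trans[OF triangle add_mono[OF triangle triangle]])
  also have "\<dots> \<le> ?x\<^sup>2 + ?x * ?y + (?y * ?x + ?y\<^sup>2)"
    using assms by (intro add_mono cauchy_schwarz) (simp_all add: mseminorm_squared)
  also have "\<dots> = (?x + ?y)\<^sup>2" by algebra
  finally show "(mseminorm E p (\<xi> + \<eta>))\<^sup>2 \<le> (?x + ?y)\<^sup>2"
    by (simp only: mseminorm_squared assms(3))
  show "0 \<le> ?x + ?y" using assms by (simp add: mseminorm_nonneg)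
qed

lemma mseminorm_zero: "p \<in> cont_seminorms \<Longrightarrow> mseminorm E p 0 = 0"
  using semi_zero_closed cstar_seminormed.zero[OF cstar_seminormed_cont]
  by (simp add: mseminorm_def inner_zero_right)

lemma mseminorm_minus: "\<xi> \<in> mcarrier E \<Longrightarrow> mseminorm E p (- \<xi>) = mseminorm E p \<xi>"
  by (simp add: mseminorm_def inner_minus_left inner_minus_right semi_uminus_closed)

lemma mseminorm_minus_commute:
  "\<xi> \<in> mcarrier E \<Longrightarrow> \<eta> \<in> mcarrier E \<Longrightarrow> mseminorm E p (\<xi> - \<eta>) = mseminorm E p (\<eta> - \<xi>)"
  using mseminorm_minus[of "\<xi> - \<eta>" p] semi_diff_closed by simp

lemma mseminorm_triangle_diff:
  assumes "\<xi> \<in> mcarrier E" "\<eta> \<in> mcarrier E" "p \<in> cont_seminorms"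
  shows "mseminorm E p (\<xi> - \<eta>) \<le> mseminorm E p \<xi> + mseminorm E p \<eta>"
  using mseminorm_triangle[of \<xi> "- \<eta>" p] assms by (simp add: semi_uminus_closed mseminorm_minus)

lemma mseminorm_sum:
  assumes "\<And>i. i \<in> I \<Longrightarrow> f i \<in> mcarrier E" "p \<in> cont_seminorms"
  shows "mseminorm E p (\<Sum>i\<in>I. f i) \<le> (\<Sum>i\<in>I. mseminorm E p (f i))"
  using assms(1)
proof (induction I rule: infinite_finite_induct)
  case (insert i I)
  then have "mseminorm E p (f i + sum f I) \<le> mseminorm E p (f i) + mseminorm E p (sum f I)"
    by (intro mseminorm_triangle semi_sum_closed assms(2)) auto
  with insert show ?case by simp
qed (auto simp: mseminorm_zero assms)

lemma tendsto_inner: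
  assumes "\<And>n. f n \<in> mcarrier E" "l \<in> mcarrier E" "\<xi> \<in> mcarrier E"
    and "\<And>p. p \<in> cont_seminorms \<Longrightarrow> (\<lambda>n::nat. mseminorm E p (f n - l)) \<longlonglongrightarrow> 0"
  shows "(\<lambda>n. minner E \<xi> (f n)) \<longlonglongrightarrow> minner E \<xi> l"
  unfolding tendsto_iff_cont_seminorms
proof
  fix p :: "'a \<Rightarrow> real" assume p: "p \<in> cont_seminorms"
  interpret cstar_seminormed p using p by (rule cstar_seminormed_cont)
  have "(\<lambda>n. mseminorm E p \<xi> * mseminorm E p (f n - l)) \<longlonglongrightarrow> 0"
    using assms(4)[OF p] by (rule tendsto_mult_right_zero)
  then show "(\<lambda>n. p (minner E \<xi> (f n) - minner E \<xi> l)) \<longlonglongrightarrow> 0"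
    by (rule Lim_null_comparison[rotated])
      (use assms(1-3) p in \<open>auto simp: cauchy_schwarz semi_diff_closed simp flip: inner_diff_right\<close>)
qed

end

lemma semi_inner_moduleI_pre_hilbert:
  assumes "pre_hilbert_module E"
  shows "semi_inner_module E"
proof -
  interpret pre_hilbert_module E by fact
  have zero: "mscale E 0 \<xi> = 0" if "\<xi> \<in> mcarrier E" for \<xi>
    using scale_add_left[OF that, of 0 0] by simp
  have minus: "- \<xi> = mscale E (- 1) \<xi>" if "\<xi> \<in> mcarrier E" for \<xi>
    using scale_add_left[OF that, of 1 "- 1"] zero[OF that] scale_one[OF that]
    by (intro minus_unique) simp
  show ?thesis
  proof
    show "cpos p (minner E \<xi> \<xi>)" if "\<xi> \<in> mcarrier E" "p \<in> cont_seminorms" for \<xi> p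
      using inner_nonneg[OF that(1)] that(2) by (auto simp: cstar_le_def intro: cpos_of_cstar_positive)
  qed (auto simp: zero_closed add_closed minus scale_closed act_closed inner_add inner_scale inner_act inner_star)
qed

section \<open>Seminorm topologies and the standard module\<close>

text \<open>The balls of the whole space whose trace on \<open>A\<close> lies in \<open>U\<close>
  have an open union, and its trace on \<open>A\<close> is \<open>U\<close>.\<close>

lemma openin_subtopology_seminorm:
  assumes "\<And>p. p \<in> P \<Longrightarrow> p 0 = 0" "U \<subseteq> A" "A \<subseteq> X"
    and "\<And>x. x \<in> U \<Longrightarrow> \<exists>p\<in>P. \<exists>\<epsilon>>0. {y \<in> A. p (y - x) < \<epsilon>} \<subseteq> U"
  shows "openin (subtopology (seminorm_topology X P) A) U"
proof -
  define B where "B = {{y \<in> X. p (y - x) < \<epsilon>} | p x \<epsilon>. p \<in> P \<and> x \<in> U \<and> \<epsilon> > 0 \<and> {y \<in> A. p (y - x) < \<epsilon>} \<subseteq> U}"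
  have "openin (seminorm_topology X P) (\<Union>B)"
    using assms(2,3) by (auto simp: B_def intro!: openin_seminorm_ball)
  moreover have "U = \<Union>B \<inter> A"
  proof (intro equalityI subsetI)
    fix x assume x: "x \<in> U"
    then obtain p \<epsilon> where p: "p \<in> P" "\<epsilon> > 0" "{y \<in> A. p (y - x) < \<epsilon>} \<subseteq> U" using assms(4) by blast
    then have "{y \<in> X. p (y - x) < \<epsilon>} \<in> B" using x by (auto simp: B_def)
    moreover have "x \<in> {y \<in> X. p (y - x) < \<epsilon>}" using x p assms(1)[OF p(1)] assms(2,3) by auto
    ultimately show "x \<in> \<Union>B \<inter> A" using x assms(2) by blast
  qed (use assms(3) in \<open>auto simp: B_def\<close>)
  ultimately show ?thesis unfolding openin_subtopology by blast
qed

lemma topspace_seminorm_topology [simp]: "topspace (seminorm_topology X P) = X"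
  by (auto simp: seminorm_topology_def)

text \<open>Formulated for a subspace \<open>A\<close> to serve both a map on its whole domain and
  the inverse on its range. The triangle inequality is asked for on \<open>Y\<close> because module
  seminorms are controlled only on carriers.\<close>

lemma continuous_map_seminorm_lipschitz:
  assumes "\<And>p. p \<in> P \<Longrightarrow> p 0 = 0" "A \<subseteq> X" "f ` A \<subseteq> Y"
    and "\<And>q a b c. q \<in> Q \<Longrightarrow> a \<in> Y \<Longrightarrow> b \<in> Y \<Longrightarrow> c \<in> Y \<Longrightarrow> q (a - c) \<le> q (a - b) + q (b - c)"
    and "\<And>q. q \<in> Q \<Longrightarrow> \<exists>p\<in>P. \<exists>K>0. \<forall>x\<in>A. \<forall>y\<in>A. q (f y - f x) \<le> K * p (y - x)"
  shows "continuous_map (subtopology (seminorm_topology X P) A) (seminorm_topology Y Q) f"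
proof -
  have top: "topspace (subtopology (seminorm_topology X P) A) = A" using assms(2) by auto
  show ?thesis
    unfolding seminorm_topology_def[of Y Q]
  proof (rule continuous_on_generated_topo)
    show "f ` topspace (subtopology (seminorm_topology X P) A) \<subseteq>
        \<Union> (insert Y {{y \<in> Y. q (y - x) < \<epsilon>} | q x \<epsilon>. q \<in> Q \<and> x \<in> Y \<and> \<epsilon> > 0})"
      using assms(3) unfolding top by blast
    fix U assume "U \<in> insert Y {{y \<in> Y. q (y - x) < \<epsilon>} | q x \<epsilon>. q \<in> Q \<and> x \<in> Y \<and> \<epsilon> > 0}"
    then consider "U = Y" | q z \<epsilon> where "U = {y \<in> Y. q (y - z) < \<epsilon>}" "q \<in> Q" "z \<in> Y" by blast
    then show "openin (subtopology (seminorm_topology X P) A)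
        (f -` U \<inter> topspace (subtopology (seminorm_topology X P) A))"
    proof cases
      case 1
      then have "f -` U \<inter> A = A" using assms(3) by blast
      then show ?thesis unfolding top by (metis openin_topspace top)
    next
      case 2
      obtain p K where p: "p \<in> P" "K > 0" "\<And>x y. x \<in> A \<Longrightarrow> y \<in> A \<Longrightarrow> q (f y - f x) \<le> K * p (y - x)"
        using assms(5)[OF 2(2)] by blast
      show ?thesis
        unfolding top
      proof (rule openin_subtopology_seminorm)
        fix x assume x: "x \<in> f -` U \<inter> A"
        let ?e = "(\<epsilon> - q (f x - z)) / K"
        have "?e > 0" using x 2(1) p(2) by simp
        moreover have "{y \<in> A. p (y - x) < ?e} \<subseteq> f -` U \<inter> A"
        proof
          fix y assume y: "y \<in> {y \<in> A. p (y - x) < ?e}"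
          then have "K * p (y - x) < \<epsilon> - q (f x - z)" using p(2) by (simp add: field_simps)
          moreover have "q (f y - z) \<le> q (f y - f x) + q (f x - z)"
            using x y assms(3) 2 by (intro assms(4)) auto
          ultimately show "y \<in> f -` U \<inter> A" using p(3)[of x y] x y assms(3) 2(1) by auto
        qed
        ultimately show "\<exists>p\<in>P. \<exists>\<epsilon>>0. {y \<in> A. p (y - x) < \<epsilon>} \<subseteq> f -` U \<inter> A" using p(1) by blast
      qed (use assms(1,2) in auto)
    qed
  qed
qed

section \<open>Series in the algebra and the module of sequences\<close>

lemma sums_mult_const_pro_cstar:
  fixes f :: "nat \<Rightarrow> 'a::pro_cstar_algebra"
  assumes "f sums s"
  shows "(\<lambda>n. f n * a) sums (s * a)" and "(\<lambda>n. a * f n) sums (a * s)"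
  using tendsto_mult_const_pro_cstar[OF assms[unfolded sums_def], of a]
  by (simp_all add: sums_def sum_distrib_left sum_distrib_right)

lemma sums_star:
  fixes f :: "nat \<Rightarrow> 'a::pro_cstar_algebra"
  assumes "f sums s"
  shows "(\<lambda>n. star (f n)) sums star s"
  using tendsto_star[OF assms[unfolded sums_def]] by (simp add: sums_def star_sum)

lemma sums_scaleC:
  fixes f :: "nat \<Rightarrow> 'a::pro_cstar_algebra"
  assumes "f sums s"
  shows "(\<lambda>n. scaleC c (f n)) sums scaleC c s"
proof -
  have sum: "(\<Sum>i\<in>I. scaleC c (f i)) = scaleC c (sum f I)" for I
    by (induction I rule: infinite_finite_induct) (auto simp: scaleC_add_right)
  have "(\<lambda>n. scaleC c (sum f {..<n})) \<longlonglongrightarrow> scaleC c s"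
    unfolding tendsto_iff_cont_seminorms
  proof
    fix p :: "'a \<Rightarrow> real" assume p: "p \<in> cont_seminorms"
    interpret cstar_seminormed p using p by (rule cstar_seminormed_cont)
    have "(\<lambda>n. p (sum f {..<n} - s)) \<longlonglongrightarrow> 0"
      using assms p unfolding sums_def tendsto_iff_cont_seminorms by blast
    then show "(\<lambda>n. p (scaleC c (sum f {..<n}) - scaleC c s)) \<longlonglongrightarrow> 0"
      by (simp add: homogeneous tendsto_mult_right_zero flip: scaleC_diff_right)
  qed
  then show ?thesis by (simp add: sums_def sum)
qed

text \<open>All sequences form a module under the inner product summed over \<open>I\<close>.
  Coordinates outside \<open>I\<close> make it degenerate, which \<open>semi_inner_module\<close>
  permits.\<close>

lemma star_mult_sum_cauchy_schwarz:
  fixes x y :: "nat \<Rightarrow> 'a::pro_cstar_algebra"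
  assumes "p \<in> cont_seminorms"
  shows "(p (\<Sum>n\<in>I. star (x n) * y n))\<^sup>2 \<le> p (\<Sum>n\<in>I. star (x n) * x n) * p (\<Sum>n\<in>I. star (y n) * y n)"
proof -
  let ?M = "\<lparr>mcarrier = UNIV, mscale = (\<lambda>c x n. scaleC c (x n)), mact = (\<lambda>x b n. x n * b),
    minner = (\<lambda>x y. \<Sum>n\<in>I. star (x n) * y n)\<rparr> :: ('a, nat \<Rightarrow> 'a) cmodule"
  have scale: "(\<Sum>n\<in>I. scaleC c (f n)) = scaleC c (\<Sum>n\<in>I. f n)" for c and f :: "nat \<Rightarrow> 'a"
    by (induction I rule: infinite_finite_induct) (auto simp: scaleC_add_right)
  interpret semi_inner_module ?M
  proof
    fix p :: "'a \<Rightarrow> real" and x assume p: "p \<in> cont_seminorms"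
    interpret cstar_seminormed p using p by (rule cstar_seminormed_cont)
    show "cpos p (minner ?M x x)" by (auto intro: cpos_sum cpos_star_mult)
  qed (auto simp: sum.distrib ring_distribs sum_distrib_right mult.assoc star_sum star_mult star_star
      mult_scaleC_right scale)
  from cauchy_schwarz_squared[of x y p] assms show ?thesis by simp
qed

lemma H_mod_simps [simp]:
  "x \<in> mcarrier H_mod \<longleftrightarrow> summable (\<lambda>n. star (x n) * x n)"
  "mscale H_mod c x = (\<lambda>n. scaleC c (x n))"
  "mact H_mod x b = (\<lambda>n. x n * b)"
  "minner H_mod x y = (\<Sum>n. star (x n) * y n)"
  by (simp_all add: H_mod_def)

text \<open>The seminorm of a mixed block is at most the geometric mean of those of the two pure
  blocks.\<close>

lemma H_mod_summable:
  assumes "x \<in> mcarrier H_mod" "y \<in> mcarrier H_mod"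
  shows "summable (\<lambda>n. star (x n) * (y n :: 'a::pro_cstar_algebra))"
  unfolding summable_iff_cauchy
proof (intro ballI allI impI)
  fix p :: "'a \<Rightarrow> real" and \<epsilon> :: real assume p: "p \<in> cont_seminorms" and \<epsilon>: "\<epsilon> > 0"
  interpret cstar_seminormed p using p by (rule cstar_seminormed_cont)
  let ?s = "\<lambda>x y n m. p (\<Sum>k\<in>{n..<m}. star (x k) * y k)"
  obtain M where M: "\<And>n m. n \<ge> M \<Longrightarrow> ?s x x n m < \<epsilon>"
    using assms(1) p \<epsilon> unfolding H_mod_simps summable_iff_cauchy by blast
  obtain N where N: "\<And>n m. n \<ge> N \<Longrightarrow> ?s y y n m < \<epsilon>"
    using assms(2) p \<epsilon> unfolding H_mod_simps summable_iff_cauchy by blast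
  have "?s x y n m < \<epsilon>" if n: "n \<ge> max M N" for n m
  proof (rule power2_less_imp_less)
    have "?s x x n m * ?s y y n m < \<epsilon> * \<epsilon>"
      using n by (intro mult_strict_mono' M N) auto
    with star_mult_sum_cauchy_schwarz[OF p, where x = x and y = y and I = "{n..<m}"]
    show "(?s x y n m)\<^sup>2 < \<epsilon>\<^sup>2" by (simp add: power2_eq_square)
  qed (use \<epsilon> in simp)
  then show "\<exists>N. \<forall>n\<ge>N. \<forall>m. ?s x y n m < \<epsilon>" by blast
qed

lemma H_mod_star:
  assumes "x \<in> mcarrier H_mod" "y \<in> mcarrier H_mod"
  shows "star (minner H_mod x y) = minner H_mod y (x :: nat \<Rightarrow> 'a::pro_cstar_algebra)"
proof -
  from sums_star[OF summable_sums[OF H_mod_summable[OF assms]]]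
  have "(\<lambda>n. star (y n) * x n) sums star (minner H_mod x y)" by (simp add: star_mult star_star)
  then show ?thesis by (simp add: sums_iff)
qed

lemma semi_inner_module_H_mod: "semi_inner_module (H_mod :: ('a::pro_cstar_algebra, nat \<Rightarrow> 'a) cmodule)"
proof
  let ?H = "H_mod :: ('a, nat \<Rightarrow> 'a) cmodule"
  fix x y z :: "nat \<Rightarrow> 'a" and a :: 'a and c :: complex and p :: "'a \<Rightarrow> real"
  show "0 \<in> mcarrier ?H" by simp
  assume x: "x \<in> mcarrier ?H"
  note xx = H_mod_summable[OF x x]
  show "- x \<in> mcarrier ?H" using xx by (simp add: star_minus)
  have "(\<lambda>n. star (mscale ?H c x n) * mscale ?H c x n) = (\<lambda>n. scaleC (cnj c * c) (star (x n) * x n))"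
    by (simp add: star_scaleC mult_scaleC_left mult_scaleC_right scaleC_scaleC mult.commute)
  then show "mscale ?H c x \<in> mcarrier ?H"
    using sums_scaleC[OF summable_sums[OF xx], of "cnj c * c"] unfolding H_mod_simps(1)
    by (simp add: sums_iff)
  have "(\<lambda>n. star (mact ?H x a n) * mact ?H x a n) = (\<lambda>n. star a * ((star (x n) * x n) * a))"
    by (simp add: star_mult mult.assoc)
  then show "mact ?H x a \<in> mcarrier ?H"
    using sums_mult_const_pro_cstar(2)[OF sums_mult_const_pro_cstar(1)[OF summable_sums[OF xx]], of "star a" a]
    unfolding H_mod_simps(1) by (simp add: sums_iff)
  show "cpos p (minner ?H x x)" if p: "p \<in> cont_seminorms"
  proof -
    interpret cstar_seminormed p using p by (rule cstar_seminormed_cont)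
    show ?thesis
      using H_mod_star[OF x x] unfolding H_mod_simps by (intro cpos_suminf xx p cpos_star_mult)
  qed
  assume y: "y \<in> mcarrier ?H"
  note xy = H_mod_summable[OF x y] and yx = H_mod_summable[OF y x] and yy = H_mod_summable[OF y y]
  have "summable (\<lambda>n. (star (x n) * x n + star (x n) * y n) + (star (y n) * x n + star (y n) * y n))"
    by (intro summable_add xx xy yx yy)
  then show "x + y \<in> mcarrier ?H" by (simp add: star_add ring_distribs add_ac)
  show "star (minner ?H x y) = minner ?H y x" by (rule H_mod_star[OF x y])
  show "minner ?H x (mscale ?H c y) = scaleC c (minner ?H x y)"
    using sums_scaleC[OF summable_sums[OF xy], of c] by (simp add: mult_scaleC_right sums_iff)
  show "minner ?H x (mact ?H y a) = minner ?H x y * a"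
    using sums_mult_const_pro_cstar(1)[OF summable_sums[OF xy], of a] by (simp add: mult.assoc sums_iff)
  assume z: "z \<in> mcarrier ?H"
  show "minner ?H x (y + z) = minner ?H x y + minner ?H x z"
    using suminf_add[OF xy H_mod_summable[OF x z]] by (simp add: ring_distribs)
qed

lemma H_mod_definite:
  assumes "x \<in> mcarrier H_mod" "minner H_mod x x = (0::'a::pro_cstar_algebra)"
  shows "x = 0"
proof
  fix n
  show "x n = 0 n"
    unfolding zero_fun_def
  proof (rule eq_zero_if_cont_seminorms)
    fix p :: "'a \<Rightarrow> real" assume p: "p \<in> cont_seminorms"
    interpret cstar_seminormed p using p by (rule cstar_seminormed_cont)
    have "p (\<Sum>k\<in>{n}. star (x k) * x k) \<le> p (\<Sum>k. star (x k) * x k)"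
      by (rule sum_le_suminf_seminorm) (use assms(1) p in \<open>auto intro: cpos_star_mult\<close>)
    then have "(p (x n))\<^sup>2 \<le> 0" using assms(2) by (simp add: cstar_identity)
    then show "p (x n) = 0" by simp
  qed
qed

lemma std_mult_in_H_mod: "std_mult n a \<in> mcarrier H_mod"
  by (simp, rule summable_finite[of "{n}"]) (auto simp: std_mult_def)

lemma inner_std_mult: "minner H_mod (std_mult n a) x = star a * x n"
proof -
  have "(\<Sum>k. star (std_mult n a k) * x k) = (\<Sum>k\<in>{n}. star (std_mult n a k) * x k)"
    by (rule suminf_finite) (auto simp: std_mult_def)
  then show ?thesis by (simp add: std_mult_def)
qed

section \<open>Coercive morphisms\<close>

text \<open>A common framework for \<open>E\<close> and \<open>H_mod\<close>. In
  \<open>H_mod\<close> the axiom \<open>inner_nonneg\<close> would ask for one \<open>b\<close> with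
  \<open>star b * b\<close> equal to an infinite sum; positivity for each seminorm is obtained from
  the partial sums.\<close>

locale definite_inner_module = semi_inner_module E
  for E :: "('a::pro_cstar_algebra, 'e::ab_group_add) cmodule" +
  assumes definite: "\<xi> \<in> mcarrier E \<Longrightarrow> minner E \<xi> \<xi> = 0 \<Longrightarrow> \<xi> = 0"
begin

lemma inner_eqI:
  assumes "\<eta> \<in> mcarrier E" "\<zeta> \<in> mcarrier E"
    and "\<And>\<xi>. \<xi> \<in> mcarrier E \<Longrightarrow> minner E \<xi> \<eta> = minner E \<xi> \<zeta>"
  shows "\<eta> = \<zeta>"
proof -
  have "minner E (\<eta> - \<zeta>) (\<eta> - \<zeta>) = 0"
    using assms by (simp add: inner_diff_right semi_diff_closed)
  then show ?thesis using definite[of "\<eta> - \<zeta>"] assms by (simp add: semi_diff_closed)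
qed

lemma eq_if_mseminorms:
  assumes "\<eta> \<in> mcarrier E" "\<zeta> \<in> mcarrier E"
    and "\<And>p. p \<in> cont_seminorms \<Longrightarrow> mseminorm E p (\<eta> - \<zeta>) = 0"
  shows "\<eta> = \<zeta>"
proof -
  have "minner E (\<eta> - \<zeta>) (\<eta> - \<zeta>) = 0"
    by (rule eq_zero_if_cont_seminorms) (use assms(3) in \<open>simp add: mseminorm_def\<close>)
  then show ?thesis using definite[of "\<eta> - \<zeta>"] assms by (simp add: semi_diff_closed)
qed

end

lemma definite_inner_module_pre_hilbert:
  "pre_hilbert_module E \<Longrightarrow> definite_inner_module E"
  by (intro definite_inner_module.intro semi_inner_moduleI_pre_hilbert definite_inner_module_axioms.intro)
    (simp_all add: pre_hilbert_module.inner_eq_0)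

lemma definite_inner_module_H_mod: "definite_inner_module H_mod"
  by (intro definite_inner_module.intro semi_inner_module_H_mod definite_inner_module_axioms.intro
      H_mod_definite)

text \<open>Linearity of \<open>S\<close> comes from the adjoint relation, since elements of a
  definite module are determined by their inner products.\<close>

lemma is_adjointI:
  assumes "definite_inner_module E" "definite_inner_module F"
    and S: "\<And>\<eta>. \<eta> \<in> mcarrier F \<Longrightarrow> S \<eta> \<in> mcarrier E"
    and T: "\<And>\<xi>. \<xi> \<in> mcarrier E \<Longrightarrow> T \<xi> \<in> mcarrier F"
    and eq: "\<And>\<xi> \<eta>. \<xi> \<in> mcarrier E \<Longrightarrow> \<eta> \<in> mcarrier F \<Longrightarrow> minner F (T \<xi>) \<eta> = minner E \<xi> (S \<eta>)"
  shows "is_adjoint E F T S"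
proof -
  interpret E: definite_inner_module E by fact
  interpret F: definite_inner_module F by fact
  note closed = S T E.semi_add_closed F.semi_add_closed E.semi_scale_closed F.semi_scale_closed
    E.semi_act_closed F.semi_act_closed
  have add: "S (\<eta> + \<zeta>) = S \<eta> + S \<zeta>" if "\<eta> \<in> mcarrier F" "\<zeta> \<in> mcarrier F" for \<eta> \<zeta>
    by (rule E.inner_eqI) (simp_all add: closed that E.semi_inner_add F.semi_inner_add flip: eq)
  have scale: "S (mscale F c \<eta>) = mscale E c (S \<eta>)" if "\<eta> \<in> mcarrier F" for c \<eta>
    by (rule E.inner_eqI) (simp_all add: closed that E.semi_inner_scale F.semi_inner_scale flip: eq)
  have act: "S (mact F \<eta> a) = mact E (S \<eta>) a" if "\<eta> \<in> mcarrier F" for a \<eta>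
    by (rule E.inner_eqI) (simp_all add: closed that E.semi_inner_act F.semi_inner_act flip: eq)
  show ?thesis
    unfolding is_adjoint_def module_morphism_def using S eq add scale act by blast
qed

text \<open>The abstract content of the frame inequalities: \<open>S \<circ> T\<close> lies between
  \<open>C\<close> and \<open>D\<close> as a form, for each seminorm. The ordering
  \<open>C \<le> D\<close> makes \<open>1 - C / D\<close> nonnegative.\<close>

locale coercive_morphism = E: definite_inner_module E + F: definite_inner_module F
  for E :: "('a::pro_cstar_algebra, 'e::ab_group_add) cmodule"
    and F :: "('a, 'f::ab_group_add) cmodule" +
  fixes T :: "'e \<Rightarrow> 'f" and S :: "'f \<Rightarrow> 'e" and C D :: real
  assumes complete_E: "seminorm_complete (mcarrier E) (mseminorm E ` cont_seminorms)"
    and T_closed: "\<xi> \<in> mcarrier E \<Longrightarrow> T \<xi> \<in> mcarrier F"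
    and is_adjoint: "is_adjoint E F T S"
    and C_pos: "0 < C" and C_le_D: "C \<le> D"
    and lower: "\<lbrakk>\<xi> \<in> mcarrier E; p \<in> cont_seminorms\<rbrakk> \<Longrightarrow>
      cpos p (minner F (T \<xi>) (T \<xi>) - scaleC (complex_of_real C) (minner E \<xi> \<xi>))"
    and upper: "\<lbrakk>\<xi> \<in> mcarrier E; p \<in> cont_seminorms\<rbrakk> \<Longrightarrow>
      cpos p (scaleC (complex_of_real D) (minner E \<xi> \<xi>) - minner F (T \<xi>) (T \<xi>))"
begin

lemma D_pos: "0 < D"
  using C_pos C_le_D by simp

lemma S_closed: "\<eta> \<in> mcarrier F \<Longrightarrow> S \<eta> \<in> mcarrier E"
  using is_adjoint by (auto simp: is_adjoint_def module_morphism_def)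

lemma inner_T_left: "\<xi> \<in> mcarrier E \<Longrightarrow> \<eta> \<in> mcarrier F \<Longrightarrow> minner F (T \<xi>) \<eta> = minner E \<xi> (S \<eta>)"
  using is_adjoint by (auto simp: is_adjoint_def)

lemma inner_T_right:
  assumes "\<xi> \<in> mcarrier E" "\<eta> \<in> mcarrier F"
  shows "minner F \<eta> (T \<xi>) = minner E (S \<eta>) \<xi>"
proof -
  have "star (minner F (T \<xi>) \<eta>) = star (minner E \<xi> (S \<eta>))" by (simp only: inner_T_left assms)
  then show ?thesis by (simp only: E.semi_inner_star F.semi_inner_star assms T_closed S_closed)
qed

text \<open>\<open>T\<close> is in turn an adjoint of \<open>S\<close>, so
  \<open>is_adjointI\<close> applies with the roles exchanged.\<close>

lemma T_morphism: "module_morphism E F T"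
proof -
  have "is_adjoint F E S T"
    by (intro is_adjointI E.definite_inner_module_axioms F.definite_inner_module_axioms)
      (simp_all add: S_closed T_closed inner_T_right)
  then show ?thesis by (simp add: is_adjoint_def)
qed

lemma T_simps:
  assumes "\<xi> \<in> mcarrier E" "\<eta> \<in> mcarrier E"
  shows "T (\<xi> + \<eta>) = T \<xi> + T \<eta>" "T (mscale E c \<xi>) = mscale F c (T \<xi>)" "T (mact E \<xi> a) = mact F (T \<xi>) a"
  using T_morphism assms by (auto simp: module_morphism_def)

lemma T_diff:
  assumes "\<xi> \<in> mcarrier E" "\<eta> \<in> mcarrier E"
  shows "T (\<xi> - \<eta>) = T \<xi> - T \<eta>"
  using T_simps(1)[of "\<xi> - \<eta>" \<eta>] assms by (simp add: E.semi_diff_closed algebra_simps)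

lemma T_zero: "T 0 = 0"
  using T_diff[of 0 0] E.semi_zero_closed by simp

lemma T_in_L: "T \<in> L E F"
  using T_morphism is_adjoint by (auto simp: L_def)

lemma T_norm_squared:
  assumes "\<xi> \<in> mcarrier E" "p \<in> cont_seminorms"
  shows "C * p (minner E \<xi> \<xi>) \<le> p (minner F (T \<xi>) (T \<xi>))"
    and "p (minner F (T \<xi>) (T \<xi>)) \<le> D * p (minner E \<xi> \<xi>)"
proof -
  interpret cstar_seminormed p using assms(2) by (rule cstar_seminormed_cont)
  have "cpos p (scaleC (complex_of_real C) (minner E \<xi> \<xi>))"
    using assms C_pos by (intro cpos_scale E.semi_inner_cpos) auto
  from cpos_mono_diff[OF this lower[OF assms]] C_pos
  show "C * p (minner E \<xi> \<xi>) \<le> p (minner F (T \<xi>) (T \<xi>))" by (simp add: homogeneous)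
  from cpos_mono_diff[OF F.semi_inner_cpos upper[OF assms]] assms D_pos
  show "p (minner F (T \<xi>) (T \<xi>)) \<le> D * p (minner E \<xi> \<xi>)" by (simp add: homogeneous T_closed)
qed

lemma T_norm:
  assumes "\<xi> \<in> mcarrier E" "p \<in> cont_seminorms"
  shows "sqrt C * mseminorm E p \<xi> \<le> mseminorm F p (T \<xi>)"
    and "mseminorm F p (T \<xi>) \<le> sqrt D * mseminorm E p \<xi>"
  using T_norm_squared[OF assms] by (simp_all add: mseminorm_def flip: real_sqrt_mult)

text \<open>The Cauchy--Schwarz inequality for \<open>T (S \<eta>)\<close> and
  \<open>\<eta>\<close>, with one factor cancelled, passes the bound of \<open>T\<close> on to its
  adjoint.\<close>

lemma S_norm:
  assumes "\<eta> \<in> mcarrier F" "p \<in> cont_seminorms"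
  shows "mseminorm E p (S \<eta>) \<le> sqrt D * mseminorm F p \<eta>"
proof (cases "mseminorm E p (S \<eta>) = 0")
  case True
  then show ?thesis using D_pos F.mseminorm_nonneg[OF assms(2)] by simp
next
  case False
  have "(mseminorm E p (S \<eta>))\<^sup>2 = p (minner F (T (S \<eta>)) \<eta>)"
    using assms by (simp add: E.mseminorm_squared inner_T_left S_closed)
  also have "\<dots> \<le> mseminorm F p (T (S \<eta>)) * mseminorm F p \<eta>"
    using assms by (intro F.cauchy_schwarz T_closed S_closed)
  also have "\<dots> \<le> (sqrt D * mseminorm E p (S \<eta>)) * mseminorm F p \<eta>"
    using assms by (intro mult_right_mono T_norm S_closed F.mseminorm_nonneg)
  finally have "mseminorm E p (S \<eta>) * mseminorm E p (S \<eta>)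
      \<le> (sqrt D * mseminorm F p \<eta>) * mseminorm E p (S \<eta>)"
    by (simp add: power2_eq_square mult_ac)
  then show ?thesis
    using False E.mseminorm_nonneg[OF assms(2), of "S \<eta>"] by (simp add: mult_le_cancel_right less_le)
qed

abbreviation G where "G \<xi> \<equiv> S (T \<xi>)"

lemma G_closed: "\<xi> \<in> mcarrier E \<Longrightarrow> G \<xi> \<in> mcarrier E"
  by (simp add: S_closed T_closed)

lemma inner_G: "\<xi> \<in> mcarrier E \<Longrightarrow> \<eta> \<in> mcarrier E \<Longrightarrow> minner E \<xi> (G \<eta>) = minner F (T \<xi>) (T \<eta>)"
  by (simp add: inner_T_left T_closed)

text \<open>The lower bound is coercivity: \<open>C\<close> times the squared seminorm of
  \<open>\<xi>\<close> is at most \<open>p (minner E \<xi> (G \<xi>))\<close>, and the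
  Cauchy--Schwarz inequality removes one factor.\<close>

lemma G_norm:
  assumes "\<xi> \<in> mcarrier E" "p \<in> cont_seminorms"
  shows "C * mseminorm E p \<xi> \<le> mseminorm E p (G \<xi>)"
    and "mseminorm E p (G \<xi>) \<le> D * mseminorm E p \<xi>"
proof -
  have "mseminorm E p (G \<xi>) \<le> sqrt D * mseminorm F p (T \<xi>)"
    using assms by (intro S_norm T_closed)
  also have "\<dots> \<le> sqrt D * (sqrt D * mseminorm E p \<xi>)"
    using D_pos by (intro mult_left_mono T_norm assms) simp
  finally show "mseminorm E p (G \<xi>) \<le> D * mseminorm E p \<xi>"
    using D_pos by (simp flip: mult.assoc)
  show "C * mseminorm E p \<xi> \<le> mseminorm E p (G \<xi>)"
  proof (cases "mseminorm E p \<xi> = 0")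
    case True
    then show ?thesis using E.mseminorm_nonneg[OF assms(2)] by simp
  next
    case False
    have "C * (mseminorm E p \<xi>)\<^sup>2 \<le> p (minner E \<xi> (G \<xi>))"
      using T_norm_squared(1)[OF assms] assms by (simp add: E.mseminorm_squared inner_G)
    also have "\<dots> \<le> mseminorm E p \<xi> * mseminorm E p (G \<xi>)"
      using assms by (intro E.cauchy_schwarz G_closed)
    finally have "(C * mseminorm E p \<xi>) * mseminorm E p \<xi> \<le> mseminorm E p (G \<xi>) * mseminorm E p \<xi>"
      by (simp add: power2_eq_square mult_ac)
    then show ?thesis
      using False E.mseminorm_nonneg[OF assms(2), of \<xi>] by (simp add: mult_le_cancel_right less_le)
  qed
qed

lemma T_injective: "inj_on T (mcarrier E)"
proof (rule inj_onI)
  fix \<xi> \<eta> assume *: "\<xi> \<in> mcarrier E" "\<eta> \<in> mcarrier E" "T \<xi> = T \<eta>"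
  show "\<xi> = \<eta>"
  proof (rule E.eq_if_mseminorms)
    fix p :: "'a \<Rightarrow> real" assume p: "p \<in> cont_seminorms"
    have "C * mseminorm E p (\<xi> - \<eta>) \<le> mseminorm E p (G (\<xi> - \<eta>))"
      using * p by (intro G_norm E.semi_diff_closed)
    also have "T (\<xi> - \<eta>) = T 0" using * by (simp add: T_diff T_zero)
    also have "mseminorm E p (S (T 0)) \<le> 0"
      using G_norm(2)[OF E.semi_zero_closed p] p by (simp add: E.mseminorm_zero)
    finally show "mseminorm E p (\<xi> - \<eta>) = 0"
      using C_pos E.mseminorm_nonneg[OF p, of "\<xi> - \<eta>"] by (simp add: mult_le_0_iff)
  qed (use * in auto)
qed

section \<open>Solving \<open>G \<xi> = \<eta>\<close> by a Neumann iteration\<close>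

definition R where "R \<xi> = \<xi> - mscale E (complex_of_real (1 / D)) (G \<xi>)"

lemma R_closed: "\<xi> \<in> mcarrier E \<Longrightarrow> R \<xi> \<in> mcarrier E"
  by (simp add: R_def E.semi_diff_closed E.semi_scale_closed G_closed)

lemma inner_R: "\<xi> \<in> mcarrier E \<Longrightarrow> \<eta> \<in> mcarrier E \<Longrightarrow>
    minner E \<xi> (R \<eta>) = minner E \<xi> \<eta> - scaleC (complex_of_real (1 / D)) (minner F (T \<xi>) (T \<eta>))"
  by (simp add: R_def E.inner_diff_right E.semi_scale_closed G_closed E.semi_inner_scale inner_G)

lemma R_diff: "\<xi> \<in> mcarrier E \<Longrightarrow> \<eta> \<in> mcarrier E \<Longrightarrow> R (\<xi> - \<eta>) = R \<xi> - R \<eta>"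
  by (rule E.inner_eqI)
    (simp_all add: R_closed E.semi_diff_closed inner_R E.inner_diff_right T_diff T_closed
      F.inner_diff_right scaleC_diff_right)

lemma scaleC_D_cancel: "scaleC (complex_of_real (1 / D)) (scaleC (complex_of_real D) x) = (x::'a)"
  using D_pos by (simp add: scaleC_scaleC scaleC_one)

text \<open>Since \<open>0 \<le> R \<le> 1 - C / D\<close> as a form, the Cauchy--Schwarz inequality for this form
  bounds the operator \<open>R\<close>.\<close>

lemma R_norm:
  assumes "\<eta> \<in> mcarrier E" "p \<in> cont_seminorms"
  shows "mseminorm E p (R \<eta>) \<le> (1 - C / D) * mseminorm E p \<eta>"
proof -
  interpret cstar_seminormed p using assms(2) by (rule cstar_seminormed_cont)
  define r where "r = 1 - C / D"
  have r: "0 \<le> r" using C_le_D D_pos by (simp add: r_def)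
  let ?B = "E\<lparr>minner := \<lambda>\<xi> \<eta>. minner E \<xi> (R \<eta>)\<rparr>"
  interpret B: semi_inner_module ?B
  proof
    fix \<xi> \<zeta> :: 'e and q :: "'a \<Rightarrow> real"
    assume "\<xi> \<in> mcarrier ?B"
    then have \<xi>: "\<xi> \<in> mcarrier E" by simp
    show "cpos q (minner ?B \<xi> \<xi>)" if q: "q \<in> cont_seminorms"
    proof -
      interpret q: cstar_seminormed q using q by (rule cstar_seminormed_cont)
      have "cpos q (scaleC (complex_of_real (1 / D))
          (scaleC (complex_of_real D) (minner E \<xi> \<xi>) - minner F (T \<xi>) (T \<xi>)))"
        using D_pos by (intro q.cpos_scale upper \<xi> q) simp
      then show ?thesis using \<xi> unfolding scaleC_diff_right scaleC_D_cancel by (simp add: inner_R)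
    qed
    assume "\<zeta> \<in> mcarrier ?B"
    with \<xi> show "star (minner ?B \<xi> \<zeta>) = minner ?B \<zeta> \<xi>"
      by (simp add: inner_R star_diff star_scaleC E.semi_inner_star F.semi_inner_star T_closed)
  qed (simp_all add: E.semi_zero_closed E.semi_add_closed E.semi_uminus_closed E.semi_scale_closed
      E.semi_act_closed inner_R E.semi_inner_add E.semi_inner_scale E.semi_inner_act T_simps T_closed
      F.semi_inner_add F.semi_inner_scale F.semi_inner_act scaleC_add_right scaleC_diff_right
      scaleC_scaleC mult_scaleC_left left_diff_distrib mult.commute)
  have form_le: "p (minner E \<xi> (R \<xi>)) \<le> r * p (minner E \<xi> \<xi>)" if \<xi>: "\<xi> \<in> mcarrier E" for \<xi>
  proof -
    have "cpos p (scaleC (complex_of_real (1 / D))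
        (minner F (T \<xi>) (T \<xi>) - scaleC (complex_of_real C) (minner E \<xi> \<xi>)))"
      using D_pos by (intro cpos_scale lower \<xi> assms(2)) simp
    also have "scaleC (complex_of_real (1 / D))
        (minner F (T \<xi>) (T \<xi>) - scaleC (complex_of_real C) (minner E \<xi> \<xi>)) =
        scaleC (complex_of_real r) (minner E \<xi> \<xi>) - minner E \<xi> (R \<xi>)"
    proof -
      have "complex_of_real r = 1 + - complex_of_real (C / D)" by (simp add: r_def)
      then show ?thesis
        using \<xi> by (simp add: inner_R scaleC_diff_right scaleC_scaleC scaleC_add_left
            scaleC_minus_left scaleC_one del: add_uminus_conv_diff)
    qed
    finally have "cpos p (scaleC (complex_of_real r) (minner E \<xi> \<xi>) - minner E \<xi> (R \<xi>))" .
    from cpos_mono_diff[OF _ this] B.semi_inner_cpos[of \<xi> p] assms(2) \<xi> r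
    show ?thesis by (simp add: homogeneous)
  qed
  have R\<eta>: "R \<eta> \<in> mcarrier E" using assms by (simp add: R_closed)
  let ?a = "p (minner E (R \<eta>) (R \<eta>))" and ?b = "p (minner E \<eta> \<eta>)"
  \<comment> \<open>\<open>minner E (R \<eta>) (R \<eta>)\<close> is the value of the form
    \<open>?B\<close> at the pair \<open>R \<eta>\<close>, \<open>\<eta>\<close>. The two diagonal
    values are bounded by \<open>form_le\<close>, after which a factor \<open>?a\<close>
    cancels.\<close>
  have "?a\<^sup>2 \<le> p (minner E (R \<eta>) (R (R \<eta>))) * p (minner E \<eta> (R \<eta>))"
    using B.cauchy_schwarz_squared[of "R \<eta>" \<eta> p] assms R\<eta> by simp
  also have "\<dots> \<le> (r * ?a) * (r * ?b)"
    using r by (intro mult_mono form_le R\<eta> assms(1)) simp_all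
  finally have *: "?a * ?a \<le> (r * r * ?b) * ?a" by (simp add: power2_eq_square mult_ac)
  have "?a \<le> r * r * ?b"
  proof (cases "?a = 0")
    case True
    then show ?thesis using r by simp
  next
    case False
    then show ?thesis
      using * nonneg[of "minner E (R \<eta>) (R \<eta>)"] by (simp add: mult_le_cancel_right less_le)
  qed
  then have "sqrt ?a \<le> sqrt (r * r * ?b)" by (rule real_sqrt_le_mono)
  then show ?thesis using r by (simp add: mseminorm_def real_sqrt_mult flip: r_def)
qed

text \<open>\<open>G \<xi> = \<eta>\<close> is the fixed point equation
  \<open>\<xi> = R \<xi> + b\<close>. Since \<open>r\<close> does not depend on the seminorm, a
  single iteration is Cauchy for all seminorms at once.\<close>

lemma G_surjective:
  assumes "\<eta> \<in> mcarrier E"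
  shows "\<exists>\<xi>\<in>mcarrier E. G \<xi> = \<eta>"
proof -
  define b where "b = mscale E (complex_of_real (1 / D)) \<eta>"
  define r where "r = 1 - C / D"
  have r: "0 \<le> r" "r < 1" using C_le_D D_pos C_pos by (auto simp: r_def)
  have b: "b \<in> mcarrier E" using assms by (simp add: b_def E.semi_scale_closed)
  \<comment> \<open>Started at 0, the iterates are the partial sums of the Neumann series, and the
    first increment is \<open>x 1\<close>.\<close>
  define x where "x = rec_nat 0 (\<lambda>n \<xi>. R \<xi> + b)"
  have x_0: "x 0 = 0" and x_Suc: "x (Suc n) = R (x n) + b" for n by (simp_all add: x_def)
  have x: "x n \<in> mcarrier E" for n
    by (induction n) (simp_all add: x_0 x_Suc E.semi_zero_closed R_closed E.semi_add_closed b)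
  have step: "mseminorm E p (x (Suc n) - x n) \<le> r ^ n * mseminorm E p (x 1)"
    if p: "p \<in> cont_seminorms" for p n
  proof (induction n)
    case (Suc n)
    have "x (Suc (Suc n)) - x (Suc n) = R (x (Suc n) - x n)"
      by (simp add: x_Suc[of "Suc n"] x_Suc[of n] R_diff x R_closed E.semi_add_closed b)
    then have "mseminorm E p (x (Suc (Suc n)) - x (Suc n)) \<le> r * mseminorm E p (x (Suc n) - x n)"
      using p x by (simp only: r_def R_norm E.semi_diff_closed)
    also have "\<dots> \<le> r * (r ^ n * mseminorm E p (x 1))"
      using r Suc.IH by (intro mult_left_mono)
    finally show ?case by (simp add: mult.assoc)
  qed (simp add: x_0)
  have geometric: "(1 - r) * (\<Sum>k=n..<m. r ^ k) = r ^ n - r ^ m" if "n \<le> m" for n m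
    using sum_Suc_diff'[OF that, of "\<lambda>k. - (r ^ k)"] by (simp add: sum_distrib_left left_diff_distrib)
  have tail: "(1 - r) * mseminorm E p (x m - x n) \<le> r ^ n * mseminorm E p (x 1)"
    if p: "p \<in> cont_seminorms" and "n \<le> m" for p n m
  proof -
    have "x m - x n = (\<Sum>k=n..<m. x (Suc k) - x k)" using that by (simp add: sum_Suc_diff')
    then have "mseminorm E p (x m - x n) \<le> (\<Sum>k=n..<m. mseminorm E p (x (Suc k) - x k))"
      using p x by (simp only: E.mseminorm_sum E.semi_diff_closed)
    also have "\<dots> \<le> (\<Sum>k=n..<m. r ^ k * mseminorm E p (x 1))" by (intro sum_mono step p)
    finally have "(1 - r) * mseminorm E p (x m - x n)
        \<le> (1 - r) * ((\<Sum>k=n..<m. r ^ k) * mseminorm E p (x 1))"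
      using r by (simp add: sum_distrib_right mult_left_mono)
    also have "\<dots> = (r ^ n - r ^ m) * mseminorm E p (x 1)"
      unfolding mult.assoc[symmetric] geometric[OF that(2)] ..
    also have "\<dots> \<le> r ^ n * mseminorm E p (x 1)"
      using r p by (intro mult_right_mono E.mseminorm_nonneg) auto
    finally show ?thesis .
  qed
  obtain \<xi> where \<xi>: "\<xi> \<in> mcarrier E"
    and lim: "\<And>p. p \<in> mseminorm E ` cont_seminorms \<Longrightarrow> (\<lambda>n. p (x n - \<xi>)) \<longlonglongrightarrow> 0"
  proof (rule seminorm_complete_sequence[OF complete_E, of x])
    show "x n \<in> mcarrier E" for n by (rule x)
    fix q and \<epsilon> :: real assume "q \<in> mseminorm E ` cont_seminorms" and \<epsilon>: "\<epsilon> > 0"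
    then obtain p where p: "p \<in> cont_seminorms" "q = mseminorm E p" by blast
    have "(\<lambda>n. r ^ n * mseminorm E p (x 1)) \<longlonglongrightarrow> 0"
      using r by (intro tendsto_mult_left_zero LIMSEQ_power_zero) simp
    then have "\<forall>\<^sub>F n in sequentially. r ^ n * mseminorm E p (x 1) < (1 - r) * \<epsilon>"
      using r \<epsilon> by (intro order_tendstoD(2)) auto
    then obtain N where N: "\<And>n. n \<ge> N \<Longrightarrow> r ^ n * mseminorm E p (x 1) < (1 - r) * \<epsilon>"
      by (auto simp: eventually_sequentially)
    have *: "q (x m - x n) < \<epsilon>" if "n \<ge> N" "n \<le> m" for n m
      using le_less_trans[OF tail[OF p(1) that(2)] N[OF that(1)]] r p(2) by simp
    have "q (x m - x n) < \<epsilon>" if "n \<ge> N" "m \<ge> N" for n m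
      using *[of n m] *[of m n] that E.mseminorm_minus_commute[OF x x, of p m n] p(2) by (cases "n \<le> m") auto
    then show "\<exists>N. \<forall>m\<ge>N. \<forall>n\<ge>N. q (x m - x n) < \<epsilon>" by blast
  qed blast
  have fixed_point: "\<xi> = R \<xi> + b"
  proof (rule E.eq_if_mseminorms)
    fix p :: "'a \<Rightarrow> real" assume p: "p \<in> cont_seminorms"
    have l: "(\<lambda>n. mseminorm E p (x n - \<xi>)) \<longlonglongrightarrow> 0" using lim p by blast
    \<comment> \<open>The left side does not depend on \<open>n\<close>, while the right side tends
      to 0.\<close>
    have "mseminorm E p (\<xi> - (R \<xi> + b)) \<le> mseminorm E p (x (Suc n) - \<xi>) + r * mseminorm E p (x n - \<xi>)" for n
    proof -
      have "\<xi> - (R \<xi> + b) = R (x n - \<xi>) - (x (Suc n) - \<xi>)" using x \<xi> by (simp add: R_diff x_Suc)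
      then have "mseminorm E p (\<xi> - (R \<xi> + b)) \<le> mseminorm E p (R (x n - \<xi>)) + mseminorm E p (x (Suc n) - \<xi>)"
        using p x \<xi> by (simp only: E.mseminorm_triangle_diff R_closed E.semi_diff_closed)
      also have "mseminorm E p (R (x n - \<xi>)) \<le> r * mseminorm E p (x n - \<xi>)"
        using p x \<xi> by (simp only: r_def R_norm E.semi_diff_closed)
      finally show ?thesis by simp
    qed
    moreover have "(\<lambda>n. mseminorm E p (x (Suc n) - \<xi>) + r * mseminorm E p (x n - \<xi>)) \<longlonglongrightarrow> 0"
      using LIMSEQ_Suc[OF l] l by (intro tendsto_add_zero tendsto_mult_right_zero)
    ultimately have "mseminorm E p (\<xi> - (R \<xi> + b)) \<le> 0" by (intro LIMSEQ_le_const) auto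
    then show "mseminorm E p (\<xi> - (R \<xi> + b)) = 0" using E.mseminorm_nonneg[OF p] by (rule antisym)
  qed (use \<xi> b in \<open>simp_all add: R_closed E.semi_add_closed\<close>)
  have "G \<xi> = \<eta>"
  proof (rule E.inner_eqI)
    fix \<zeta> assume \<zeta>: "\<zeta> \<in> mcarrier E"
    have "minner E \<zeta> \<xi> = minner E \<zeta> (R \<xi>) + minner E \<zeta> b"
      using \<zeta> \<xi> b by (subst fixed_point) (simp add: E.semi_inner_add R_closed)
    then have "scaleC (complex_of_real (1 / D)) (minner E \<zeta> (G \<xi>)) =
        scaleC (complex_of_real (1 / D)) (minner E \<zeta> \<eta>)"
      using \<zeta> \<xi> assms by (simp add: inner_R inner_G b_def E.semi_inner_scale)
    then have "scaleC (complex_of_real D) (scaleC (complex_of_real (1 / D)) (minner E \<zeta> (G \<xi>))) =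
        scaleC (complex_of_real D) (scaleC (complex_of_real (1 / D)) (minner E \<zeta> \<eta>))" by simp
    then show "minner E \<zeta> (G \<xi>) = minner E \<zeta> \<eta>"
      using D_pos by (simp add: scaleC_scaleC scaleC_one)
  qed (use \<xi> assms in \<open>simp_all add: G_closed\<close>)
  with \<xi> show ?thesis by blast
qed

section \<open>The bounded inverse and the range of \<open>T\<close>\<close>

definition K where "K \<eta> = (SOME \<xi>. \<xi> \<in> mcarrier E \<and> G \<xi> = \<eta>)"

lemma K_closed: "\<eta> \<in> mcarrier E \<Longrightarrow> K \<eta> \<in> mcarrier E"
  and G_K: "\<eta> \<in> mcarrier E \<Longrightarrow> G (K \<eta>) = \<eta>"
  using someI_ex[of "\<lambda>\<xi>. \<xi> \<in> mcarrier E \<and> G \<xi> = \<eta>"] G_surjective[of \<eta>] unfolding K_def by blast+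

text \<open>A selfadjoint map that is onto is injective: every test vector \<open>\<zeta>\<close>
  equals \<open>G (K \<zeta>)\<close>, and \<open>G\<close> can be moved to the other
  argument.\<close>

lemma K_G:
  assumes "\<xi> \<in> mcarrier E"
  shows "K (G \<xi>) = \<xi>"
proof (rule E.inner_eqI)
  fix \<zeta> assume \<zeta>: "\<zeta> \<in> mcarrier E"
  have "minner E \<zeta> (K (G \<xi>)) = minner E (G (K \<zeta>)) (K (G \<xi>))" using \<zeta> by (simp add: G_K)
  also have "\<dots> = minner E (K \<zeta>) (G (K (G \<xi>)))"
    using assms \<zeta> by (simp add: inner_T_right[symmetric] inner_G K_closed G_closed T_closed)
  also have "\<dots> = minner E (K \<zeta>) (G \<xi>)" using assms by (simp add: G_K G_closed)
  also have "\<dots> = minner E (G (K \<zeta>)) \<xi>"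
    using assms \<zeta> by (simp add: inner_T_right[symmetric] inner_G K_closed T_closed)
  finally show "minner E \<zeta> (K (G \<xi>)) = minner E \<zeta> \<xi>" using \<zeta> by (simp add: G_K)
qed (use assms in \<open>simp_all add: K_closed G_closed\<close>)

text \<open>Tailored to \<open>S \<circ> T\<close> and its inverse, which are selfadjoint and so
  serve as their own adjoints. The bound \<open>B\<close> must be the same for all seminorms, as
  \<open>bL\<close> demands.\<close>

lemma bL_I:
  assumes "\<And>\<xi>. \<xi> \<in> mcarrier E \<Longrightarrow> W \<xi> \<in> mcarrier E"
    and "\<And>\<xi> \<eta>. \<xi> \<in> mcarrier E \<Longrightarrow> \<eta> \<in> mcarrier E \<Longrightarrow> minner E (W \<xi>) \<eta> = minner E \<xi> (W \<eta>)"
    and "0 \<le> B"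
    and "\<And>\<xi> p. \<xi> \<in> mcarrier E \<Longrightarrow> p \<in> cont_seminorms \<Longrightarrow> mseminorm E p (W \<xi>) \<le> B * mseminorm E p \<xi>"
  shows "W \<in> bL E"
proof -
  have adj: "is_adjoint E E W W"
    by (intro is_adjointI E.definite_inner_module_axioms assms(1,2))
  then have "W \<in> L E E" unfolding L_def by (auto simp: is_adjoint_def)
  moreover have "mseminorm E p (W \<xi>) \<le> B"
    if "p \<in> cont_seminorms" "\<xi> \<in> mcarrier E" "mseminorm E p \<xi> \<le> 1" for p \<xi>
    using assms(4)[OF that(2,1)] mult_left_mono[OF that(3) assms(3)] by simp
  ultimately show ?thesis unfolding bL_def bdd_above_def by blast
qed

theorem adjoint_comp_invertible: "invertible_in_bL E (S \<circ> T)"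
proof -
  have "S \<circ> T \<in> bL E"
    by (rule bL_I[of _ D])
      (simp_all add: G_closed inner_T_right[symmetric] inner_G T_closed G_norm less_imp_le[OF D_pos])
  moreover have "K \<in> bL E"
  proof (rule bL_I[of _ "1 / C"])
    fix \<xi> \<eta> assume *: "\<xi> \<in> mcarrier E" "\<eta> \<in> mcarrier E"
    have "minner E (K \<xi>) (G (K \<eta>)) = minner E (G (K \<xi>)) (K \<eta>)"
      using * by (simp add: inner_T_right[symmetric] inner_G K_closed T_closed)
    then show "minner E (K \<xi>) \<eta> = minner E \<xi> (K \<eta>)" using * by (simp add: G_K)
  next
    fix \<xi> and p :: "'a \<Rightarrow> real" assume *: "\<xi> \<in> mcarrier E" "p \<in> cont_seminorms"
    then show "mseminorm E p (K \<xi>) \<le> 1 / C * mseminorm E p \<xi>"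
      using G_norm(1)[of "K \<xi>" p] C_pos by (simp add: K_closed G_K field_simps)
  qed (use C_pos in \<open>simp_all add: K_closed\<close>)
  ultimately show ?thesis
    unfolding invertible_in_bL_def by (auto simp: K_G G_K intro!: bexI[of _ K])
qed

text \<open>\<open>S\<close> annihilates the difference because \<open>G (K (S x)) = S x\<close>,
  and whatever \<open>S\<close> annihilates is orthogonal to the range of \<open>T\<close>.\<close>

lemma orthogonal_decomposition:
  assumes "x \<in> mcarrier F"
  shows "x - T (K (S x)) \<in> orth_compl F (T ` mcarrier E)"
proof -
  have KS: "K (S x) \<in> mcarrier E" using assms by (simp add: K_closed S_closed)
  have "minner F (T \<zeta>) (x - T (K (S x))) = 0" if \<zeta>: "\<zeta> \<in> mcarrier E" for \<zeta>
    using assms \<zeta> KS by (simp add: F.inner_diff_right T_closed inner_T_left G_K S_closed)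
  then show ?thesis using assms KS by (auto simp: orth_compl_def F.semi_diff_closed T_closed)
qed

text \<open>\<open>T\<close> and its inverse are Lipschitz with respect to the same
  \<open>p\<close>, with constants \<open>sqrt D\<close> and \<open>1 / sqrt C\<close>.\<close>

theorem T_embedding: "embedding_map (mtop E) (mtop F) T"
proof -
  let ?P = "mseminorm E ` cont_seminorms" and ?Q = "mseminorm F ` cont_seminorms"
  have P0: "p 0 = 0" if "p \<in> ?P" for p using that by (auto simp: E.mseminorm_zero)
  have Q0: "q 0 = 0" if "q \<in> ?Q" for q using that by (auto simp: F.mseminorm_zero)
  have Ptri: "p (a - c) \<le> p (a - b) + p (b - c)"
    if "p \<in> ?P" "a \<in> mcarrier E" "b \<in> mcarrier E" "c \<in> mcarrier E" for p a b c
    using that E.mseminorm_triangle[of "a - b" "b - c"] by (auto simp: E.semi_diff_closed)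
  have Qtri: "q (a - c) \<le> q (a - b) + q (b - c)"
    if "q \<in> ?Q" "a \<in> mcarrier F" "b \<in> mcarrier F" "c \<in> mcarrier F" for q a b c
    using that F.mseminorm_triangle[of "a - b" "b - c"] by (auto simp: F.semi_diff_closed)
  have sub: "T ` mcarrier E \<subseteq> mcarrier F" by (auto simp: T_closed)
  have "continuous_map (subtopology (mtop E) (mcarrier E)) (mtop F) T"
    unfolding mtop_def
  proof (rule continuous_map_seminorm_lipschitz)
    fix q assume "q \<in> ?Q"
    then obtain p where p: "p \<in> cont_seminorms" "q = mseminorm F p" by blast
    then have "\<forall>x\<in>mcarrier E. \<forall>y\<in>mcarrier E. q (T y - T x) \<le> sqrt D * mseminorm E p (y - x)"
      by (auto simp: T_norm E.semi_diff_closed simp flip: T_diff)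
    then show "\<exists>p\<in>?P. \<exists>K>0. \<forall>x\<in>mcarrier E. \<forall>y\<in>mcarrier E. q (T y - T x) \<le> K * p (y - x)"
      using p(1) D_pos by (metis imageI real_sqrt_gt_zero)
  qed (rule P0 sub Qtri order_refl | assumption)+
  then have cont: "continuous_map (mtop E) (subtopology (mtop F) (T ` mcarrier E)) T"
    by (metis continuous_map_in_subtopology image_subset_iff_funcset mtop_def order_refl
        subtopology_topspace topspace_seminorm_topology)
  define T' where "T' = the_inv_into (mcarrier E) T"
  have T': "T' (T \<xi>) = \<xi>" if "\<xi> \<in> mcarrier E" for \<xi>
    using that T_injective by (simp add: T'_def the_inv_into_f_f)
  have inv: "continuous_map (subtopology (mtop F) (T ` mcarrier E)) (mtop E) T'"
    unfolding mtop_def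
  proof (rule continuous_map_seminorm_lipschitz)
    fix q assume "q \<in> ?P"
    then obtain p where p: "p \<in> cont_seminorms" "q = mseminorm E p" by blast
    have "q (T' (T y) - T' (T x)) \<le> (1 / sqrt C) * mseminorm F p (T y - T x)"
      if "x \<in> mcarrier E" "y \<in> mcarrier E" for x y
      using that p T_norm(1)[of "y - x" p] C_pos
      by (simp add: T' E.semi_diff_closed field_simps flip: T_diff)
    then have "\<forall>x\<in>T ` mcarrier E. \<forall>y\<in>T ` mcarrier E. q (T' y - T' x) \<le> (1 / sqrt C) * mseminorm F p (y - x)"
      by blast
    moreover have "1 / sqrt C > 0" using C_pos by simp
    ultimately show "\<exists>p\<in>?Q. \<exists>K>0. \<forall>x\<in>T ` mcarrier E. \<forall>y\<in>T ` mcarrier E. q (T' y - T' x) \<le> K * p (y - x)"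
      using p(1) by blast
  next
    show "T' ` T ` mcarrier E \<subseteq> mcarrier E" by (auto simp: T')
  qed (rule Q0 sub Ptri | assumption)+
  have "homeomorphic_maps (mtop E) (subtopology (mtop F) (T ` mcarrier E)) T T'"
    unfolding homeomorphic_maps_def using cont inv by (auto simp: T' mtop_def)
  then show ?thesis
    unfolding embedding_map_def homeomorphic_map_maps by (auto simp: mtop_def)
qed

text \<open>A point \<open>x\<close> off the range has a nonzero component \<open>y\<close>
  orthogonal to it. Pairing with \<open>y\<close> vanishes on the range but not at \<open>x\<close>,
  and by the Cauchy--Schwarz inequality it stays nonzero near \<open>x\<close>.\<close>

lemma T_image_closed: "closedin (mtop F) (T ` mcarrier E)"
proof -
  let ?N = "T ` mcarrier E" and ?Q = "mseminorm F ` cont_seminorms"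
  have "openin (subtopology (seminorm_topology (mcarrier F) ?Q) (mcarrier F)) (mcarrier F - ?N)"
  proof (rule openin_subtopology_seminorm)
    fix x assume x: "x \<in> mcarrier F - ?N"
    define y where "y = x - T (K (S x))"
    have KS: "K (S x) \<in> mcarrier E" using x by (simp add: K_closed S_closed)
    have y: "y \<in> mcarrier F" and orth: "\<And>\<zeta>. \<zeta> \<in> mcarrier E \<Longrightarrow> minner F (T \<zeta>) y = 0"
      using orthogonal_decomposition[of x] x by (auto simp: y_def orth_compl_def)
    have orth': "minner F y (T \<zeta>) = 0" if "\<zeta> \<in> mcarrier E" for \<zeta>
      using F.semi_inner_star[OF T_closed[OF that] y] orth[OF that] by simp
    have "y \<noteq> 0" using x KS by (auto simp: y_def)
    then have "minner F y y \<noteq> 0" using F.definite[OF y] by blast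
    moreover have "minner F y y = minner F y x - minner F y (T (K (S x)))"
      using F.inner_diff_right[OF y _ T_closed[OF KS], of x] x by (simp add: y_def)
    ultimately have "minner F y x \<noteq> 0" using orth'[OF KS] by simp
    then obtain p where p: "p \<in> cont_seminorms" "p (minner F y x) \<noteq> 0"
      using eq_zero_if_cont_seminorms by blast
    interpret cstar_seminormed p using p(1) by (rule cstar_seminormed_cont)
    let ?e = "p (minner F y x) / (mseminorm F p y + 1)"
    have y0: "0 \<le> mseminorm F p y" by (rule F.mseminorm_nonneg[OF p(1)])
    have "?e > 0" using p(2) nonneg[of "minner F y x"] y0 by (simp add: less_le)
    moreover have "{z \<in> mcarrier F. mseminorm F p (z - x) < ?e} \<subseteq> mcarrier F - ?N"
    proof
      fix z assume "z \<in> {z \<in> mcarrier F. mseminorm F p (z - x) < ?e}"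
      then have z: "z \<in> mcarrier F" "mseminorm F p (z - x) < ?e" by auto
      have "z \<notin> ?N"
      proof
        assume "z \<in> ?N"
        then have "minner F y z = 0" using orth' by blast
        then have "p (minner F y x) = p (minner F y (z - x))"
          using x y z by (simp add: F.inner_diff_right)
        also have "\<dots> \<le> mseminorm F p y * mseminorm F p (z - x)"
          using x y z p by (intro F.cauchy_schwarz F.semi_diff_closed) auto
        also have "\<dots> \<le> (mseminorm F p y + 1) * mseminorm F p (z - x)"
          using F.mseminorm_nonneg[OF p(1)] by (intro mult_right_mono) auto
        also have "\<dots> < p (minner F y x)" using z(2) y0 by (simp add: field_simps)
        finally show False by simp
      qed
      with z show "z \<in> mcarrier F - ?N" by blast
    qed
    ultimately show "\<exists>p\<in>?Q. \<exists>\<epsilon>>0. {y \<in> mcarrier F. p (y - x) < \<epsilon>} \<subseteq> mcarrier F - ?N"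
      using p(1) by blast
  qed (auto simp: F.mseminorm_zero)
  then have "openin (mtop F) (mcarrier F - ?N)"
    by (metis mtop_def subtopology_topspace topspace_seminorm_topology)
  then show ?thesis by (auto simp: closedin_def mtop_def T_closed)
qed

theorem T_image_orthogonal_summand: "orthogonal_summand F (T ` mcarrier E)"
proof -
  let ?N = "T ` mcarrier E"
  have "closed_submodule F ?N"
    unfolding closed_submodule_def
  proof (intro conjI ballI allI)
    show "0 \<in> ?N" using T_zero E.semi_zero_closed by (metis imageI)
    show "\<xi> + \<eta> \<in> ?N" if "\<xi> \<in> ?N" "\<eta> \<in> ?N" for \<xi> \<eta>
      using that by (auto simp: E.semi_add_closed simp flip: T_simps)
    show "mscale F c \<xi> \<in> ?N" if "\<xi> \<in> ?N" for c \<xi>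
      using that by (auto simp: E.semi_scale_closed simp flip: T_simps)
    show "mact F \<xi> a \<in> ?N" if "\<xi> \<in> ?N" for a \<xi>
      using that by (auto simp: E.semi_act_closed simp flip: T_simps)
  qed (auto simp: T_closed T_image_closed)
  moreover have "mcarrier F = {\<xi> + \<eta> | \<xi> \<eta>. \<xi> \<in> ?N \<and> \<eta> \<in> orth_compl F ?N}"
  proof (intro equalityI subsetI)
    fix x assume x: "x \<in> mcarrier F"
    then have "x = T (K (S x)) + (x - T (K (S x)))" "T (K (S x)) \<in> ?N"
      by (simp_all add: K_closed S_closed)
    with orthogonal_decomposition[OF x]
    show "x \<in> {\<xi> + \<eta> | \<xi> \<eta>. \<xi> \<in> ?N \<and> \<eta> \<in> orth_compl F ?N}" by blast
  qed (auto simp: orth_compl_def T_closed F.semi_add_closed)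
  moreover have "?N \<inter> orth_compl F ?N = {0}"
  proof (intro equalityI subsetI)
    fix x assume "x \<in> {0::'f}"
    moreover have "0 \<in> ?N" using T_zero E.semi_zero_closed by (metis imageI)
    ultimately show "x \<in> ?N \<inter> orth_compl F ?N"
      by (auto simp: orth_compl_def F.semi_zero_closed F.inner_zero_right T_closed)
  qed (auto simp: orth_compl_def intro: F.definite)
  ultimately show ?thesis by (simp add: orthogonal_summand_def)
qed

theorem T_embeds: "embeds_onto_orthogonal_summand E F T"
  by (simp add: embeds_onto_orthogonal_summand_def T_injective T_embedding T_image_orthogonal_summand)

end

section \<open>The frame transform\<close>

locale frame_of_multipliers = hilbert_module E
  for E :: "('a::pro_cstar_algebra, 'e::ab_group_add) cmodule" +
  fixes h :: "nat \<Rightarrow> 'a \<Rightarrow> 'e"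
  assumes frame: "standard_frame_of_multipliers E h"
begin

sublocale E: definite_inner_module E
  by (rule definite_inner_module_pre_hilbert) unfold_locales

sublocale H: definite_inner_module "H_mod :: ('a, nat \<Rightarrow> 'a) cmodule"
  by (rule definite_inner_module_H_mod)

abbreviation \<theta> where "\<theta> \<equiv> frame_transform E h"

lemma h_adjoint: "is_adjoint alg_module E (h n) (mult_inner E (h n))"
proof -
  have "h n \<in> multipliers E" using frame by (auto simp: standard_frame_of_multipliers_def)
  then have "is_adjoint alg_module E (h n) (adj alg_module E (h n))"
    unfolding multipliers_def L_def adj_def by (auto intro: someI[of "is_adjoint alg_module E (h n)"])
  moreover have "mult_inner E (h n) = adj alg_module E (h n)" by (rule ext) (simp add: mult_inner_def)
  ultimately show ?thesis by simp
qed

lemma h_closed: "h n a \<in> mcarrier E"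
proof -
  have "h n \<in> multipliers E" using frame by (auto simp: standard_frame_of_multipliers_def)
  then show ?thesis by (auto simp: multipliers_def L_def module_morphism_def alg_module_def)
qed

lemma inner_h_left: "\<xi> \<in> mcarrier E \<Longrightarrow> minner E (h n a) \<xi> = star a * \<theta> \<xi> n"
  using h_adjoint[of n] by (simp add: is_adjoint_def alg_module_def frame_transform_def)

lemma inner_h_right: "\<xi> \<in> mcarrier E \<Longrightarrow> minner E \<xi> (h n a) = star (\<theta> \<xi> n) * a"
  using inner_h_left[of \<xi> n a] E.semi_inner_star[OF h_closed, of \<xi> n a] by (simp add: star_mult star_star)

lemma frame_term: "inner_mult E \<xi> (h n) * mult_inner E (h n) \<xi> = star (\<theta> \<xi> n) * \<theta> \<xi> n"
  by (simp add: inner_mult_def mult_inner_def frame_transform_def)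

lemma \<theta>_closed: "\<xi> \<in> mcarrier E \<Longrightarrow> \<theta> \<xi> \<in> mcarrier H_mod"
  using frame by (simp add: standard_frame_of_multipliers_def frame_term)

text \<open>A frame's constants come unordered: for the zero module all positive \<open>C\<close>
  and \<open>D\<close> qualify. Lowering \<open>C\<close> to \<open>min C D\<close> supplies the
  ordering for the contraction argument.\<close>

lemma frame_bounds:
  obtains C D where "0 < C" "C \<le> D"
    "\<And>\<xi> p. \<xi> \<in> mcarrier E \<Longrightarrow> p \<in> cont_seminorms \<Longrightarrow>
      cpos p (minner H_mod (\<theta> \<xi>) (\<theta> \<xi>) - scaleC (complex_of_real C) (minner E \<xi> \<xi>))"
    "\<And>\<xi> p. \<xi> \<in> mcarrier E \<Longrightarrow> p \<in> cont_seminorms \<Longrightarrow>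
      cpos p (scaleC (complex_of_real D) (minner E \<xi> \<xi>) - minner H_mod (\<theta> \<xi>) (\<theta> \<xi>))"
proof -
  obtain C D where CD: "0 < C" "0 < D"
    and bounds: "\<forall>\<xi>\<in>mcarrier E.
      scaleC (complex_of_real C) (minner E \<xi> \<xi>) \<preceq> minner H_mod (\<theta> \<xi>) (\<theta> \<xi>) \<and>
      minner H_mod (\<theta> \<xi>) (\<theta> \<xi>) \<preceq> scaleC (complex_of_real D) (minner E \<xi> \<xi>)"
    using frame unfolding standard_frame_of_multipliers_def frame_term H_mod_simps by blast
  have lower: "cpos p (minner H_mod (\<theta> \<xi>) (\<theta> \<xi>) - scaleC (complex_of_real C) (minner E \<xi> \<xi>))"
    and upper: "cpos p (scaleC (complex_of_real D) (minner E \<xi> \<xi>) - minner H_mod (\<theta> \<xi>) (\<theta> \<xi>))"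
    if "\<xi> \<in> mcarrier E" "p \<in> cont_seminorms" for \<xi> p
    using bounds that unfolding cstar_le_def by (blast intro: cpos_of_cstar_positive)+
  show thesis
  proof (rule that[of "min C D" D])
    fix \<xi> and p :: "'a \<Rightarrow> real" assume *: "\<xi> \<in> mcarrier E" "p \<in> cont_seminorms"
    interpret cstar_seminormed p using *(2) by (rule cstar_seminormed_cont)
    have "cpos p ((minner H_mod (\<theta> \<xi>) (\<theta> \<xi>) - scaleC (complex_of_real C) (minner E \<xi> \<xi>)) +
        scaleC (complex_of_real (C - min C D)) (minner E \<xi> \<xi>))"
      using * by (intro cpos_add lower cpos_scale E.semi_inner_cpos) auto
    moreover have "scaleC (complex_of_real C) (minner E \<xi> \<xi>) =
        scaleC (complex_of_real (C - min C D)) (minner E \<xi> \<xi>) +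
        scaleC (complex_of_real (min C D)) (minner E \<xi> \<xi>)"
      by (simp flip: scaleC_add_left)
    ultimately show "cpos p (minner H_mod (\<theta> \<xi>) (\<theta> \<xi>) -
        scaleC (complex_of_real (min C D)) (minner E \<xi> \<xi>))" by (simp del: H_mod_simps)
  qed (use CD upper in auto)
qed

text \<open>A duality argument that works before the adjoint is known to exist: pairing the sum
  \<open>y\<close> with itself produces the coefficients of \<open>\<theta> y\<close>, which the
  upper bound controls by \<open>y\<close>, and one factor \<open>?a\<close> cancels.\<close>

lemma synthesis_sum_norm:
  assumes "finite I" "p \<in> cont_seminorms"
    and D: "0 \<le> D" "\<And>\<xi>. \<xi> \<in> mcarrier E \<Longrightarrow> p (minner H_mod (\<theta> \<xi>) (\<theta> \<xi>)) \<le> D * p (minner E \<xi> \<xi>)"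
  shows "(mseminorm E p (\<Sum>n\<in>I. h n (x n)))\<^sup>2 \<le> D * p (\<Sum>n\<in>I. star (x n) * x n)"
proof -
  interpret cstar_seminormed p using assms(2) by (rule cstar_seminormed_cont)
  define y where "y = (\<Sum>n\<in>I. h n (x n))"
  have y: "y \<in> mcarrier E" unfolding y_def by (intro E.semi_sum_closed h_closed)
  let ?a = "p (minner E y y)" and ?s = "p (\<Sum>n\<in>I. star (x n) * x n)"
  have "minner E y y = (\<Sum>n\<in>I. star (\<theta> y n) * x n)"
    using y by (subst (2) y_def) (simp add: E.inner_sum_right h_closed inner_h_right)
  then have "?a\<^sup>2 \<le> ?s * p (\<Sum>n\<in>I. star (\<theta> y n) * \<theta> y n)"
    using star_mult_sum_cauchy_schwarz[OF assms(2), of "\<theta> y" x I] by (simp add: mult.commute)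
  also have "\<dots> \<le> ?s * p (minner H_mod (\<theta> y) (\<theta> y))"
    unfolding H_mod_simps
    by (intro mult_left_mono sum_le_suminf_seminorm assms cpos_star_mult nonneg)
      (use \<theta>_closed[OF y] in simp)
  also have "\<dots> \<le> ?s * (D * ?a)" by (intro mult_left_mono D(2) y nonneg)
  finally have *: "?a * ?a \<le> (D * ?s) * ?a" by (simp add: power2_eq_square mult_ac)
  have "?a \<le> D * ?s"
  proof (cases "?a = 0")
    case True
    then show ?thesis using D(1) by simp
  next
    case False
    then show ?thesis
      using * nonneg[of "minner E y y"] by (simp add: mult_le_cancel_right less_le)
  qed
  then show ?thesis using assms(2) by (simp add: E.mseminorm_squared flip: y_def)
qed

text \<open>\<open>\<eta>\<close> is the sum of the series with terms \<open>h n (x n)\<close>;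
  \<open>synthesis_sum_norm\<close>, applied to blocks, makes its partial sums Cauchy.\<close>

lemma adjoint_value:
  assumes x: "x \<in> mcarrier H_mod"
  shows "\<exists>\<eta>\<in>mcarrier E. \<forall>\<xi>\<in>mcarrier E. minner H_mod (\<theta> \<xi>) x = minner E \<xi> \<eta>"
proof -
  obtain C D where CD: "0 < C" "C \<le> D"
    and upper: "\<And>\<xi> p. \<xi> \<in> mcarrier E \<Longrightarrow> p \<in> cont_seminorms \<Longrightarrow>
      cpos p (scaleC (complex_of_real D) (minner E \<xi> \<xi>) - minner H_mod (\<theta> \<xi>) (\<theta> \<xi>))"
    using frame_bounds by metis
  have D: "0 < D" using CD by simp
  define y where "y N = (\<Sum>n<N. h n (x n))" for N
  have y: "y N \<in> mcarrier E" for N unfolding y_def by (intro E.semi_sum_closed h_closed)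
  obtain \<eta> where \<eta>: "\<eta> \<in> mcarrier E"
    and lim: "\<And>q. q \<in> mseminorm E ` cont_seminorms \<Longrightarrow> (\<lambda>N. q (y N - \<eta>)) \<longlonglongrightarrow> 0"
  proof (rule seminorm_complete_sequence[OF complete, of y])
    show "y N \<in> mcarrier E" for N by (rule y)
    fix q and \<epsilon> :: real assume "q \<in> mseminorm E ` cont_seminorms" and \<epsilon>: "\<epsilon> > 0"
    then obtain p where p: "p \<in> cont_seminorms" "q = mseminorm E p" by blast
    interpret cstar_seminormed p using p(1) by (rule cstar_seminormed_cont)
    have bound: "p (minner H_mod (\<theta> \<xi>) (\<theta> \<xi>)) \<le> D * p (minner E \<xi> \<xi>)" if "\<xi> \<in> mcarrier E" for \<xi>
      using cpos_mono_diff[OF H.semi_inner_cpos upper[OF that p(1)]] \<theta>_closed[OF that] p(1) D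
      by (simp add: homogeneous del: H_mod_simps)
    have "\<epsilon>\<^sup>2 / D > 0" using \<epsilon> D by simp
    then obtain N where N: "\<And>n m. n \<ge> N \<Longrightarrow> p (\<Sum>k=n..<m. star (x k) * x k) < \<epsilon>\<^sup>2 / D"
      using x p(1) unfolding H_mod_simps summable_iff_cauchy by blast
    have *: "q (y m - y n) < \<epsilon>" if "n \<ge> N" "n \<le> m" for m n
    proof (rule power2_less_imp_less)
      have "y m - y n = (\<Sum>k=n..<m. h k (x k))"
        using sum_diff_nat_ivl[of 0 n m "\<lambda>k. h k (x k)"] that by (simp add: y_def atLeast0LessThan)
      then have "(q (y m - y n))\<^sup>2 \<le> D * p (\<Sum>k=n..<m. star (x k) * x k)"
        using synthesis_sum_norm[OF _ p(1) less_imp_le[OF D] bound, of "{n..<m}" x] p(2) by simp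
      also have "\<dots> < \<epsilon>\<^sup>2" using N[OF that(1), of m] D by (simp add: field_simps)
      finally show "(q (y m - y n))\<^sup>2 < \<epsilon>\<^sup>2" .
    qed (use \<epsilon> in simp)
    have "q (y m - y n) < \<epsilon>" if "n \<ge> N" "m \<ge> N" for n m
      using *[of n m] *[of m n] that E.mseminorm_minus_commute[OF y y, of p m n] p(2)
      by (cases "n \<le> m") auto
    then show "\<exists>N. \<forall>m\<ge>N. \<forall>n\<ge>N. q (y m - y n) < \<epsilon>" by blast
  qed blast
  have "minner H_mod (\<theta> \<xi>) x = minner E \<xi> \<eta>" if \<xi>: "\<xi> \<in> mcarrier E" for \<xi>
  proof -
    have "(\<lambda>N. minner E \<xi> (y N)) \<longlonglongrightarrow> minner E \<xi> \<eta>"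
      using lim by (intro E.tendsto_inner y \<eta> \<xi>) blast
    moreover have "minner E \<xi> (y N) = (\<Sum>n<N. star (\<theta> \<xi> n) * x n)" for N
      using \<xi> by (simp add: y_def E.inner_sum_right h_closed inner_h_right)
    moreover have "(\<lambda>N. \<Sum>n<N. star (\<theta> \<xi> n) * x n) \<longlonglongrightarrow> minner H_mod (\<theta> \<xi>) x"
      unfolding H_mod_simps using \<theta>_closed[OF \<xi>] x by (intro summable_LIMSEQ H_mod_summable)
    ultimately show ?thesis using LIMSEQ_unique by simp
  qed
  with \<eta> show ?thesis by blast
qed

text \<open>\<open>adj\<close> chooses among the adjoints, so one has to be exhibited; it is
  assembled pointwise from \<open>adjoint_value\<close>.\<close>

lemma frame_transform_adjoint: "is_adjoint E H_mod \<theta> (adj E H_mod \<theta>)"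
proof -
  from adjoint_value obtain S where "\<And>x. x \<in> mcarrier H_mod \<Longrightarrow> S x \<in> mcarrier E"
    "\<And>x \<xi>. x \<in> mcarrier H_mod \<Longrightarrow> \<xi> \<in> mcarrier E \<Longrightarrow> minner H_mod (\<theta> \<xi>) x = minner E \<xi> (S x)"
    by metis
  then have "is_adjoint E H_mod \<theta> S"
    using \<theta>_closed by (intro is_adjointI E.definite_inner_module_axioms H.definite_inner_module_axioms) auto
  then show ?thesis unfolding adj_def by (rule someI[of "is_adjoint E H_mod \<theta>"])
qed

text \<open>Pairing with \<open>std_mult n a\<close> selects the \<open>n\<close>-th coefficient of
  \<open>\<theta> \<xi>\<close>, which is how \<open>h n\<close> pairs with \<open>\<xi>\<close>.
  Equality holds for all arguments because the carrier of \<open>alg_module\<close> is the whole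
  type.\<close>

lemma adjoint_std_mult: "adj E H_mod \<theta> \<circ> std_mult n = h n"
proof
  fix a
  have closed: "adj E H_mod \<theta> (std_mult n a) \<in> mcarrier E"
    using frame_transform_adjoint std_mult_in_H_mod[of n a] by (auto simp: is_adjoint_def module_morphism_def)
  have "minner E \<xi> (adj E H_mod \<theta> (std_mult n a)) = minner E \<xi> (h n a)" if \<xi>: "\<xi> \<in> mcarrier E" for \<xi>
  proof -
    have "minner E \<xi> (adj E H_mod \<theta> (std_mult n a)) = minner H_mod (\<theta> \<xi>) (std_mult n a)"
      using frame_transform_adjoint \<xi> std_mult_in_H_mod[of n a] unfolding is_adjoint_def by metis
    also have "\<dots> = star (minner H_mod (std_mult n a) (\<theta> \<xi>))"
      by (rule H_mod_star[symmetric]) (rule std_mult_in_H_mod \<theta>_closed \<xi>)+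
    also have "\<dots> = minner E \<xi> (h n a)"
      unfolding inner_std_mult inner_h_right[OF \<xi>] by (simp add: star_mult star_star)
    finally show ?thesis .
  qed
  then show "(adj E H_mod \<theta> \<circ> std_mult n) a = h n a"
    using E.inner_eqI[OF closed h_closed] by simp
qed

end

theorem theorem3p11:
  fixes E :: "('a::pro_cstar_algebra, 'e::ab_group_add) cmodule"
    and h :: "nat \<Rightarrow> 'a \<Rightarrow> 'e"
  assumes "hilbert_module E"
    and "countably_generated_in_multipliers E"
    and "standard_frame_of_multipliers E h"
  shows "frame_transform E h \<in> L E H_mod \<and>
         embeds_onto_orthogonal_summand E H_mod (frame_transform E h) \<and>
         (\<forall>n. adj E H_mod (frame_transform E h) \<circ> std_mult n = h n) \<and>
         invertible_in_bL E (adj E H_mod (frame_transform E h) \<circ> frame_transform E h)"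
proof -
  interpret hilbert_module E by fact
  interpret frame_of_multipliers E h
    by unfold_locales fact
  obtain C D where "0 < C" "C \<le> D"
    "\<And>\<xi> p. \<xi> \<in> mcarrier E \<Longrightarrow> p \<in> cont_seminorms \<Longrightarrow>
      cpos p (minner H_mod (\<theta> \<xi>) (\<theta> \<xi>) - scaleC (complex_of_real C) (minner E \<xi> \<xi>))"
    "\<And>\<xi> p. \<xi> \<in> mcarrier E \<Longrightarrow> p \<in> cont_seminorms \<Longrightarrow>
      cpos p (scaleC (complex_of_real D) (minner E \<xi> \<xi>) - minner H_mod (\<theta> \<xi>) (\<theta> \<xi>))"
    using frame_bounds by blast
  \<comment> \<open>All claims but the recovery of the \<open>h n\<close> become instances of
    results on coercive morphisms.\<close>
  then interpret coercive_morphism E H_mod \<theta> "adj E H_mod \<theta>" C D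
    by unfold_locales (use complete \<theta>_closed frame_transform_adjoint in auto)
  show ?thesis
    using T_in_L T_embeds adjoint_comp_invertible adjoint_std_mult by blast
qed

end
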